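(* Let $n\ge 2$, $1<p<\infty$, and let $\Omega\subset\mathbb{R}^n$ be bounded, open and strictly convex. Let $\sigma_1,\sigma_2$ be positive continuous functions on $\overline{\Omega}$. If $\Lambda_{\sigma_1}=\Lambda_{\sigma_2}$, then $\sigma_1|_{\partial\Omega}=\sigma_2|_{\partial\Omega}$.
   Context: Strictly convex means convex with boundary containing no nondegenerate line segment. Dirichlet-Neumann map: let $X=W^{1,p}(\Omega)/W^{1,p}_0(\Omega)$ with dual $X'$. For $\sigma\in L^\infty(\Omega;\mathbb{R})$ with $\operatorname{ess\,inf}\sigma>0$ and $f\in X$ let $u_\sigma^f$ be the unique minimizer of $E_\sigma(u)=\int_\Omega \sigma|\nabla u|^p\,dx$ over $f+W^{1,p}_0(\Omega)$ (equivalently the weak solution of $\mathrm{div}(\sigma|\nabla u|^{p-2}\nabla u)=0$ in $\Omega$ with boundary value $f$). Then $\Lambda_\sigma:X\to X'$ is the (nonlinear) map $$(\Lambda_\sigma(f),g)=\int_\Omega \sigma|\nabla u_\sigma^f|^{p-2}\nabla u_\sigma^f\cdot\nabla v^g\,dx,\qquad f,g\in X,$$ where $v^g\in W^{1,p}(\Omega)$ is any representative of $g$. *)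

theory Defs
  imports "HOL-Analysis.Analysis"
begin

definition strictly_convex :: "'a::euclidean_space set \<Rightarrow> bool" where
  "strictly_convex S \<longleftrightarrow>
     convex S \<and> (\<nexists>a b. a \<noteq> b \<and> closed_segment a b \<subseteq> frontier S)"


section \<open>Test functions\<close>

definition partial :: "'n \<Rightarrow> (real^'n \<Rightarrow> real) \<Rightarrow> real^'n \<Rightarrow> real" where
  "partial i f x = frechet_derivative f (at x) (axis i 1)"

primrec C_k :: "nat \<Rightarrow> (real^'n \<Rightarrow> real) \<Rightarrow> bool" where
  "C_k 0 f \<longleftrightarrow> continuous_on UNIV f"
| "C_k (Suc k) f \<longleftrightarrow> (\<forall>x. f differentiable (at x)) \<and> (\<forall>i. C_k k (partial i f))"

definition test_functions :: "(real^'n) set \<Rightarrow> (real^'n \<Rightarrow> real) set" where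
  "test_functions \<Omega> =
     {\<phi>. (\<forall>k. C_k k \<phi>) \<and> compact (closure {x. \<phi> x \<noteq> 0}) \<and> closure {x. \<phi> x \<noteq> 0} \<subseteq> \<Omega>}"


section \<open>Sobolev spaces\<close>

text \<open>
  Elements of \<open>L\<^sup>p(\<Omega>)\<close> and \<open>W\<^sup>1\<^sup>,\<^sup>p(\<Omega>)\<close> are represented by functions on the whole space; values
  outside \<open>\<Omega>\<close> are irrelevant, and functions that agree almost everywhere in \<open>\<Omega>\<close> are not
  identified at this level.
\<close>

definition Lp :: "(real^'n) set \<Rightarrow> real \<Rightarrow> (real^'n \<Rightarrow> 'b::euclidean_space) set" where
  "Lp \<Omega> p = {f. f \<in> borel_measurable (lebesgue_on \<Omega>) \<and>
                integrable (lebesgue_on \<Omega>) (\<lambda>x. norm (f x) powr p)}"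

definition has_weak_gradient ::
    "(real^'n) set \<Rightarrow> real \<Rightarrow> (real^'n \<Rightarrow> real) \<Rightarrow> (real^'n \<Rightarrow> real^'n) \<Rightarrow> bool" where
  "has_weak_gradient \<Omega> p u G \<longleftrightarrow>
     u \<in> Lp \<Omega> p \<and> G \<in> Lp \<Omega> p \<and>
     (\<forall>\<phi>\<in>test_functions \<Omega>. \<forall>i.
        (\<integral>x. u x * partial i \<phi> x \<partial>lebesgue_on \<Omega>) = - (\<integral>x. G x $ i * \<phi> x \<partial>lebesgue_on \<Omega>))"

definition W1p :: "(real^'n) set \<Rightarrow> real \<Rightarrow> (real^'n \<Rightarrow> real) set" where
  "W1p \<Omega> p = {u. \<exists>G. has_weak_gradient \<Omega> p u G}"

text \<open>The weak gradient is determined only almost everywhere in \<open>\<Omega>\<close>.\<close>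

definition weak_gradient ::
    "(real^'n) set \<Rightarrow> real \<Rightarrow> (real^'n \<Rightarrow> real) \<Rightarrow> real^'n \<Rightarrow> real^'n" where
  "weak_gradient \<Omega> p u = (SOME G. has_weak_gradient \<Omega> p u G)"

definition W1p_norm :: "(real^'n) set \<Rightarrow> real \<Rightarrow> (real^'n \<Rightarrow> real) \<Rightarrow> real" where
  "W1p_norm \<Omega> p u =
     ((\<integral>x. \<bar>u x\<bar> powr p \<partial>lebesgue_on \<Omega>) +
      (\<integral>x. norm (weak_gradient \<Omega> p u x) powr p \<partial>lebesgue_on \<Omega>)) powr (1 / p)"

definition W1p0 :: "(real^'n) set \<Rightarrow> real \<Rightarrow> (real^'n \<Rightarrow> real) set" where
  "W1p0 \<Omega> p =
     {u \<in> W1p \<Omega> p. \<forall>e>0. \<exists>\<phi>\<in>test_functions \<Omega>. W1p_norm \<Omega> p (\<lambda>x. u x - \<phi> x) < e}"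


section \<open>The Dirichlet-Neumann map\<close>

text \<open>
  The quotient \<open>W\<^sup>1\<^sup>,\<^sup>p(\<Omega>) / W\<^sup>1\<^sup>,\<^sup>p\<^sub>0(\<Omega>)\<close>: its elements are the affine classes
  \<open>f + W\<^sup>1\<^sup>,\<^sup>p\<^sub>0(\<Omega>)\<close>. Functions vanishing almost everywhere in \<open>\<Omega>\<close> belong to
  \<open>W\<^sup>1\<^sup>,\<^sup>p\<^sub>0(\<Omega>)\<close>, so the classes also absorb equality almost everywhere.
\<close>

definition boundary_space :: "(real^'n) set \<Rightarrow> real \<Rightarrow> (real^'n \<Rightarrow> real) set set" where
  "boundary_space \<Omega> p =
     W1p \<Omega> p // {(u, v). u \<in> W1p \<Omega> p \<and> v \<in> W1p \<Omega> p \<and> (\<lambda>x. u x - v x) \<in> W1p0 \<Omega> p}"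

definition energy ::
    "(real^'n) set \<Rightarrow> real \<Rightarrow> (real^'n \<Rightarrow> real) \<Rightarrow> (real^'n \<Rightarrow> real) \<Rightarrow> real" where
  "energy \<Omega> p \<sigma> u =
     (\<integral>x. \<sigma> x * norm (weak_gradient \<Omega> p u x) powr p \<partial>lebesgue_on \<Omega>)"

text \<open>
  The minimizer of the energy over the class \<open>f = u + W\<^sup>1\<^sup>,\<^sup>p\<^sub>0(\<Omega>)\<close> is unique as an element of
  \<open>W\<^sup>1\<^sup>,\<^sup>p(\<Omega>)\<close>, that is, up to equality almost everywhere in \<open>\<Omega>\<close>.
\<close>

definition minimizer ::
    "(real^'n) set \<Rightarrow> real \<Rightarrow> (real^'n \<Rightarrow> real) \<Rightarrow> (real^'n \<Rightarrow> real) set \<Rightarrow> real^'n \<Rightarrow> real" where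
  "minimizer \<Omega> p \<sigma> f =
     (SOME u. u \<in> f \<and> (\<forall>w\<in>f. energy \<Omega> p \<sigma> u \<le> energy \<Omega> p \<sigma> w))"

text \<open>
  The map is extensional on the quotient space in both arguments, so that equality of two such
  maps means equality of all pairings. At points where the gradient vanishes, the flux
  \<open>|\<nabla>u|\<^sup>p\<^sup>-\<^sup>2 \<nabla>u\<close> evaluates to zero, also for \<open>p < 2\<close>. The value does not depend on the chosen
  representative of \<open>g\<close>.
\<close>

definition DN_map ::
    "(real^'n) set \<Rightarrow> real \<Rightarrow> (real^'n \<Rightarrow> real) \<Rightarrow>
     (real^'n \<Rightarrow> real) set \<Rightarrow> (real^'n \<Rightarrow> real) set \<Rightarrow> real" where
  "DN_map \<Omega> p \<sigma> =
     (\<lambda>f\<in>boundary_space \<Omega> p. \<lambda>g\<in>boundary_space \<Omega> p.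
        let Du = weak_gradient \<Omega> p (minimizer \<Omega> p \<sigma> f);
            Dv = weak_gradient \<Omega> p (SOME v. v \<in> g)
        in \<integral>x. \<sigma> x * norm (Du x) powr (p - 2) * (Du x \<bullet> Dv x) \<partial>lebesgue_on \<Omega>)"

end

theory Submission
  imports Defs
begin

text \<open>
  The idea is to compare energies. By the Euler-Lagrange equation the number \<open>(\<Lambda> f, f)\<close> is the
  minimal energy in the class \<open>f\<close> (\<open>DN_map_diagonal\<close>), so equal Dirichlet-Neumann maps have equal
  minimal energies for all boundary data. It is therefore enough to find boundary data whose
  minimal energy reads off \<open>\<sigma>(x0)\<close> at a given boundary point \<open>x0\<close>.

  Let \<open>v\<close> be \<open>p\<close>-harmonic in the whole space, with nonvanishing gradient \<open>V\<close>. For the boundary data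
  of \<open>v\<close>, the minimal energy is at most \<open>\<integral> \<sigma> |V|\<^sup>p\<close>, because \<open>v\<close> itself competes. It is bounded
  below as well (\<open>min_energy_ge\<close>): the field \<open>|V|\<^sup>p\<^sup>-\<^sup>2 V\<close> is divergence free, so its pairing with
  the gradient of any competitor depends on the boundary data only, and convexity of \<open>|.|\<^sup>p\<close> turns
  this into a lower bound \<open>\<integral> g |V|\<^sup>p\<close>, where \<open>g\<close> is an explicit continuous function of \<open>\<sigma>\<close> with
  \<open>g(x0) = \<sigma>(x0)\<close>. Hence equality of the two maps gives \<open>\<integral> (\<sigma>1 - g2) |V|\<^sup>p \<ge> 0\<close> for every such
  \<open>v\<close>. If \<open>\<sigma>1(x0) < \<sigma>2(x0)\<close>, the continuous function \<open>\<sigma>1 - g2\<close> is negative near \<open>x0\<close>, and a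
  contradiction arises once \<open>|V|\<^sup>p\<close> concentrates at \<open>x0\<close>.

  Wolff's solutions \<open>v(x) = exp (\<tau> (x \<bullet> \<rho>)) a(\<tau> (x \<bullet> e))\<close>, with orthonormal \<open>\<rho>\<close>, \<open>e\<close> and a bounded
  profile \<open>a\<close>, have \<open>|V|\<^sup>p\<close> comparable to \<open>exp (p \<tau> (x \<bullet> \<rho>))\<close> (\<open>wolff_solutions\<close>); this is where
  dimension at least two is used. If \<open>\<rho>\<close> is an outer normal of a supporting hyperplane at \<open>x0\<close>, then
  by strict convexity the caps cut off near \<open>x0\<close> shrink to \<open>x0\<close> (\<open>supporting_direction\<close>), and
  letting \<open>\<tau>\<close> grow gives the concentration (\<open>negative_at_peak_imp_negative_integral\<close>).

  The minimizer in the Dirichlet-Neumann map and the weak gradients are choices, so the comparison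
  needs the direct method in full: weak gradients are unique almost everywhere
  (\<open>fundamental_lemma_calculus_of_variations\<close>), and minimizers exist (\<open>exists_minimizer\<close>). For the
  latter, minimizing sequences are Cauchy: a quantitative form of strict convexity
  (\<open>uniform_convexity_gap\<close>) controls their gradients, Poincare's inequality controls the functions,
  and the functions with integrable \<open>p\<close>-th power form a complete space (\<open>lp_complete\<close>).
\<close>

section \<open>Directional derivatives of compactly supported functions, and test functions\<close>

lemma continuous_bounded_support_bounded:
  fixes g :: "'a::euclidean_space \<Rightarrow> real"
  assumes "continuous_on UNIV g" "\<And>x. r < norm x \<Longrightarrow> g x = 0"
  obtains K where "K \<ge> 0" "\<And>x. \<bar>g x\<bar> \<le> K"
proof -
  have "compact (g ` cball 0 r)"
    by (intro compact_continuous_image continuous_on_subset[OF assms(1)]) auto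
  then have "bounded (g ` cball 0 r)" by (rule compact_imp_bounded)
  then obtain K where K: "\<And>x. norm x \<le> r \<Longrightarrow> \<bar>g x\<bar> \<le> K"
    unfolding bounded_iff by (metis imageI mem_cball_0 real_norm_def)
  have "\<bar>g x\<bar> \<le> max K 0" for x
    using K[of x] assms(2)[of x] by (cases "norm x \<le> r") auto
  then show ?thesis using that[of "max K 0"] by simp
qed

lemma integrable_continuous_bounded_support:
  fixes g :: "'a::euclidean_space \<Rightarrow> real"
  assumes "continuous_on UNIV g" "\<And>x. r < norm x \<Longrightarrow> g x = 0"
  shows "integrable lborel g"
proof -
  have "integrable lborel (\<lambda>x. indicator (cball 0 r) x *\<^sub>R g x)"
    by (intro borel_integrable_compact continuous_on_subset[OF assms(1)]) auto
  moreover have "(\<lambda>x. indicator (cball 0 r) x *\<^sub>R g x) = g"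
    using assms(2) by (auto simp: indicator_def fun_eq_iff not_le)
  ultimately show ?thesis by simp
qed

lemma lborel_integral_translate:
  fixes f :: "'a::euclidean_space \<Rightarrow> real"
  assumes [measurable]: "f \<in> borel_measurable borel"
  shows "(\<integral>x. f (c + x) \<partial>lborel) = (\<integral>x. f x \<partial>lborel)"
proof -
  have "(\<integral>x. f x \<partial>lborel) = (\<integral>x. f x \<partial>(distr lborel borel ((+) c)))"
    by (simp add: lborel_distr_plus)
  also have "\<dots> = (\<integral>x. f (c + x) \<partial>lborel)"
    by (subst integral_distr) auto
  finally show ?thesis by simp
qed

text \<open>
By translation invariance the difference quotients of \<open>\<psi>\<close> integrate to zero, and they converge
boundedly to \<open>g\<close>. All integrations by parts below come from this fact.
\<close>

lemma integral_directional_derivative_eq_0: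
  fixes \<psi> g :: "'a::euclidean_space \<Rightarrow> real"
  assumes deriv: "\<And>x. ((\<lambda>t. \<psi> (x + t *\<^sub>R d)) has_real_derivative g x) (at 0)"
    and cont: "continuous_on UNIV \<psi>" "continuous_on UNIV g"
    and supp: "\<And>x. r < norm x \<Longrightarrow> \<psi> x = 0" "\<And>x. r < norm x \<Longrightarrow> g x = 0"
  shows "(\<integral>x. g x \<partial>lborel) = 0"
proof -
  obtain K where K: "K \<ge> 0" "\<And>x. \<bar>g x\<bar> \<le> K"
    using continuous_bounded_support_bounded[OF cont(2) supp(2)] by blast
  have deriv': "((\<lambda>t. \<psi> (x + t *\<^sub>R d)) has_real_derivative g (x + t *\<^sub>R d)) (at t)" for x t
    using DERIV_shift[of "\<lambda>s. \<psi> (x + s *\<^sub>R d)" "g (x + t *\<^sub>R d)" 0 t] deriv[of "x + t *\<^sub>R d"]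
    by (simp add: algebra_simps)
  define h :: "nat \<Rightarrow> real" where "h = (\<lambda>k. inverse (real (Suc k)))"
  have h: "0 < h k" "h k \<le> 1" for k by (auto simp: h_def inverse_eq_divide)
  define D where "D = (\<lambda>k x. (\<psi> (h k *\<^sub>R d + x) - \<psi> x) / h k)"
  have meas: "\<psi> \<in> borel_measurable borel" "g \<in> borel_measurable borel"
    using cont by (auto intro: borel_measurable_continuous_onI)
  have int\<psi>: "integrable lborel \<psi>"
    by (rule integrable_continuous_bounded_support[OF cont(1) supp(1)])
  have zero: "(\<integral>x. D k x \<partial>lborel) = 0" for k
  proof -
    have "continuous_on UNIV (\<lambda>x. \<psi> (h k *\<^sub>R d + x))"
      by (rule continuous_on_compose2[OF cont(1)]) (auto intro!: continuous_intros)
    moreover have "\<psi> (h k *\<^sub>R d + x) = 0" if "r + norm d < norm x" for x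
    proof (rule supp(1))
      have "norm x \<le> norm (h k *\<^sub>R d + x) + norm (h k *\<^sub>R d)"
        using norm_triangle_ineq4[of "h k *\<^sub>R d + x" "h k *\<^sub>R d"] by simp
      moreover have "norm (h k *\<^sub>R d) \<le> norm d"
        using h[of k] by (simp add: mult_left_le_one_le)
      ultimately show "r < norm (h k *\<^sub>R d + x)" using that by linarith
    qed
    ultimately have "integrable lborel (\<lambda>x. \<psi> (h k *\<^sub>R d + x))"
      by (rule integrable_continuous_bounded_support)
    then show ?thesis
      unfolding D_def using int\<psi> lborel_integral_translate[OF meas(1)] by simp
  qed
  have "(\<lambda>k. \<integral>x. D k x \<partial>lborel) \<longlonglongrightarrow> (\<integral>x. g x \<partial>lborel)"
  proof (rule integral_dominated_convergence[where w="\<lambda>x. K * indicator (cball 0 (r + norm d)) x"])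
    show "AE x in lborel. (\<lambda>k. D k x) \<longlonglongrightarrow> g x"
    proof (rule AE_I2)
      fix x
      have "((\<lambda>t. (\<psi> (x + t *\<^sub>R d) - \<psi> x) / t) \<longlongrightarrow> g x) (at 0)"
        using deriv[of x] by (simp add: DERIV_def)
      moreover have "filterlim h (at 0) sequentially"
      proof -
        have "h \<longlonglongrightarrow> 0" unfolding h_def by (rule LIMSEQ_inverse_real_of_nat)
        moreover have "\<forall>k. h k \<noteq> 0" using h(1) by (metis less_irrefl)
        ultimately show ?thesis by (simp add: filterlim_at)
      qed
      ultimately have "(\<lambda>k. (\<psi> (x + h k *\<^sub>R d) - \<psi> x) / h k) \<longlonglongrightarrow> g x"
        by (rule filterlim_compose)
      then show "(\<lambda>k. D k x) \<longlonglongrightarrow> g x" by (simp add: D_def add.commute)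
    qed
    show "AE x in lborel. norm (D k x) \<le> K * indicator (cball 0 (r + norm d)) x" for k
    proof (rule AE_I2)
      fix x
      obtain z where z: "0 < z" "z < h k"
        "\<psi> (x + h k *\<^sub>R d) - \<psi> (x + 0 *\<^sub>R d) = (h k - 0) * g (x + z *\<^sub>R d)"
        using MVT2[OF h(1)[of k], of "\<lambda>t. \<psi> (x + t *\<^sub>R d)" "\<lambda>t. g (x + t *\<^sub>R d)"] deriv' by metis
      have D: "D k x = g (x + z *\<^sub>R d)"
        using z h(1)[of k] by (simp add: D_def add.commute)
      have "g (x + z *\<^sub>R d) = 0" if "r + norm d < norm x"
      proof (rule supp(2))
        have "norm x \<le> norm (x + z *\<^sub>R d) + norm (z *\<^sub>R d)"
          using norm_triangle_ineq4[of "x + z *\<^sub>R d" "z *\<^sub>R d"] by simp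
        moreover have "norm (z *\<^sub>R d) \<le> norm d"
          using z h(2)[of k] by (simp add: mult_left_le_one_le)
        ultimately show "r < norm (x + z *\<^sub>R d)" using that by linarith
      qed
      then show "norm (D k x) \<le> K * indicator (cball 0 (r + norm d)) x"
        using K D by (auto simp: indicator_def not_le)
    qed
    show "integrable lborel (\<lambda>x. K * indicator (cball 0 (r + norm d)) x)"
      by (intro integrable_mult_right integrable_real_indicator emeasure_bounded_finite) auto
    show "g \<in> borel_measurable lborel" using meas by simp
    show "\<And>k. D k \<in> borel_measurable lborel" unfolding D_def using meas by measurable
  qed
  then show ?thesis using zero by (simp add: LIMSEQ_const_iff)
qed

lemma integral_lebesgue_on_eq_lborel:
  fixes f :: "'a::euclidean_space \<Rightarrow> real"
  assumes "open \<Omega>" "f \<in> borel_measurable borel" "\<And>x. x \<notin> \<Omega> \<Longrightarrow> f x = 0"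
  shows "(\<integral>x. f x \<partial>lebesgue_on \<Omega>) = (\<integral>x. f x \<partial>lborel)"
proof -
  have "(\<integral>x. f x \<partial>lebesgue_on \<Omega>) = (\<integral>x. indicator \<Omega> x *\<^sub>R f x \<partial>lebesgue)"
    using assms by (intro integral_restrict_space) auto
  also have "(\<lambda>x. indicator \<Omega> x *\<^sub>R f x) = f"
    using assms(3) by (auto simp: indicator_def fun_eq_iff)
  also have "(\<integral>x. f x \<partial>lebesgue) = (\<integral>x. f x \<partial>lborel)"
    using assms(2) by (intro integral_completion) auto
  finally show ?thesis .
qed

lemma C_k_SucD: "C_k (Suc k) f \<Longrightarrow> C_k k f"
proof (induction k arbitrary: f)
  case 0
  then show ?case
    by (auto intro!: continuous_at_imp_continuous_on differentiable_imp_continuous_within)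
next
  case (Suc k)
  then show ?case by (metis C_k.simps(2))
qed

lemma partial_add:
  assumes "f differentiable (at x)" "g differentiable (at x)"
  shows "partial i (\<lambda>x. f x + g x) x = partial i f x + partial i g x"
  using frechet_derivative_at[OF has_derivative_add[OF assms[unfolded frechet_derivative_works]]]
  unfolding partial_def by metis

lemma partial_mult:
  assumes "f differentiable (at x)" "g differentiable (at x)"
  shows "partial i (\<lambda>x. f x * g x) x = f x * partial i g x + partial i f x * g x"
  using frechet_derivative_at[OF has_derivative_mult[OF assms[unfolded frechet_derivative_works]]]
  unfolding partial_def by metis

lemma C_k_add: "C_k k f \<Longrightarrow> C_k k g \<Longrightarrow> C_k k (\<lambda>x. f x + g x)"
proof (induction k arbitrary: f g)
  case 0
  then show ?case by (auto intro: continuous_intros)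
next
  case (Suc k)
  have "partial i (\<lambda>x. f x + g x) = (\<lambda>x. partial i f x + partial i g x)" for i
    using Suc.prems by (auto simp: partial_add)
  then show ?case using Suc by auto
qed

text \<open>
The Leibniz rule lowers the order by one on one factor only, so the induction needs that the other
factor may be regarded as less smooth than it is; this is \<open>C_k_SucD\<close>.
\<close>

lemma C_k_mult: "C_k k f \<Longrightarrow> C_k k g \<Longrightarrow> C_k k (\<lambda>x. f x * g x)"
proof (induction k arbitrary: f g)
  case 0
  then show ?case by (auto intro: continuous_intros)
next
  case (Suc k)
  have eq: "partial i (\<lambda>x. f x * g x) = (\<lambda>x. f x * partial i g x + partial i f x * g x)" for i
    using Suc.prems by (auto simp: partial_mult)
  have "C_k k f" "C_k k g" using Suc.prems C_k_SucD by blast+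
  then show ?case using Suc by (auto simp: eq intro!: C_k_add)
qed

lemma partial_const [simp]: "partial i (\<lambda>x. c) = (\<lambda>x. 0)"
  by (simp add: partial_def fun_eq_iff)

lemma C_k_const: "C_k k (\<lambda>x. c)"
  by (induction k arbitrary: c) auto

lemma C_k_prod: "finite I \<Longrightarrow> (\<And>j. j \<in> I \<Longrightarrow> C_k k (f j)) \<Longrightarrow> C_k k (\<lambda>x. \<Prod>j\<in>I. f j x)"
  by (induction I rule: finite_induct) (auto intro: C_k_const C_k_mult)

lemma test_functions_differentiable:
  assumes "\<phi> \<in> test_functions \<Omega>"
  shows "\<phi> differentiable (at x)" "continuous_on UNIV (partial i \<phi>)" "continuous_on UNIV \<phi>"
proof -
  have "C_k (Suc 0) \<phi>" "C_k 0 \<phi>" using assms by (auto simp: test_functions_def simp del: C_k.simps)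
  then show "\<phi> differentiable (at x)" "continuous_on UNIV (partial i \<phi>)" "continuous_on UNIV \<phi>"
    by auto
qed

section \<open>Smooth bumps and the fundamental lemma of the calculus of variations\<close>

text \<open>
Up to the factor \<open>t\<^sup>-\<^sup>k\<close> this is the standard smooth function that is flat at \<open>0\<close>. The powers are
included because the derivatives of the case \<open>k = 0\<close> are then combinations of members of the family.
\<close>

definition flat_exp :: "real \<Rightarrow> nat \<Rightarrow> real \<Rightarrow> real" where
  "flat_exp c k t = (if t > 0 then (1 / t) ^ k * exp (- c / t) else 0)"

text \<open>
From \<open>(1 + u/n)\<^sup>n \<le> exp u\<close> at \<open>u = c/t\<close> with \<open>n = k + 2\<close>: two more powers of \<open>t\<close> than the singular
factor absorbs, which yields the derivative \<open>0\<close> at the origin.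
\<close>

lemma flat_exp_bound:
  assumes "c > 0"
  obtains K where "K \<ge> 0" "\<And>t. \<bar>flat_exp c k t\<bar> \<le> K * t\<^sup>2"
proof -
  define n where "n = k + 2"
  have "\<bar>flat_exp c k t\<bar> \<le> (real n / c) ^ n * t\<^sup>2" for t
  proof (cases "t > 0")
    case True
    have "(c / t / real n) ^ n \<le> (1 + c / t / real n) ^ n"
      using assms True by (intro power_mono) auto
    also have "\<dots> \<le> exp (c / t)"
      using exp_ge_one_plus_x_over_n_power_n[of "n" "c / t"] assms True
      by (simp add: n_def order_trans[of _ 0])
    finally have *: "(c / t / real n) ^ n \<le> exp (c / t)" .
    have pos: "0 < c / t / real n" using assms True by (simp add: n_def)
    have "exp (- c / t) = 1 / exp (c / t)" by (simp add: exp_minus field_simps)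
    also have "\<dots> \<le> 1 / (c / t / real n) ^ n"
      using * pos by (intro divide_left_mono) auto
    also have "\<dots> = (real n / c) ^ n * t ^ n"
      by (simp add: power_divide power_mult_distrib field_simps)
    finally have "(1 / t) ^ k * exp (- c / t) \<le> (1 / t) ^ k * ((real n / c) ^ n * t ^ n)"
      using True by (intro mult_left_mono) auto
    also have "\<dots> = (real n / c) ^ n * t\<^sup>2"
      using True unfolding n_def power_add by (simp add: power_one_over field_simps)
    finally show ?thesis using True by (simp add: flat_exp_def)
  qed (use assms in \<open>simp add: flat_exp_def\<close>)
  then show ?thesis using that[of "(real n / c) ^ n"] assms by simp
qed

lemma flat_exp_deriv:
  assumes "c > 0"
  shows "(flat_exp c k has_real_derivative
           (c * flat_exp c (k + 2) t - real k * flat_exp c (k + 1) t)) (at t)"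
proof -
  consider "t > 0" | "t < 0" | "t = 0" by linarith
  then show ?thesis
  proof cases
    case 1
    have k: "real k * (1 / t) ^ (k - 1) / t\<^sup>2 = real k * (1 / t) ^ (k + 1)"
      by (cases k) (simp_all add: power2_eq_square)
    have "((\<lambda>s. (1 / s) ^ k * exp (- c / s)) has_real_derivative
           (real k * (1 / t) ^ (k - 1) * (- (1 / t\<^sup>2)) * exp (- c / t) + (1 / t) ^ k * (exp (- c / t) * (c / t\<^sup>2)))) (at t)"
      using 1 by (auto intro!: derivative_eq_intros simp: power2_eq_square)
    also have "real k * (1 / t) ^ (k - 1) * (- (1 / t\<^sup>2)) * exp (- c / t) + (1 / t) ^ k * (exp (- c / t) * (c / t\<^sup>2))
      = c * flat_exp c (k + 2) t - real k * flat_exp c (k + 1) t"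
    proof -
      have "real k * (1 / t) ^ (k - 1) * (- (1 / t\<^sup>2)) * exp (- c / t)
          = - (real k * (1 / t) ^ (k - 1) / t\<^sup>2) * exp (- c / t)" by simp
      moreover have "(1 / t) ^ k * (exp (- c / t) * (c / t\<^sup>2)) = c * ((1 / t) ^ (k + 2) * exp (- c / t))"
        by (simp add: power_add power2_eq_square)
      ultimately show ?thesis using 1 by (simp only: k) (simp add: flat_exp_def)
    qed
    finally have "((\<lambda>s. (1 / s) ^ k * exp (- c / s)) has_real_derivative
           (c * flat_exp c (k + 2) t - real k * flat_exp c (k + 1) t)) (at t)" .
    then show ?thesis
      by (rule has_field_derivative_transform_within_open[of _ _ _ "{0<..}"])
         (use 1 in \<open>auto simp: flat_exp_def\<close>)
  next
    case 2
    have "((\<lambda>s. 0) has_real_derivative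
           (c * flat_exp c (k + 2) t - real k * flat_exp c (k + 1) t)) (at t)"
      using 2 by (simp add: flat_exp_def)
    then show ?thesis
      by (rule has_field_derivative_transform_within_open[of _ _ _ "{..<0}"])
         (use 2 in \<open>auto simp: flat_exp_def\<close>)
  next
    case 3
    obtain K where K: "K \<ge> 0" "\<And>t. \<bar>flat_exp c k t\<bar> \<le> K * t\<^sup>2"
      using flat_exp_bound[OF assms] by blast
    have "((\<lambda>h. flat_exp c k h / h) \<longlongrightarrow> 0) (at 0)"
    proof (rule Lim_null_comparison)
      show "\<forall>\<^sub>F h in at 0. norm (flat_exp c k h / h) \<le> K * \<bar>h\<bar>"
        unfolding eventually_at_filter
      proof (rule always_eventually, intro allI impI)
        fix h :: real assume "h \<noteq> 0"
        then show "norm (flat_exp c k h / h) \<le> K * \<bar>h\<bar>"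
          using K(2)[of h] by (simp add: abs_divide divide_simps power2_eq_square mult.assoc)
      qed
      show "((\<lambda>h. K * \<bar>h\<bar>) \<longlongrightarrow> 0) (at 0)" by (auto intro!: tendsto_eq_intros)
    qed
    then show ?thesis using 3 by (simp add: DERIV_def flat_exp_def)
  qed
qed

text \<open>
The factor \<open>r\<close> makes the family of functions in the statement closed under partial derivatives up to
sums, so that the induction on the order of differentiability goes through.
\<close>

lemma C_k_flat_exp:
  assumes "c > 0"
  shows "C_k m (\<lambda>x::real^'n. r * flat_exp c k (s * x $ i + d))"
proof (induction m arbitrary: r k)
  case 0
  have "continuous_on UNIV (flat_exp c k)"
    using flat_exp_deriv[OF assms] by (intro continuous_at_imp_continuous_on) (blast intro: DERIV_isCont)
  then show ?case
    by (auto intro!: continuous_intros continuous_on_compose2[of UNIV "flat_exp c k"])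
next
  case (Suc m)
  let ?g = "\<lambda>x::real^'n. c * flat_exp c (k + 2) (s * x $ i + d) - real k * flat_exp c (k + 1) (s * x $ i + d)"
  have D: "((\<lambda>x::real^'n. r * flat_exp c k (s * x $ i + d)) has_derivative (\<lambda>h. r * (?g x * (s * h $ i)))) (at x)" for x
    apply (rule derivative_eq_intros refl has_derivative_compose[where g="flat_exp c k" and g'="(*) (?g x)"])+
    using flat_exp_deriv[OF assms, of k "s * x $ i + d"]
    apply (auto simp: has_field_derivative_def intro!: derivative_eq_intros bounded_linear_imp_has_derivative bounded_linear_vec_nth)
    done
  have "partial j (\<lambda>x::real^'n. r * flat_exp c k (s * x $ i + d)) x
      = (r * c * s * axis j 1 $ i) * flat_exp c (k + 2) (s * x $ i + d)
       + (- r * real k * s * axis j 1 $ i) * flat_exp c (k + 1) (s * x $ i + d)" for j x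
    unfolding partial_def using frechet_derivative_at[OF D[of x]]
    by (simp add: algebra_simps fun_eq_iff)
  then have eq: "partial j (\<lambda>x::real^'n. r * flat_exp c k (s * x $ i + d))
      = (\<lambda>x. (r * c * s * axis j 1 $ i) * flat_exp c (k + 2) (s * x $ i + d)
       + (- r * real k * s * axis j 1 $ i) * flat_exp c (k + 1) (s * x $ i + d))" for j
    by blast
  show ?case unfolding C_k.simps eq
    by (intro conjI allI C_k_add Suc.IH) (use D differentiableI in blast)
qed

definition box_bump :: "real^'n \<Rightarrow> real^'n \<Rightarrow> real \<Rightarrow> real^'n \<Rightarrow> real" where
  "box_bump a b c x = (\<Prod>i\<in>UNIV. flat_exp c 0 (x $ i - a $ i) * flat_exp c 0 (b $ i - x $ i))"

lemma box_bump_zero: "x \<notin> box a b \<Longrightarrow> box_bump a b c x = 0"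
proof -
  assume "x \<notin> box a b"
  then obtain i where "x $ i \<le> a $ i \<or> b $ i \<le> x $ i" by (auto simp: mem_box_cart not_less)
  then have "flat_exp c 0 (x $ i - a $ i) * flat_exp c 0 (b $ i - x $ i) = 0"
    by (auto simp: flat_exp_def)
  then show ?thesis unfolding box_bump_def by (intro prod_zero) auto
qed

lemma box_bump_in_test_functions:
  assumes "c > 0" "cbox a b \<subseteq> \<Omega>"
  shows "box_bump a b c \<in> test_functions \<Omega>"
proof -
  have "C_k k (box_bump a b c)" for k
    unfolding box_bump_def
  proof (intro C_k_prod C_k_mult)
    fix i
    show "C_k k (\<lambda>x. flat_exp c 0 (x $ i - a $ i))"
      using C_k_flat_exp[OF assms(1), of k 1 0 1 i "- a $ i"] by (simp only: mult_1 add_uminus_conv_diff)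
    show "C_k k (\<lambda>x. flat_exp c 0 (b $ i - x $ i))"
      using C_k_flat_exp[OF assms(1), of k 1 0 "-1" i "b $ i"] by (simp only: mult_1 mult_minus1 uminus_add_conv_diff)
  qed simp
  moreover have sub: "closure {x. box_bump a b c x \<noteq> 0} \<subseteq> cbox a b"
  proof (rule closure_minimal)
    show "{x. box_bump a b c x \<noteq> 0} \<subseteq> cbox a b"
      using box_bump_zero[of _ a b c] subsetD[OF box_subset_cbox[of a b]] by auto
  qed (rule closed_cbox)
  moreover have "compact (closure {x. box_bump a b c x \<noteq> 0})"
    using bounded_subset[OF bounded_cbox sub] by (simp add: compact_eq_bounded_closed)
  ultimately show ?thesis using assms(2) by (auto simp: test_functions_def)
qed

lemma box_bump_bounds: 
  assumes "c > 0"
  shows "0 \<le> box_bump a b c x" "box_bump a b c x \<le> 1"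
proof -
  have *: "0 \<le> flat_exp c 0 t" "flat_exp c 0 t \<le> 1" for t
    using assms by (auto simp: flat_exp_def)
  show "0 \<le> box_bump a b c x" "box_bump a b c x \<le> 1"
    unfolding box_bump_def using * by (auto intro!: prod_nonneg prod_le_1 mult_le_one)
qed

text \<open>
As \<open>c\<close> tends to \<open>0\<close>, the factor \<open>exp (- c / t)\<close> tends to \<open>1\<close> on the positive axis and stays \<open>0\<close> on
the rest, so the parameter \<open>c\<close> alone provides test functions approximating the indicator of a box.
\<close>

lemma box_bump_tendsto:
  "(\<lambda>m. box_bump a b (inverse (real (Suc m))) x) \<longlonglongrightarrow> indicator (box a b) x"
proof (cases "x \<in> box a b")
  case True
  have *: "(\<lambda>m. flat_exp (inverse (real (Suc m))) 0 t) \<longlonglongrightarrow> 1" if "t > 0" for t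
  proof -
    have "(\<lambda>m. exp (- inverse (real (Suc m)) / t)) \<longlonglongrightarrow> exp (- 0 / t)"
      using that by (intro tendsto_intros LIMSEQ_inverse_real_of_nat) auto
    then show ?thesis using that by (simp add: flat_exp_def)
  qed
  have "(\<lambda>m. box_bump a b (inverse (real (Suc m))) x) \<longlonglongrightarrow> (\<Prod>i\<in>(UNIV::'a set). 1 * 1)"
    unfolding box_bump_def using True by (intro tendsto_prod tendsto_mult *) (auto simp: mem_box_cart)
  then show ?thesis using True by simp
qed (simp add: box_bump_zero)

text \<open>
Testing with bumps that tend to the indicator of a box shows that \<open>f\<close> has integral zero over each
closed box inside \<open>\<Omega>\<close>. Almost every value of \<open>f\<close> is a limit of averages over small cubes, which
are eventually contained in \<open>\<Omega>\<close>.
\<close>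

lemma fundamental_lemma_calculus_of_variations:
  fixes f :: "real^'n \<Rightarrow> real"
  assumes "open \<Omega>" and int: "integrable (lebesgue_on \<Omega>) f"
    and zero: "\<And>\<phi>. \<phi> \<in> test_functions \<Omega> \<Longrightarrow> (\<integral>x. f x * \<phi> x \<partial>lebesgue_on \<Omega>) = 0"
  shows "AE x in lebesgue_on \<Omega>. f x = 0"
proof -
  define F where "F = (\<lambda>x. indicator \<Omega> x *\<^sub>R f x)"
  have \<Omega>: "\<Omega> \<in> sets lebesgue" using assms(1) by auto
  have intF: "integrable lebesgue F"
    using int \<Omega> unfolding F_def by (simp add: integrable_restrict_space)
  have "F absolutely_integrable_on UNIV"
    using intF by (simp add: set_integrable_def)
  then have abs: "F absolutely_integrable_on S" if "S \<in> sets lebesgue" for S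
    by (rule set_integrable_subset[OF _ that]) auto
  have box0: "integral (cbox a b) F = 0" if sub: "cbox a b \<subseteq> \<Omega>" for a b
  proof -
    have "(\<lambda>m. \<integral>x. f x * box_bump a b (inverse (real (Suc m))) x \<partial>lebesgue_on \<Omega>)
            \<longlonglongrightarrow> (\<integral>x. f x * indicator (box a b) x \<partial>lebesgue_on \<Omega>)"
    proof (rule integral_dominated_convergence[where w="\<lambda>x. norm (f x)"])
      have "box_bump a b (inverse (real (Suc m))) \<in> borel_measurable (lebesgue_on \<Omega>)" for m
      proof -
        have "box_bump a b (inverse (real (Suc m))) \<in> test_functions \<Omega>"
          using sub by (intro box_bump_in_test_functions) auto
        then have "continuous_on UNIV (box_bump a b (inverse (real (Suc m))))"
          by (rule test_functions_differentiable)
        then show ?thesis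
          using \<Omega> by (intro continuous_imp_measurable_on_sets_lebesgue) (auto intro: continuous_on_subset)
      qed
      then show "(\<lambda>x. f x * box_bump a b (inverse (real (Suc m))) x) \<in> borel_measurable (lebesgue_on \<Omega>)" for m
        using int by (intro borel_measurable_times) auto
      have "indicator (box a b) \<in> borel_measurable (lebesgue_on \<Omega>)"
        by (intro measurable_restrict_space1 borel_measurable_indicator) auto
      then show "(\<lambda>x. f x * indicator (box a b) x) \<in> borel_measurable (lebesgue_on \<Omega>)"
        using int by (intro borel_measurable_times) auto
      show "integrable (lebesgue_on \<Omega>) (\<lambda>x. norm (f x))" using int by simp
      show "AE x in lebesgue_on \<Omega>. (\<lambda>m. f x * box_bump a b (inverse (real (Suc m))) x)
          \<longlonglongrightarrow> f x * indicator (box a b) x"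
        by (intro AE_I2 tendsto_intros box_bump_tendsto)
      show "AE x in lebesgue_on \<Omega>. norm (f x * box_bump a b (inverse (real (Suc m))) x) \<le> norm (f x)" for m
        using box_bump_bounds[of "inverse (real (Suc m))" a b]
        by (intro AE_I2) (simp add: abs_mult mult_left_le)
    qed
    moreover have "(\<integral>x. f x * box_bump a b (inverse (real (Suc m))) x \<partial>lebesgue_on \<Omega>) = 0" for m
      using sub by (intro zero box_bump_in_test_functions) auto
    ultimately have "(\<integral>x. f x * indicator (box a b) x \<partial>lebesgue_on \<Omega>) = 0"
      by (simp add: LIMSEQ_const_iff)
    also have "(\<integral>x. f x * indicator (box a b) x \<partial>lebesgue_on \<Omega>)
        = (\<integral>x. indicator \<Omega> x *\<^sub>R (f x * indicator (box a b) x) \<partial>lebesgue)"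
      using \<Omega> by (intro integral_restrict_space) auto
    also have "\<dots> = (LINT x:box a b|lebesgue. F x)"
      unfolding set_lebesgue_integral_def F_def using subset_trans[OF box_subset_cbox sub]
      by (intro Bochner_Integration.integral_cong) (auto simp: indicator_def)
    also have "\<dots> = integral (box a b) F"
      by (rule set_lebesgue_integral_eq_integral(2)[OF abs]) auto
    finally show ?thesis by (simp add: integral_open_interval)
  qed
  have "F integrable_on cbox a b" for a b
    by (rule set_lebesgue_integral_eq_integral(1)[OF abs]) auto
  then obtain N where N: "negligible N"
    "\<And>x e. \<lbrakk>x \<notin> N; 0 < e\<rbrakk> \<Longrightarrow> \<exists>d>0. \<forall>h. 0 < h \<and> h < d \<longrightarrow>
        norm (integral (cbox x (x + h *\<^sub>R One)) F /\<^sub>R h ^ DIM(real^'n) - F x) < e"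
  proof (rule integrable_ccontinuous_explicit)
    fix N
    assume "negligible N" and "\<And>x e. \<lbrakk>x \<notin> N; 0 < e\<rbrakk> \<Longrightarrow> \<exists>d>0. \<forall>h. 0 < h \<and> h < d \<longrightarrow>
        norm (integral (cbox x (x + h *\<^sub>R One)) F /\<^sub>R h ^ DIM(real^'n) - F x) < e"
    then show thesis by (rule that)
  qed
  have "F x = 0" if xN: "x \<notin> N" and x\<Omega>: "x \<in> \<Omega>" for x
  proof (rule ccontr)
    assume "F x \<noteq> 0"
    then obtain d where d: "d > 0" "\<And>h. 0 < h \<and> h < d \<Longrightarrow>
        norm (integral (cbox x (x + h *\<^sub>R One)) F /\<^sub>R h ^ DIM(real^'n) - F x) < norm (F x)"
      using N(2)[OF xN, of "norm (F x)"] by (metis zero_less_norm_iff)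
    obtain e where e: "e > 0" "ball x e \<subseteq> \<Omega>"
      using assms(1) x\<Omega> unfolding open_contains_ball by auto
    let ?O = "One :: real^'n"
    define h where "h = min (d / 2) (e / (2 * (norm ?O + 1)))"
    have h: "0 < h" "h < d" using d e by (auto simp: h_def add_nonneg_pos)
    have "h * norm ?O < e"
    proof -
      have "h * norm ?O \<le> e / (2 * (norm ?O + 1)) * norm ?O"
        by (intro mult_right_mono) (auto simp: h_def)
      also have "\<dots> < e"
      proof -
        have "e / (2 * (n + 1)) * n < e" if "n \<ge> 0" for n :: real
          using e(1) that by (simp add: pos_divide_less_eq)
        then show ?thesis by (simp only: norm_ge_zero)
      qed
      finally show ?thesis .
    qed
    have "cbox x (x + h *\<^sub>R ?O) \<subseteq> ball x e"
    proof
      fix y assume y: "y \<in> cbox x (x + h *\<^sub>R ?O)"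
      have "norm (y - x) \<le> norm (h *\<^sub>R ?O)"
      proof (rule norm_le_componentwise)
        fix b :: "real^'n" assume b: "b \<in> Basis"
        have "x \<bullet> b \<le> y \<bullet> b" "y \<bullet> b \<le> x \<bullet> b + h"
          using y b by (auto simp: mem_box inner_add_left)
        then show "\<bar>(y - x) \<bullet> b\<bar> \<le> \<bar>h *\<^sub>R ?O \<bullet> b\<bar>"
          using b h(1) by (simp add: inner_diff_left)
      qed
      then show "y \<in> ball x e" using \<open>h * norm ?O < e\<close> h(1) by (simp add: dist_norm norm_minus_commute)
    qed
    then have "integral (cbox x (x + h *\<^sub>R ?O)) F = 0" using e box0 by blast
    then show False using d(2)[of h] h by simp
  qed
  then have "AE x in lebesgue. x \<in> \<Omega> \<longrightarrow> f x = 0"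
    using N(1) by (intro AE_I'[of N]) (auto simp: F_def negligible_iff_null_sets)
  then show ?thesis using \<Omega> by (simp add: AE_restrict_space_iff)
qed

section \<open>Functions with integrable p-th power\<close>

lemma norm_add_powr_le:
  assumes "p \<ge> 0"
  shows "norm (a + b) powr p \<le> 2 powr p * (norm a powr p + norm b powr p)"
proof -
  have "norm (a + b) powr p \<le> (2 * max (norm a) (norm b)) powr p"
    using assms norm_triangle_ineq[of a b] by (intro powr_mono2) auto
  also have "\<dots> = 2 powr p * max (norm a) (norm b) powr p"
    by (simp add: powr_mult)
  also have "\<dots> \<le> 2 powr p * (norm a powr p + norm b powr p)"
    by (intro mult_left_mono) (auto simp: max_def)
  finally show ?thesis .
qed

text \<open>
A substitute for Hoelder's inequality: with a free parameter \<open>c\<close>, smallness of \<open>\<integral> t\<^sup>p\<close> gives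
smallness of \<open>\<integral> t\<close> over a set of finite measure.
\<close>

lemma le_const_add_powr:
  assumes "p > 1" "c > 0" "t \<ge> 0"
  shows "t \<le> c + c powr (1 - p) * t powr (p::real)"
proof (cases "t \<le> c")
  case False
  then have t: "t > 0" "c \<le> t" using assms by auto
  have "t = t powr (1 - p) * t powr p" using t by (simp flip: powr_add)
  also have "\<dots> \<le> c powr (1 - p) * t powr p"
    using t assms by (intro mult_right_mono powr_mono2') auto
  finally show ?thesis using assms by simp
qed (use assms in \<open>simp add: add_increasing2\<close>)

definition lp :: "'a measure \<Rightarrow> real \<Rightarrow> ('a \<Rightarrow> 'b::euclidean_space) \<Rightarrow> bool" where
  "lp M p f \<longleftrightarrow> f \<in> borel_measurable M \<and> integrable M (\<lambda>x. norm (f x) powr p)"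

text \<open>
The \<open>p\<close>-th power of the \<open>L\<^sup>p\<close> norm. It satisfies the triangle inequality only up to the factor
\<open>2\<^sup>p\<close>, which suffices because convergence and Cauchy sequences are the same as for the norm.
\<close>

definition pint :: "'a measure \<Rightarrow> real \<Rightarrow> ('a \<Rightarrow> 'b::euclidean_space) \<Rightarrow> real" where
  "pint M p f = (\<integral>x. norm (f x) powr p \<partial>M)"

lemma pint_nonneg [simp]: "0 \<le> pint M p f"
  by (simp add: pint_def)

lemma lp_add:
  assumes "p > 1" "lp M p f" "lp M p g"
  shows "lp M p (\<lambda>x. f x + g x)" "pint M p (\<lambda>x. f x + g x) \<le> 2 powr p * (pint M p f + pint M p g)"
proof -
  have int: "integrable M (\<lambda>x. 2 powr p * (norm (f x) powr p + norm (g x) powr p))"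
    using assms by (auto simp: lp_def)
  have [measurable]: "f \<in> borel_measurable M" "g \<in> borel_measurable M"
    using assms by (auto simp: lp_def)
  have int2: "integrable M (\<lambda>x. norm (f x + g x) powr p)"
    by (rule Bochner_Integration.integrable_bound[OF int])
       (use norm_add_powr_le[of p] assms(1) in \<open>auto intro!: AE_I2\<close>)
  then show "lp M p (\<lambda>x. f x + g x)" by (simp add: lp_def)
  have "pint M p (\<lambda>x. f x + g x) \<le> (\<integral>x. 2 powr p * (norm (f x) powr p + norm (g x) powr p) \<partial>M)"
    unfolding pint_def using int int2 norm_add_powr_le[of p] assms(1) by (intro integral_mono) auto
  also have "\<dots> = 2 powr p * (pint M p f + pint M p g)"
    using assms by (simp add: pint_def lp_def)
  finally show "pint M p (\<lambda>x. f x + g x) \<le> 2 powr p * (pint M p f + pint M p g)" .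
qed

lemma lp_scaleR:
  assumes "lp M p f"
  shows "lp M p (\<lambda>x. c *\<^sub>R f x)" "pint M p (\<lambda>x. c *\<^sub>R f x) = \<bar>c\<bar> powr p * pint M p f"
  using assms by (auto simp: lp_def pint_def powr_mult)

lemma lp_diff:
  assumes "p > 1" "lp M p f" "lp M p g"
  shows "lp M p (\<lambda>x. f x - g x)" "pint M p (\<lambda>x. f x - g x) \<le> 2 powr p * (pint M p f + pint M p g)"
  using lp_add[OF assms(1,2) lp_scaleR(1)[OF assms(3), of "-1"]] lp_scaleR(2)[OF assms(3), of "-1"]
  by auto

lemma pint_triangle:
  assumes "p > 1" "lp M p f" "lp M p g" "lp M p h"
  shows "pint M p (\<lambda>x. f x - h x) \<le> 2 powr p * (pint M p (\<lambda>x. f x - g x) + pint M p (\<lambda>x. g x - h x))"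
  using lp_add(2)[OF assms(1) lp_diff(1)[OF assms(1,2,3)] lp_diff(1)[OF assms(1,3,4)]] by simp

lemma pint_minus_commute: "pint M p (\<lambda>x. f x - g x) = pint M p (\<lambda>x. g x - f x)"
  by (simp add: pint_def norm_minus_commute)

lemma lp_imp_integrable:
  assumes "finite_measure M" "p > 1" "lp M p f"
  shows "integrable M f"
proof (rule Bochner_Integration.integrable_bound)
  show "integrable M (\<lambda>x. 1 + norm (f x) powr p)"
    using assms by (auto simp: lp_def finite_measure.integrable_const)
  show "f \<in> borel_measurable M" using assms by (simp add: lp_def)
  show "AE x in M. norm (f x) \<le> norm (1 + norm (f x) powr p)"
    using le_const_add_powr[OF assms(2), of 1] by (auto intro!: AE_I2)
qed

lemma lp_bounded:
  assumes "finite_measure M" "f \<in> borel_measurable M" "\<And>x. x \<in> space M \<Longrightarrow> norm (f x) \<le> K" "p > 0"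
  shows "lp M p f"
  unfolding lp_def
proof
  show "integrable M (\<lambda>x. norm (f x) powr p)"
    by (rule Bochner_Integration.integrable_bound[OF finite_measure.integrable_const[OF assms(1), of "K powr p"]])
       (use assms in \<open>auto intro!: AE_I2 powr_mono2\<close>)
qed fact

lemma lp_tendsto_inner:
  fixes f :: "nat \<Rightarrow> 'a \<Rightarrow> 'b::euclidean_space"
  assumes M: "finite_measure M" and p: "p > 1" and f: "\<And>k. lp M p (f k)" and g: "lp M p g"
    and lim: "(\<lambda>k. pint M p (\<lambda>x. f k x - g x)) \<longlonglongrightarrow> 0"
    and \<phi>: "\<phi> \<in> borel_measurable M" "\<And>x. x \<in> space M \<Longrightarrow> norm (\<phi> x) \<le> K"
  shows "integrable M (\<lambda>x. g x \<bullet> \<phi> x)" "(\<lambda>k. \<integral>x. f k x \<bullet> \<phi> x \<partial>M) \<longlonglongrightarrow> (\<integral>x. g x \<bullet> \<phi> x \<partial>M)"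
proof -
  define K' where "K' = max K 1"
  have \<phi>': "norm (\<phi> x) \<le> K'" if "x \<in> space M" for x using \<phi>(2)[OF that] by (simp add: K'_def)
  have K': "K' > 0" by (simp add: K'_def)
  have int: "integrable M (\<lambda>x. h x \<bullet> \<phi> x)" if "lp M p h" for h :: "'a \<Rightarrow> 'b"
  proof (rule Bochner_Integration.integrable_bound)
    show "integrable M (\<lambda>x. K' *\<^sub>R h x)" using lp_imp_integrable[OF M p that] by simp
    show "(\<lambda>x. h x \<bullet> \<phi> x) \<in> borel_measurable M" using that \<phi>(1) by (auto simp: lp_def)
    show "AE x in M. norm (h x \<bullet> \<phi> x) \<le> norm (K' *\<^sub>R h x)"
    proof (rule AE_I2)
      fix x assume x: "x \<in> space M"
      have "\<bar>h x \<bullet> \<phi> x\<bar> \<le> norm (h x) * norm (\<phi> x)" by (rule Cauchy_Schwarz_ineq2)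
      also have "\<dots> \<le> norm (h x) * K'" using \<phi>'[OF x] by (intro mult_left_mono) auto
      finally show "norm (h x \<bullet> \<phi> x) \<le> norm (K' *\<^sub>R h x)" using K' by (simp add: mult.commute)
    qed
  qed
  show "integrable M (\<lambda>x. g x \<bullet> \<phi> x)" using g by (rule int)
  have bound: "\<bar>(\<integral>x. f k x \<bullet> \<phi> x \<partial>M) - (\<integral>x. g x \<bullet> \<phi> x \<partial>M)\<bar>
      \<le> K' * (c * measure M (space M)) + K' * c powr (1 - p) * pint M p (\<lambda>x. f k x - g x)"
    if c: "c > 0" for k c
  proof -
    let ?d = "\<lambda>x. f k x - g x"
    have d: "lp M p ?d" by (rule lp_diff[OF p f g])
    have "(\<integral>x. f k x \<bullet> \<phi> x \<partial>M) - (\<integral>x. g x \<bullet> \<phi> x \<partial>M) = (\<integral>x. ?d x \<bullet> \<phi> x \<partial>M)"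
      using int[OF f] int[OF g] by (simp add: inner_diff_left)
    also have "\<bar>\<dots>\<bar> \<le> (\<integral>x. K' * (c + c powr (1 - p) * norm (?d x) powr p) \<partial>M)"
    proof (rule integral_abs_bound[THEN order_trans], rule integral_mono)
      show "integrable M (\<lambda>x. \<bar>?d x \<bullet> \<phi> x\<bar>)" using int[OF d] by simp
      show "integrable M (\<lambda>x. K' * (c + c powr (1 - p) * norm (?d x) powr p))"
        using d M by (auto simp: lp_def finite_measure.integrable_const)
      fix x assume x: "x \<in> space M"
      have "\<bar>?d x \<bullet> \<phi> x\<bar> \<le> norm (?d x) * norm (\<phi> x)" by (rule Cauchy_Schwarz_ineq2)
      also have "\<dots> \<le> norm (?d x) * K'" using \<phi>'[OF x] by (intro mult_left_mono) auto
      also have "\<dots> \<le> (c + c powr (1 - p) * norm (?d x) powr p) * K'"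
        using K' le_const_add_powr[OF p c, of "norm (?d x)"] by (intro mult_right_mono) auto
      finally show "\<bar>?d x \<bullet> \<phi> x\<bar> \<le> K' * (c + c powr (1 - p) * norm (?d x) powr p)"
        by (simp add: mult.commute)
    qed
    also have "\<dots> = K' * (c * measure M (space M)) + K' * c powr (1 - p) * pint M p ?d"
      using d M by (simp add: lp_def pint_def finite_measure.integrable_const algebra_simps)
    finally show ?thesis .
  qed
  show "(\<lambda>k. \<integral>x. f k x \<bullet> \<phi> x \<partial>M) \<longlonglongrightarrow> (\<integral>x. g x \<bullet> \<phi> x \<partial>M)"
  proof (rule LIMSEQ_I)
    fix e :: real assume e: "e > 0"
    define c where "c = e / (2 * K' * (measure M (space M) + 1))"
    have c: "c > 0" using e K' by (simp add: c_def add_nonneg_pos)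
    have "K' * (c * measure M (space M)) = (e / 2) * (measure M (space M) / (measure M (space M) + 1))"
      using K' by (simp add: c_def)
    also have "\<dots> \<le> e / 2 * 1"
    proof (rule mult_left_mono)
      have "m / (m + 1) \<le> 1" if "m \<ge> 0" for m :: real using that by simp
      then show "measure M (space M) / (measure M (space M) + 1) \<le> 1" by (simp only: measure_nonneg)
    qed (use e in simp)
    finally have 1: "K' * (c * measure M (space M)) \<le> e / 2" by simp
    have "(\<lambda>k. K' * c powr (1 - p) * pint M p (\<lambda>x. f k x - g x)) \<longlonglongrightarrow> K' * c powr (1 - p) * 0"
      by (intro tendsto_intros lim)
    then have "\<forall>\<^sub>F k in sequentially. K' * c powr (1 - p) * pint M p (\<lambda>x. f k x - g x) < e / 2"
      using e by (intro order_tendstoD) auto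
    then have "\<forall>\<^sub>F k in sequentially. norm ((\<integral>x. f k x \<bullet> \<phi> x \<partial>M) - (\<integral>x. g x \<bullet> \<phi> x \<partial>M)) < e"
    proof (rule eventually_mono)
      fix k assume "K' * c powr (1 - p) * pint M p (\<lambda>x. f k x - g x) < e / 2"
      then show "norm ((\<integral>x. f k x \<bullet> \<phi> x \<partial>M) - (\<integral>x. g x \<bullet> \<phi> x \<partial>M)) < e"
        using bound[OF c, of k] 1 unfolding real_norm_def by linarith
    qed
    then show "\<exists>N. \<forall>k\<ge>N. norm ((\<integral>x. f k x \<bullet> \<phi> x \<partial>M) - (\<integral>x. g x \<bullet> \<phi> x \<partial>M)) < e"
      by (simp only: eventually_sequentially)
  qed
qed

text \<open>
Summability forces the increments to be eventually at most \<open>2\<^sup>-\<^sup>k\<close>.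
\<close>

lemma summable_increments_imp_convergent:
  fixes s :: "nat \<Rightarrow> 'b::euclidean_space"
  assumes p: "p > 1" and sm: "summable (\<lambda>k. (2 ^ k) powr p * norm (s (Suc k) - s k) powr p)"
  shows "convergent s"
proof -
  have "(\<lambda>k. (2 ^ k) powr p * norm (s (Suc k) - s k) powr p) \<longlonglongrightarrow> 0"
    using sm by (rule summable_LIMSEQ_zero)
  then have "\<forall>\<^sub>F k in sequentially. (2 ^ k) powr p * norm (s (Suc k) - s k) powr p < 1"
    by (rule order_tendstoD) simp
  then have "\<forall>\<^sub>F k in sequentially. norm (s (Suc k) - s k) \<le> (1 / 2) ^ k"
  proof (rule eventually_mono)
    fix k assume "(2 ^ k) powr p * norm (s (Suc k) - s k) powr p < 1"
    then have "(2 ^ k * norm (s (Suc k) - s k)) powr p < 1 powr p" by (simp add: powr_mult)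
    then have "2 ^ k * norm (s (Suc k) - s k) < 1"
      using p by (metis less_irrefl less_trans powr_less_mono2 not_le powr_mono2 zero_le_one less_eq_real_def)
    then show "norm (s (Suc k) - s k) \<le> (1 / 2) ^ k" by (simp add: power_divide field_simps)
  qed
  then have "summable (\<lambda>k. s (Suc k) - s k)"
    by (rule summable_comparison_test_ev) (simp add: summable_geometric)
  then have "convergent (\<lambda>n. \<Sum>k<n. s (Suc k) - s k)" by (simp add: summable_iff_convergent)
  then have "convergent (\<lambda>n. s n - s 0)" by (simp add: sum_lessThan_telescope)
  then have "convergent (\<lambda>n. (s n - s 0) + s 0)" by (intro convergent_add convergent_const)
  then show ?thesis by simp
qed

lemma pint_eq_nn_integral:
  assumes "lp M p f"
  shows "ennreal (pint M p f) = (\<integral>\<^sup>+x. ennreal (norm (f x) powr p) \<partial>M)"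
  using assms unfolding lp_def pint_def by (subst nn_integral_eq_integral) auto

lemma pint_fatou:
  fixes f :: "nat \<Rightarrow> 'a \<Rightarrow> 'b::euclidean_space"
  assumes p: "p > 1" and f: "\<And>k. lp M p (f k)" and [measurable]: "g \<in> borel_measurable M"
    and lim: "AE x in M. (\<lambda>k. f k x) \<longlonglongrightarrow> g x"
    and b: "\<forall>\<^sub>F k in sequentially. pint M p (f k) \<le> e"
  shows "lp M p g" "pint M p g \<le> e"
proof -
  have [measurable]: "f k \<in> borel_measurable M" for k using f by (simp add: lp_def)
  have e: "e \<ge> 0" 
    using eventually_happens'[OF sequentially_bot b] pint_nonneg order_trans by blast
  have "(\<integral>\<^sup>+x. ennreal (norm (g x) powr p) \<partial>M)
      = (\<integral>\<^sup>+x. liminf (\<lambda>k. ennreal (norm (f k x) powr p)) \<partial>M)"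
  proof (rule nn_integral_cong_AE, use lim in eventually_elim)
    fix x assume "(\<lambda>k. f k x) \<longlonglongrightarrow> g x"
    then have "(\<lambda>k. ennreal (norm (f k x) powr p)) \<longlonglongrightarrow> ennreal (norm (g x) powr p)"
      using p by (intro tendsto_ennrealI tendsto_powr' tendsto_norm) auto
    then show "ennreal (norm (g x) powr p) = liminf (\<lambda>k. ennreal (norm (f k x) powr p))"
      by (intro lim_imp_Liminf[symmetric]) auto
  qed
  also have "\<dots> \<le> liminf (\<lambda>k. \<integral>\<^sup>+x. ennreal (norm (f k x) powr p) \<partial>M)"
    by (rule nn_integral_liminf) simp
  also have "\<dots> \<le> ennreal e"
    unfolding pint_eq_nn_integral[OF f, symmetric]
    by (rule Liminf_le) (use b in \<open>auto elim!: eventually_mono intro: ennreal_leI\<close>)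
  finally have le: "(\<integral>\<^sup>+x. ennreal (norm (g x) powr p) \<partial>M) \<le> ennreal e" .
  then have "integrable M (\<lambda>x. norm (g x) powr p)"
    by (intro integrableI_bounded) (auto simp: le_less_trans[OF le])
  then show lp: "lp M p g" by (simp add: lp_def)
  show "pint M p g \<le> e"
    using le e unfolding pint_eq_nn_integral[OF lp, symmetric] by simp
qed

text \<open>
Along a subsequence with rapidly decreasing increments the sum of the weighted \<open>p\<close>-th powers of the
increments has a finite integral, so the subsequence converges almost everywhere; Fatou's lemma
turns this into convergence of the whole Cauchy sequence. The subsequence is part of the conclusion
because lower semicontinuity of the energy is obtained from it, again by Fatou's lemma.
\<close>

lemma lp_complete:
  fixes f :: "nat \<Rightarrow> 'a \<Rightarrow> 'b::euclidean_space"
  assumes p: "p > 1" and f: "\<And>k. lp M p (f k)"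
    and Cau: "\<And>e. e > 0 \<Longrightarrow> \<exists>N. \<forall>m\<ge>N. \<forall>n\<ge>N. pint M p (\<lambda>x. f m x - f n x) < e"
  obtains r g where "strict_mono (r :: nat \<Rightarrow> nat)" "lp M p g"
    "AE x in M. (\<lambda>k. f (r k) x) \<longlonglongrightarrow> g x" "(\<lambda>k. pint M p (\<lambda>x. f k x - g x)) \<longlonglongrightarrow> 0"
proof -
  have [measurable]: "f k \<in> borel_measurable M" for k using f by (simp add: lp_def)
  \<comment> \<open>These bounds leave a geometric series after multiplication by the weights \<open>(2\<^sup>k)\<^sup>p\<close>.\<close>
  define b :: "nat \<Rightarrow> real" where "b k = (1 / 2) ^ k / (2 ^ k) powr p" for k
  have b: "b k > 0" for k by (simp add: b_def)
  have "\<forall>k. \<exists>N. \<forall>m\<ge>N. \<forall>n\<ge>N. pint M p (\<lambda>x. f m x - f n x) < b k" using Cau b by blast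
  then obtain N where N: "\<And>k m n. m \<ge> N k \<Longrightarrow> n \<ge> N k \<Longrightarrow> pint M p (\<lambda>x. f m x - f n x) < b k"
    by metis
  define r where "r = rec_nat (N 0) (\<lambda>k s. max (Suc s) (N (Suc k)))"
  have r_Suc: "r (Suc k) = max (Suc (r k)) (N (Suc k))" for k by (simp add: r_def)
  have r: "strict_mono r" by (rule strict_monoI_Suc) (simp add: r_Suc)
  have rN: "r k \<ge> N k" for k by (cases k) (simp_all add: r_Suc, simp add: r_def)
  let ?d = "\<lambda>k x. f (r (Suc k)) x - f (r k) x"
  have dlp: "lp M p (?d k)" for k by (rule lp_diff[OF p f f])
  have "pint M p (?d k) \<le> b k" for k
    using N[of k "r (Suc k)" "r k"] rN[of k] strict_mono_less[OF r, of k "Suc k"] by simp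
  have "(\<integral>\<^sup>+x. (\<Sum>k. ennreal ((2 ^ k) powr p * norm (?d k x) powr p)) \<partial>M)
      = (\<Sum>k. \<integral>\<^sup>+x. ennreal ((2 ^ k) powr p * norm (?d k x) powr p) \<partial>M)"
    by (rule nn_integral_suminf) simp
  also have "\<dots> = (\<Sum>k. ennreal ((2 ^ k) powr p) * ennreal (pint M p (?d k)))"
    unfolding pint_eq_nn_integral[OF dlp] by (simp add: ennreal_mult nn_integral_cmult)
  also have "\<dots> \<le> (\<Sum>k. ennreal ((1 / 2) ^ k))"
  proof (rule suminf_le)
    fix k
    have "ennreal ((2 ^ k) powr p) * ennreal (pint M p (?d k)) = ennreal ((2 ^ k) powr p * pint M p (?d k))"
      by (simp add: ennreal_mult)
    also have "\<dots> \<le> ennreal ((2 ^ k) powr p * b k)"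
      using \<open>pint M p (?d k) \<le> b k\<close> by (intro ennreal_leI mult_left_mono) auto
    also have "(2 ^ k) powr p * b k = (1 / 2) ^ k" by (simp add: b_def)
    finally show "ennreal ((2 ^ k) powr p) * ennreal (pint M p (?d k)) \<le> ennreal ((1 / 2) ^ k)" .
  qed auto
  also have "\<dots> < \<infinity>"
    by (subst suminf_ennreal2) (auto simp: summable_geometric)
  finally have "AE x in M. (\<Sum>k. ennreal ((2 ^ k) powr p * norm (?d k x) powr p)) \<noteq> \<infinity>"
    by (intro nn_integral_noteq_infinite) auto
  then have conv: "AE x in M. convergent (\<lambda>k. f (r k) x)"
  proof eventually_elim
    fix x assume "(\<Sum>k. ennreal ((2 ^ k) powr p * norm (?d k x) powr p)) \<noteq> \<infinity>"
    then have "summable (\<lambda>k. (2 ^ k) powr p * norm (?d k x) powr p)"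
      by (intro summable_suminf_not_top) auto
    then show "convergent (\<lambda>k. f (r k) x)"
      using summable_increments_imp_convergent[OF p, of "\<lambda>k. f (r k) x"] by simp
  qed
  define g where "g x = lim (\<lambda>k. f (r k) x)" for x
  have [measurable]: "g \<in> borel_measurable M" unfolding g_def by (rule borel_measurable_lim_metric) simp
  have lim: "AE x in M. (\<lambda>k. f (r k) x) \<longlonglongrightarrow> g x"
    using conv by eventually_elim (simp add: g_def convergent_LIMSEQ_iff)
  have fat: "lp M p (\<lambda>x. f n x - g x) \<and> pint M p (\<lambda>x. f n x - g x) \<le> e"
    if "n \<ge> N'" and N': "\<And>m n. m \<ge> N' \<Longrightarrow> n \<ge> N' \<Longrightarrow> pint M p (\<lambda>x. f m x - f n x) < e" for n N' e
  proof -
    have "AE x in M. (\<lambda>k. f n x - f (r k) x) \<longlonglongrightarrow> f n x - g x"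
      using lim by eventually_elim (intro tendsto_intros)
    moreover have "\<forall>\<^sub>F k in sequentially. pint M p (\<lambda>x. f n x - f (r k) x) \<le> e"
      using N'[OF \<open>n \<ge> N'\<close>] seq_suble[OF r] unfolding eventually_sequentially
      by (meson less_imp_le order_trans)
    ultimately show ?thesis
      using pint_fatou[OF p lp_diff(1)[OF p f f], where g="\<lambda>x. f n x - g x"] by simp
  qed
  have glp: "lp M p g"
  proof -
    have "lp M p (\<lambda>x. f (N 0) x - g x)" using fat[of "N 0" "N 0" "b 0"] N by blast
    then have "lp M p (\<lambda>x. f (N 0) x - (f (N 0) x - g x))" by (rule lp_diff[OF p f])
    then show ?thesis by simp
  qed
  have "(\<lambda>k. pint M p (\<lambda>x. f k x - g x)) \<longlonglongrightarrow> 0"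
  proof (rule LIMSEQ_I)
    fix e :: real assume "e > 0"
    then obtain N' where "\<And>m n. m \<ge> N' \<Longrightarrow> n \<ge> N' \<Longrightarrow> pint M p (\<lambda>x. f m x - f n x) < e / 2"
      using Cau[of "e / 2"] by auto
    then show "\<exists>N. \<forall>n\<ge>N. norm (pint M p (\<lambda>x. f n x - g x) - 0) < e"
      using fat[of N' _ "e / 2"] \<open>e > 0\<close> by (intro exI[of _ N']) force
  qed
  then show ?thesis using that r glp lim by blast
qed

section \<open>Weak gradients on a bounded domain\<close>

definition grad :: "(real^'n \<Rightarrow> real) \<Rightarrow> real^'n \<Rightarrow> real^'n" where
  "grad f x = (\<chi> i. partial i f x)"

lemma has_derivative_grad:
  assumes "f differentiable (at x)"
  shows "(f has_derivative (\<lambda>h. grad f x \<bullet> h)) (at x)"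
proof -
  let ?D = "frechet_derivative f (at x)"
  have D: "(f has_derivative ?D) (at x)" using assms by (simp add: frechet_derivative_works)
  then have lin: "linear ?D" by (simp add: has_derivative_linear)
  have "?D h = grad f x \<bullet> h" for h
  proof -
    have "?D h = ?D (\<Sum>i\<in>UNIV. h $ i *\<^sub>R axis i 1)"
      by (simp add: basis_expansion flip: scalar_mult_eq_scaleR)
    also have "\<dots> = (\<Sum>i\<in>UNIV. h $ i * ?D (axis i 1))"
      using lin by (simp add: linear_sum linear_cmul)
    also have "\<dots> = grad f x \<bullet> h"
      by (simp add: grad_def inner_vec_def partial_def mult.commute)
    finally show ?thesis .
  qed
  then have "?D = (\<lambda>h. grad f x \<bullet> h)" by blast
  then show ?thesis using D by simp
qed

lemma grad_eqI:
  assumes "(f has_derivative (\<lambda>h. g \<bullet> h)) (at x)"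
  shows "grad f x = g"
  using frechet_derivative_at[OF assms]
  by (simp add: grad_def partial_def vec_eq_iff inner_axis fun_eq_iff) (metis inner_axis inner_real_def mult.right_neutral)

lemma directional_derivative:
  assumes "(f has_derivative f') (at x)"
  shows "((\<lambda>t. f (x + t *\<^sub>R d)) has_real_derivative f' d) (at 0)"
proof -
  have 1: "((\<lambda>t::real. x + t *\<^sub>R d) has_derivative (\<lambda>t. t *\<^sub>R d)) (at 0)"
    by (auto intro!: derivative_eq_intros)
  have "(f \<circ> (\<lambda>t::real. x + t *\<^sub>R d) has_derivative f' \<circ> (\<lambda>t. t *\<^sub>R d)) (at 0)"
    using assms by (intro diff_chain_at[OF 1]) simp
  moreover have "f' (t *\<^sub>R d) = t * f' d" for t
    using has_derivative_linear[OF assms] by (simp add: linear_cmul)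
  ultimately show ?thesis
    by (simp add: has_field_derivative_def o_def mult_commute_abs)
qed

lemma test_functions_grad:
  assumes "\<phi> \<in> test_functions \<Omega>"
  shows "(\<phi> has_derivative (\<lambda>h. grad \<phi> x \<bullet> h)) (at x)" "continuous_on UNIV (grad \<phi>)"
  using test_functions_differentiable[OF assms] unfolding grad_def
  by (auto intro!: has_derivative_grad[unfolded grad_def] continuous_on_vec_lambda)

lemma test_functions_zero:
  assumes "\<phi> \<in> test_functions \<Omega>" "x \<notin> \<Omega>"
  shows "\<phi> x = 0" "grad \<phi> x = 0"
proof -
  let ?S = "closure {x. \<phi> x \<noteq> 0}"
  have x: "x \<in> - ?S" using assms by (auto simp: test_functions_def)
  have zero: "\<phi> y = 0" if "y \<in> - ?S" for y using that closure_subset[of "{x. \<phi> x \<noteq> 0}"] by auto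
  show "\<phi> x = 0" using x by (rule zero)
  have "(\<phi> has_derivative (\<lambda>h. 0)) (at x)"
  proof (rule has_derivative_transform_within_open[OF has_derivative_const _ x])
    show "open (- ?S)" by (intro open_Compl closed_closure)
    show "0 = \<phi> y" if "y \<in> - ?S" for y using zero[OF that] by (rule sym)
  qed
  then show "grad \<phi> x = 0" by (intro grad_eqI) simp
qed

lemma compact_closed_subset:
  fixes S T :: "'a::heine_borel set"
  assumes "compact T" "closed S" "S \<subseteq> T"
  shows "compact S"
  using assms bounded_subset unfolding compact_eq_bounded_closed by metis

lemma test_functions_add: "\<phi> \<in> test_functions \<Omega> \<Longrightarrow> \<psi> \<in> test_functions \<Omega> \<Longrightarrow> (\<lambda>x. \<phi> x + \<psi> x) \<in> test_functions \<Omega>"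
proof -
  assume a: "\<phi> \<in> test_functions \<Omega>" "\<psi> \<in> test_functions \<Omega>"
  have "closure {x. \<phi> x + \<psi> x \<noteq> 0} \<subseteq> closure ({x. \<phi> x \<noteq> 0} \<union> {x. \<psi> x \<noteq> 0})"
    by (intro closure_mono) auto
  then have sub: "closure {x. \<phi> x + \<psi> x \<noteq> 0} \<subseteq> closure {x. \<phi> x \<noteq> 0} \<union> closure {x. \<psi> x \<noteq> 0}"
    by (simp add: closure_Un)
  have "compact (closure {x. \<phi> x \<noteq> 0} \<union> closure {x. \<psi> x \<noteq> 0})"
    using a by (intro compact_Un) (simp_all add: test_functions_def)
  then have cpt: "compact (closure {x. \<phi> x + \<psi> x \<noteq> 0})"
    by (rule compact_closed_subset[OF _ closed_closure sub])
  have "C_k k (\<lambda>x. \<phi> x + \<psi> x)" for k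
    using a by (intro C_k_add) (simp_all add: test_functions_def)
  moreover have "closure {x. \<phi> x + \<psi> x \<noteq> 0} \<subseteq> \<Omega>"
    using a by (intro subset_trans[OF sub] Un_least) (simp_all add: test_functions_def)
  ultimately show ?thesis using cpt by (simp add: test_functions_def)
qed

lemma test_functions_scale: "\<phi> \<in> test_functions \<Omega> \<Longrightarrow> (\<lambda>x. c * \<phi> x) \<in> test_functions \<Omega>"
proof -
  assume a: "\<phi> \<in> test_functions \<Omega>"
  have sub: "closure {x. c * \<phi> x \<noteq> 0} \<subseteq> closure {x. \<phi> x \<noteq> 0}"
    by (intro closure_mono) auto
  have "compact (closure {x. \<phi> x \<noteq> 0})" using a by (simp add: test_functions_def)
  then have cpt: "compact (closure {x. c * \<phi> x \<noteq> 0})"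
    by (rule compact_closed_subset[OF _ closed_closure sub])
  have "C_k k (\<lambda>x. c * \<phi> x)" for k
    using a by (intro C_k_mult C_k_const) (simp add: test_functions_def)
  moreover have "closure {x. c * \<phi> x \<noteq> 0} \<subseteq> \<Omega>"
    using a by (intro subset_trans[OF sub]) (simp add: test_functions_def)
  ultimately show ?thesis using cpt by (simp add: test_functions_def)
qed

locale bounded_domain =
  fixes \<Omega> :: "(real^'n) set" and p :: real
  assumes p: "1 < p" and open_\<Omega>: "open \<Omega>" and bounded_\<Omega>: "bounded \<Omega>"
begin

abbreviation "M \<equiv> lebesgue_on \<Omega>"

lemma \<Omega>_sets [simp]: "\<Omega> \<in> sets lebesgue" using open_\<Omega> by auto

lemma finite_M: "finite_measure M"
  using bounded_\<Omega> by (intro finite_measure_lebesgue_on bounded_set_imp_lmeasurable) auto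

lemma continuous_measurable_M:
  fixes f :: "real^'n \<Rightarrow> 'b::euclidean_space"
  assumes "continuous_on \<Omega> f"
  shows "f \<in> borel_measurable M"
  using assms by (intro continuous_imp_measurable_on_sets_lebesgue) auto

lemma continuous_bounded_on_\<Omega>:
  fixes f :: "real^'n \<Rightarrow> 'b::euclidean_space"
  assumes "continuous_on (closure \<Omega>) f"
  obtains K where "K > 0" "\<And>x. x \<in> closure \<Omega> \<Longrightarrow> norm (f x) \<le> K"
proof -
  have "compact (f ` closure \<Omega>)"
    using assms bounded_\<Omega> by (intro compact_continuous_image) (auto simp: compact_closure)
  then have "bounded (f ` closure \<Omega>)" by (rule compact_imp_bounded)
  then obtain K where "\<forall>y\<in>f ` closure \<Omega>. norm y \<le> K" "K > 0"
    using bounded_pos by blast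
  then show ?thesis using that[of K] by blast
qed

lemma lp_continuous:
  fixes f :: "real^'n \<Rightarrow> 'b::euclidean_space"
  assumes "continuous_on (closure \<Omega>) f"
  shows "lp M p f"
proof -
  obtain K where K: "\<And>x. x \<in> closure \<Omega> \<Longrightarrow> norm (f x) \<le> K"
    using continuous_bounded_on_\<Omega>[OF assms] by blast
  show ?thesis
    using K closure_subset[of \<Omega>] p
    by (intro lp_bounded[OF finite_M, of _ K] continuous_measurable_M continuous_on_subset[OF assms]) auto
qed

lemma integrable_continuous_M:
  fixes f :: "real^'n \<Rightarrow> 'b::euclidean_space"
  assumes "continuous_on (closure \<Omega>) f"
  shows "integrable M f"
  using lp_imp_integrable[OF finite_M p lp_continuous[OF assms]] .

lemma has_weak_gradient_iff:
  "has_weak_gradient \<Omega> p u G \<longleftrightarrow> lp M p u \<and> lp M p G \<and>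
     (\<forall>\<phi>\<in>test_functions \<Omega>. \<forall>i.
        (\<integral>x. u x * partial i \<phi> x \<partial>M) = - (\<integral>x. G x $ i * \<phi> x \<partial>M))"
  by (simp add: has_weak_gradient_def Lp_def lp_def)

abbreviation "wgrad \<equiv> has_weak_gradient \<Omega> p"

lemma wgradD:
  assumes "wgrad u G"
  shows "lp M p u" "lp M p G"
    "\<phi> \<in> test_functions \<Omega> \<Longrightarrow> (\<integral>x. u x * partial i \<phi> x \<partial>M) = - (\<integral>x. G x $ i * \<phi> x \<partial>M)"
  using assms unfolding has_weak_gradient_iff by simp_all

lemma lp_inner_integrable:
  assumes "lp M p f" "continuous_on (closure \<Omega>) \<phi>"
  shows "integrable M (\<lambda>x. f x \<bullet> \<phi> x)"
proof -
  obtain K where K: "\<And>x. x \<in> closure \<Omega> \<Longrightarrow> norm (\<phi> x) \<le> K"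
    using continuous_bounded_on_\<Omega>[OF assms(2)] by blast
  show ?thesis
    by (rule lp_tendsto_inner(1)[OF finite_M p assms(1) assms(1), where K=K])
       (use K closure_subset[of \<Omega>] in \<open>auto simp: pint_def intro!: continuous_measurable_M continuous_on_subset[OF assms(2)]\<close>)
qed

lemma lp_inner_tendsto:
  assumes "\<And>k. lp M p (f k)" "lp M p g" "(\<lambda>k. pint M p (\<lambda>x. f k x - g x)) \<longlonglongrightarrow> 0"
    and "continuous_on (closure \<Omega>) \<phi>"
  shows "(\<lambda>k. \<integral>x. f k x \<bullet> \<phi> x \<partial>M) \<longlonglongrightarrow> (\<integral>x. g x \<bullet> \<phi> x \<partial>M)"
proof -
  obtain K where K: "\<And>x. x \<in> closure \<Omega> \<Longrightarrow> norm (\<phi> x) \<le> K"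
    using continuous_bounded_on_\<Omega>[OF assms(4)] by blast
  show ?thesis
    by (rule lp_tendsto_inner(2)[OF finite_M p assms(1,2,3), where K=K])
       (use K closure_subset[of \<Omega>] in \<open>auto intro!: continuous_measurable_M continuous_on_subset[OF assms(4)]\<close>)
qed

lemma test_continuous:
  assumes "\<phi> \<in> test_functions \<Omega>"
  shows "continuous_on S \<phi>" "continuous_on S (partial i \<phi>)" "continuous_on S (grad \<phi>)"
  using test_functions_differentiable[OF assms] test_functions_grad[OF assms]
  by (auto intro: continuous_on_subset)

lemma wgrad_integrable:
  assumes "wgrad u G" "\<phi> \<in> test_functions \<Omega>"
  shows "integrable M (\<lambda>x. u x * partial i \<phi> x)" "integrable M (\<lambda>x. G x $ i * \<phi> x)"
proof -
  show "integrable M (\<lambda>x. u x * partial i \<phi> x)"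
    using lp_inner_integrable[of u "partial i \<phi>"] assms test_continuous[OF assms(2)]
    by (simp add: has_weak_gradient_iff)
  have "integrable M (\<lambda>x. G x \<bullet> (\<phi> x *\<^sub>R axis i 1))"
    using assms test_continuous[OF assms(2)]
    by (intro lp_inner_integrable continuous_intros) (auto simp: has_weak_gradient_iff)
  then show "integrable M (\<lambda>x. G x $ i * \<phi> x)" by (simp add: inner_axis mult.commute)
qed

text \<open>
This makes all quantities built from the chosen weak gradient independent of the choice.
\<close>

lemma wgrad_unique:
  assumes "wgrad u G" "wgrad u G'"
  shows "AE x in M. G x = G' x"
proof -
  have "AE x in M. G x $ i - G' x $ i = 0" for i
  proof (rule fundamental_lemma_calculus_of_variations[OF open_\<Omega>])
    have "integrable M G" "integrable M G'"
      using assms lp_imp_integrable[OF finite_M p] by (auto simp: has_weak_gradient_iff)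
    then have "integrable M (\<lambda>x. G x \<bullet> axis i 1)" "integrable M (\<lambda>x. G' x \<bullet> axis i 1)"
      by (auto intro: integrable_inner_left)
    then show "integrable M (\<lambda>x. G x $ i - G' x $ i)" by (simp add: inner_axis)
    fix \<phi> assume \<phi>: "\<phi> \<in> test_functions \<Omega>"
    have "(\<integral>x. G x $ i * \<phi> x \<partial>M) = (\<integral>x. G' x $ i * \<phi> x \<partial>M)"
      using wgradD(3)[OF assms(1) \<phi>, of i] wgradD(3)[OF assms(2) \<phi>, of i] by simp
    then show "(\<integral>x. (G x $ i - G' x $ i) * \<phi> x \<partial>M) = 0"
      using wgrad_integrable(2)[OF assms(1) \<phi>, of i] wgrad_integrable(2)[OF assms(2) \<phi>, of i]
      by (simp add: left_diff_distrib)
  qed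
  then have "AE x in M. \<forall>i\<in>UNIV. G x $ i - G' x $ i = 0" by (intro AE_finite_allI) auto
  then show ?thesis by eventually_elim (simp add: vec_eq_iff)
qed

lemma wgrad_add: assumes "wgrad u G" "wgrad v H" shows "wgrad (\<lambda>x. u x + v x) (\<lambda>x. G x + H x)"
  unfolding has_weak_gradient_iff
proof (intro conjI ballI allI)
  show "lp M p (\<lambda>x. u x + v x)" "lp M p (\<lambda>x. G x + H x)"
    by (intro lp_add(1)[OF p] wgradD[OF assms(1)] wgradD[OF assms(2)])+
  fix \<phi> i assume \<phi>: "\<phi> \<in> test_functions \<Omega>"
  show "(\<integral>x. (u x + v x) * partial i \<phi> x \<partial>M) = - (\<integral>x. (G x + H x) $ i * \<phi> x \<partial>M)"
    using wgradD(3)[OF assms(1) \<phi>, of i] wgradD(3)[OF assms(2) \<phi>, of i]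
      wgrad_integrable[OF assms(1) \<phi>, of i] wgrad_integrable[OF assms(2) \<phi>, of i]
    by (simp add: distrib_right)
qed

lemma wgrad_scale: assumes "wgrad u G" shows "wgrad (\<lambda>x. c * u x) (\<lambda>x. c *\<^sub>R G x)"
  unfolding has_weak_gradient_iff
proof (intro conjI ballI allI)
  show "lp M p (\<lambda>x. c * u x)" "lp M p (\<lambda>x. c *\<^sub>R G x)"
    using lp_scaleR(1)[OF wgradD(1)[OF assms], of c] lp_scaleR(1)[OF wgradD(2)[OF assms], of c] by simp_all
  fix \<phi> i assume \<phi>: "\<phi> \<in> test_functions \<Omega>"
  show "(\<integral>x. (c * u x) * partial i \<phi> x \<partial>M) = - (\<integral>x. (c *\<^sub>R G x) $ i * \<phi> x \<partial>M)"
    using wgradD(3)[OF assms(1) \<phi>, of i] by (simp add: mult.assoc)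
qed

lemma wgrad_diff: assumes "wgrad u G" "wgrad v H" shows "wgrad (\<lambda>x. u x - v x) (\<lambda>x. G x - H x)"
  using wgrad_add[OF assms(1) wgrad_scale[OF assms(2), of "-1"]] by simp

text \<open>
The defining identity of a weak gradient is preserved because test functions and their derivatives
are bounded.
\<close>

lemma wgrad_limit:
  assumes "\<And>k. wgrad (u k) (G k)" "lp M p v" "lp M p H"
    and "(\<lambda>k. pint M p (\<lambda>x. u k x - v x)) \<longlonglongrightarrow> 0" "(\<lambda>k. pint M p (\<lambda>x. G k x - H x)) \<longlonglongrightarrow> 0"
  shows "wgrad v H"
  unfolding has_weak_gradient_iff
proof (intro conjI ballI allI)
  fix \<phi> i assume \<phi>: "\<phi> \<in> test_functions \<Omega>"
  have lp: "lp M p (u k)" "lp M p (G k)" for k using assms(1) by (auto simp: has_weak_gradient_iff)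
  have 1: "(\<lambda>k. \<integral>x. u k x * partial i \<phi> x \<partial>M) \<longlonglongrightarrow> (\<integral>x. v x * partial i \<phi> x \<partial>M)"
    using lp_inner_tendsto[OF lp(1) assms(2,4) test_continuous(2)[OF \<phi>, of _ i]] by simp
  have "(\<lambda>k. \<integral>x. G k x \<bullet> (\<phi> x *\<^sub>R axis i 1) \<partial>M) \<longlonglongrightarrow> (\<integral>x. H x \<bullet> (\<phi> x *\<^sub>R axis i 1) \<partial>M)"
    using test_continuous[OF \<phi>] by (intro lp_inner_tendsto lp assms continuous_intros) auto
  then have 2: "(\<lambda>k. - (\<integral>x. G k x $ i * \<phi> x \<partial>M)) \<longlonglongrightarrow> - (\<integral>x. H x $ i * \<phi> x \<partial>M)"
    by (intro tendsto_minus) (simp add: inner_axis mult.commute)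
  have "(\<integral>x. u k x * partial i \<phi> x \<partial>M) = - (\<integral>x. G k x $ i * \<phi> x \<partial>M)" for k
    by (rule wgradD(3)[OF assms(1) \<phi>])
  then show "(\<integral>x. v x * partial i \<phi> x \<partial>M) = - (\<integral>x. H x $ i * \<phi> x \<partial>M)"
    using LIMSEQ_unique[OF 1] 2 by simp
qed fact+

lemma W1p_iff: "u \<in> W1p \<Omega> p \<longleftrightarrow> (\<exists>G. wgrad u G)"
  by (simp add: W1p_def)

lemma wgrad_weak_gradient:
  assumes "u \<in> W1p \<Omega> p"
  shows "wgrad u (weak_gradient \<Omega> p u)"
proof -
  have "\<exists>G. wgrad u G" using assms by (simp add: W1p_iff)
  then show ?thesis unfolding weak_gradient_def by (rule someI_ex)
qed

lemma AE_weak_gradient: "wgrad u G \<Longrightarrow> AE x in M. weak_gradient \<Omega> p u x = G x"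
  by (rule wgrad_unique[OF wgrad_weak_gradient]) (auto simp: W1p_iff)

text \<open>
The direction \<open>d\<close> is arbitrary, and only the derivative of \<open>A\<close> along \<open>d\<close> has to exist: the Wolff
solutions are differentiated along the directions of their own orthonormal frame.
\<close>

lemma test_integration_by_parts:
  assumes \<phi>: "\<phi> \<in> test_functions \<Omega>"
    and A: "\<And>x. ((\<lambda>t. A (x + t *\<^sub>R d)) has_real_derivative A' x) (at 0)"
    and cont: "continuous_on UNIV A" "continuous_on UNIV A'"
  shows "(\<integral>x. A x * (grad \<phi> x \<bullet> d) \<partial>M) = - (\<integral>x. A' x * \<phi> x \<partial>M)"
proof -
  let ?g = "\<lambda>x. A x * (grad \<phi> x \<bullet> d) + A' x * \<phi> x"
  obtain r where r: "\<And>x. x \<in> \<Omega> \<Longrightarrow> norm x \<le> r" using bounded_\<Omega> by (auto simp: bounded_iff)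
  have out: "x \<notin> \<Omega>" if "r < norm x" for x using r[of x] that by auto
  have cg: "continuous_on S ?g" for S
    using test_continuous[OF \<phi>] cont by (intro continuous_intros) (auto intro: continuous_on_subset)
  have "(\<integral>x. ?g x \<partial>lborel) = 0"
  proof (rule integral_directional_derivative_eq_0[where r=r and d=d])
    show "((\<lambda>t. A (x + t *\<^sub>R d) * \<phi> (x + t *\<^sub>R d)) has_real_derivative ?g x) (at 0)" for x
      using DERIV_mult[OF A[of x] directional_derivative[OF test_functions_grad(1)[OF \<phi>, of x], of d]]
      by (simp add: algebra_simps)
    show "continuous_on UNIV (\<lambda>x. A x * \<phi> x)"
      using test_continuous[OF \<phi>] cont by (intro continuous_intros) auto
  qed (use cg test_functions_zero[OF \<phi>] out in auto)
  moreover have "(\<integral>x. ?g x \<partial>M) = (\<integral>x. ?g x \<partial>lborel)"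
    using cg test_functions_zero[OF \<phi>]
    by (intro integral_lebesgue_on_eq_lborel open_\<Omega> borel_measurable_continuous_onI) auto
  moreover have "(\<integral>x. ?g x \<partial>M) = (\<integral>x. A x * (grad \<phi> x \<bullet> d) \<partial>M) + (\<integral>x. A' x * \<phi> x \<partial>M)"
    using test_continuous[OF \<phi>] cont
    by (intro Bochner_Integration.integral_add integrable_continuous_M continuous_intros)
       (auto intro: continuous_on_subset)
  ultimately show ?thesis by simp
qed

lemma wgrad_C1:
  assumes deriv: "\<And>x. (u has_derivative (\<lambda>h. G x \<bullet> h)) (at x)" and G: "continuous_on UNIV G"
  shows "wgrad u G"
proof -
  have u: "continuous_on UNIV u"
    by (intro continuous_at_imp_continuous_on ballI has_derivative_continuous[OF deriv])
  have "(\<integral>x. u x * partial i \<phi> x \<partial>M) = - (\<integral>x. G x $ i * \<phi> x \<partial>M)" if "\<phi> \<in> test_functions \<Omega>" for \<phi> i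
    using test_integration_by_parts[OF that directional_derivative[OF deriv], of "axis i 1"] u G
    by (simp add: inner_axis grad_def continuous_on_component)
  then show ?thesis
    unfolding has_weak_gradient_iff
    using lp_continuous[OF continuous_on_subset[OF u subset_UNIV]] lp_continuous[OF continuous_on_subset[OF G subset_UNIV]]
    by simp
qed

lemma wgrad_test: "\<phi> \<in> test_functions \<Omega> \<Longrightarrow> wgrad \<phi> (grad \<phi>)"
  by (intro wgrad_C1 test_functions_grad)

lemma grad_add:
  assumes "\<phi> \<in> test_functions \<Omega>" "\<psi> \<in> test_functions \<Omega>"
  shows "grad (\<lambda>x. \<phi> x + \<psi> x) x = grad \<phi> x + grad \<psi> x"
  by (rule grad_eqI) (use has_derivative_add[OF test_functions_grad(1)[OF assms(1)] test_functions_grad(1)[OF assms(2)], of x] in \<open>simp add: inner_add_left\<close>)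

lemma grad_scale:
  assumes "\<phi> \<in> test_functions \<Omega>"
  shows "grad (\<lambda>x. c * \<phi> x) x = c *\<^sub>R grad \<phi> x"
  by (rule grad_eqI) (use has_derivative_mult_right[OF test_functions_grad(1)[OF assms(1)], of c x] in simp)

text \<open>
Restates membership in the closure of the test functions with an explicit weak gradient and without
the \<open>p\<close>-th root.
\<close>

lemma W1p0_iff:
  assumes u: "wgrad u G"
  shows "u \<in> W1p0 \<Omega> p \<longleftrightarrow>
    (\<forall>e>0. \<exists>\<phi>\<in>test_functions \<Omega>. pint M p (\<lambda>x. u x - \<phi> x) < e \<and> pint M p (\<lambda>x. G x - grad \<phi> x) < e)"
proof -
  let ?a = "\<lambda>\<phi>. pint M p (\<lambda>x. u x - \<phi> x)" and ?b = "\<lambda>\<phi>. pint M p (\<lambda>x. G x - grad \<phi> x)"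
  have norm: "W1p_norm \<Omega> p (\<lambda>x. u x - \<phi> x) = (?a \<phi> + ?b \<phi>) powr (1 / p)"
    if "\<phi> \<in> test_functions \<Omega>" for \<phi>
  proof -
    have w: "wgrad (\<lambda>x. u x - \<phi> x) (\<lambda>x. G x - grad \<phi> x)"
      using wgrad_diff[OF u wgrad_test[OF that]] .
    have "(\<integral>x. norm (weak_gradient \<Omega> p (\<lambda>x. u x - \<phi> x) x) powr p \<partial>M) = ?b \<phi>"
      unfolding pint_def
    proof (rule integral_cong_AE)
      have "wgrad (\<lambda>x. u x - \<phi> x) (weak_gradient \<Omega> p (\<lambda>x. u x - \<phi> x))"
        using w by (intro wgrad_weak_gradient) (auto simp: W1p_iff)
      then have m: "weak_gradient \<Omega> p (\<lambda>x. u x - \<phi> x) \<in> borel_measurable M" "(\<lambda>x. G x - grad \<phi> x) \<in> borel_measurable M"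
        using w by (auto simp: has_weak_gradient_iff lp_def)
      then show "(\<lambda>x. norm (weak_gradient \<Omega> p (\<lambda>x. u x - \<phi> x) x) powr p) \<in> borel_measurable M"
        "(\<lambda>x. norm (G x - grad \<phi> x) powr p) \<in> borel_measurable M" by measurable
      show "AE x in M. norm (weak_gradient \<Omega> p (\<lambda>x. u x - \<phi> x) x) powr p = norm (G x - grad \<phi> x) powr p"
        using AE_weak_gradient[OF w] by eventually_elim simp
    qed
    then show ?thesis by (simp add: W1p_norm_def pint_def)
  qed
  have small: "A powr (1 / p) < e \<longleftrightarrow> A < e powr p" if "A \<ge> 0" "e > 0" for A e
  proof -
    have A: "(A powr (1 / p)) powr p = A" using p that by (simp add: powr_powr)
    show ?thesis
    proof
      assume "A powr (1 / p) < e"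
      then have "(A powr (1 / p)) powr p < e powr p" using p by (intro powr_less_mono2) auto
      then show "A < e powr p" by (simp only: A)
    next
      assume "A < e powr p"
      then have "\<not> e powr p \<le> (A powr (1 / p)) powr p" by (simp only: A not_le)
      then have "\<not> e \<le> A powr (1 / p)" using p that powr_mono2[of p e "A powr (1 / p)"] by auto
      then show "A powr (1 / p) < e" by simp
    qed
  qed
  have "u \<in> W1p0 \<Omega> p \<longleftrightarrow> (\<forall>e>0. \<exists>\<phi>\<in>test_functions \<Omega>. ?a \<phi> + ?b \<phi> < e powr p)"
    unfolding W1p0_def using u by (auto simp: W1p_iff norm small)
  also have "\<dots> \<longleftrightarrow> (\<forall>e>0. \<exists>\<phi>\<in>test_functions \<Omega>. ?a \<phi> < e \<and> ?b \<phi> < e)"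
  proof (intro iffI allI impI)
    fix e :: real assume *: "\<forall>e>0. \<exists>\<phi>\<in>test_functions \<Omega>. ?a \<phi> + ?b \<phi> < e powr p" and "e > 0"
    have "0 < e powr (1 / p)" using \<open>e > 0\<close> by simp
    then obtain \<phi> where \<phi>: "\<phi> \<in> test_functions \<Omega>" "?a \<phi> + ?b \<phi> < (e powr (1 / p)) powr p"
      using *[rule_format] by blast
    have "(e powr (1 / p)) powr p = e" using p \<open>e > 0\<close> by (simp add: powr_powr)
    then have "?a \<phi> + ?b \<phi> < e" using \<phi>(2) by simp
    then have "?a \<phi> < e \<and> ?b \<phi> < e"
      using pint_nonneg[of M p "\<lambda>x. u x - \<phi> x"] pint_nonneg[of M p "\<lambda>x. G x - grad \<phi> x"] by linarith
    then show "\<exists>\<phi>\<in>test_functions \<Omega>. ?a \<phi> < e \<and> ?b \<phi> < e" using \<phi>(1) by blast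
  next
    fix e :: real assume *: "\<forall>e>0. \<exists>\<phi>\<in>test_functions \<Omega>. ?a \<phi> < e \<and> ?b \<phi> < e" and "e > 0"
    have "0 < e powr p / 2" using \<open>e > 0\<close> by simp
    then obtain \<phi> where "\<phi> \<in> test_functions \<Omega>" "?a \<phi> < e powr p / 2" "?b \<phi> < e powr p / 2"
      using *[rule_format] by blast
    then show "\<exists>\<phi>\<in>test_functions \<Omega>. ?a \<phi> + ?b \<phi> < e powr p" by (intro bexI[of _ \<phi>]) auto
  qed
  finally show ?thesis .
qed

end

section \<open>The closure of the test functions\<close>

lemma pint_tendsto_0I:
  assumes "\<And>k. pint M p (\<lambda>x. f x - h k x) < inverse (real (Suc k))"
  shows "(\<lambda>k. pint M p (\<lambda>x. h k x - f x)) \<longlonglongrightarrow> 0"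
proof (rule tendsto_sandwich[OF _ _ tendsto_const LIMSEQ_inverse_real_of_nat])
  have "pint M p (\<lambda>x. h k x - f x) \<le> inverse (real (Suc k))" for k
    using assms[of k] unfolding pint_minus_commute[of M p f "h k"] by (rule less_imp_le)
  then show "\<forall>\<^sub>F k in sequentially. pint M p (\<lambda>x. h k x - f x) \<le> inverse (real (Suc k))" by simp
qed simp

context bounded_domain
begin

lemma W1p0_sequence:
  assumes u: "wgrad u G" "u \<in> W1p0 \<Omega> p"
  obtains \<phi> where "\<And>k. \<phi> k \<in> test_functions \<Omega>"
    "(\<lambda>k. pint M p (\<lambda>x. \<phi> k x - u x)) \<longlonglongrightarrow> 0" "(\<lambda>k. pint M p (\<lambda>x. grad (\<phi> k) x - G x)) \<longlonglongrightarrow> 0"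
proof -
  have "\<forall>k. \<exists>\<phi>\<in>test_functions \<Omega>. pint M p (\<lambda>x. u x - \<phi> x) < inverse (real (Suc k))
      \<and> pint M p (\<lambda>x. G x - grad \<phi> x) < inverse (real (Suc k))"
    using u(2) unfolding W1p0_iff[OF u(1)] by simp
  then have "\<exists>\<phi>. \<forall>k. \<phi> k \<in> test_functions \<Omega> \<and> pint M p (\<lambda>x. u x - \<phi> k x) < inverse (real (Suc k))
      \<and> pint M p (\<lambda>x. G x - grad (\<phi> k) x) < inverse (real (Suc k))"
    unfolding Bex_def by (rule choice)
  then obtain \<phi> where \<phi>: "\<And>k. \<phi> k \<in> test_functions \<Omega>"
    "\<And>k. pint M p (\<lambda>x. u x - \<phi> k x) < inverse (real (Suc k))"
    "\<And>k. pint M p (\<lambda>x. G x - grad (\<phi> k) x) < inverse (real (Suc k))" by auto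
  have "(\<lambda>k. pint M p (\<lambda>x. \<phi> k x - u x)) \<longlonglongrightarrow> 0" "(\<lambda>k. pint M p (\<lambda>x. grad (\<phi> k) x - G x)) \<longlonglongrightarrow> 0"
    by (rule pint_tendsto_0I[OF \<phi>(2)], rule pint_tendsto_0I[OF \<phi>(3)])
  then show ?thesis by (rule that[OF \<phi>(1)])
qed

lemma W1p0_closed:
  assumes wk: "\<And>k. wgrad (w k) (G k)" "\<And>k. w k \<in> W1p0 \<Omega> p" and v: "wgrad v H"
    and lim: "(\<lambda>k. pint M p (\<lambda>x. w k x - v x)) \<longlonglongrightarrow> 0" "(\<lambda>k. pint M p (\<lambda>x. G k x - H x)) \<longlonglongrightarrow> 0"
  shows "v \<in> W1p0 \<Omega> p"
  unfolding W1p0_iff[OF v]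
proof (intro allI impI)
  fix e :: real assume "e > 0"
  define c where "c = e / (2 * 2 powr p)"
  have c: "c > 0" using \<open>e > 0\<close> by (simp add: c_def)
  have "\<forall>\<^sub>F k in sequentially. pint M p (\<lambda>x. w k x - v x) < c \<and> pint M p (\<lambda>x. G k x - H x) < c"
    by (intro eventually_conj order_tendstoD(2)[OF lim(1)] order_tendstoD(2)[OF lim(2)] c)
  then obtain k where k: "pint M p (\<lambda>x. w k x - v x) < c" "pint M p (\<lambda>x. G k x - H x) < c"
    using eventually_happens'[OF sequentially_bot] by blast
  obtain \<phi> where \<phi>: "\<phi> \<in> test_functions \<Omega>" "pint M p (\<lambda>x. w k x - \<phi> x) < c" "pint M p (\<lambda>x. G k x - grad \<phi> x) < c"
    using wk(2)[of k] c unfolding W1p0_iff[OF wk(1)[of k]] by blast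
  have lp: "lp M p v" "lp M p H" "lp M p (w k)" "lp M p (G k)" "lp M p \<phi>" "lp M p (grad \<phi>)"
    using v wk(1)[of k] wgrad_test[OF \<phi>(1)] by (auto simp: has_weak_gradient_iff)
  have "pint M p (\<lambda>x. v x - \<phi> x) \<le> 2 powr p * (pint M p (\<lambda>x. v x - w k x) + pint M p (\<lambda>x. w k x - \<phi> x))"
    by (rule pint_triangle[OF p lp(1,3,5)])
  also have "\<dots> < 2 powr p * (c + c)"
    using k \<phi> by (intro mult_strict_left_mono) (auto simp: pint_minus_commute[of M p v])
  finally have 1: "pint M p (\<lambda>x. v x - \<phi> x) < e" by (simp add: c_def)
  have "pint M p (\<lambda>x. H x - grad \<phi> x) \<le> 2 powr p * (pint M p (\<lambda>x. H x - G k x) + pint M p (\<lambda>x. G k x - grad \<phi> x))"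
    by (rule pint_triangle[OF p lp(2,4,6)])
  also have "\<dots> < 2 powr p * (c + c)"
    using k \<phi> by (intro mult_strict_left_mono) (auto simp: pint_minus_commute[of M p H])
  finally have 2: "pint M p (\<lambda>x. H x - grad \<phi> x) < e" by (simp add: c_def)
  show "\<exists>\<phi>\<in>test_functions \<Omega>. pint M p (\<lambda>x. v x - \<phi> x) < e \<and> pint M p (\<lambda>x. H x - grad \<phi> x) < e"
    using \<phi>(1) 1 2 by blast
qed

lemma W1p0_test: assumes "\<phi> \<in> test_functions \<Omega>" shows "\<phi> \<in> W1p0 \<Omega> p"
  unfolding W1p0_iff[OF wgrad_test[OF assms]]
  using assms p by (auto intro!: bexI[of _ \<phi>] simp: pint_def)

lemma W1p0_W1p: "u \<in> W1p0 \<Omega> p \<Longrightarrow> u \<in> W1p \<Omega> p"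
  by (simp add: W1p0_def)

lemma W1p0_add_scale:
  assumes "u \<in> W1p0 \<Omega> p" "v \<in> W1p0 \<Omega> p"
  shows "(\<lambda>x. u x + c * v x) \<in> W1p0 \<Omega> p"
proof -
  obtain G H where G: "wgrad u G" and H: "wgrad v H" using assms W1p0_W1p W1p_iff by blast
  obtain \<phi> where \<phi>: "\<And>k. \<phi> k \<in> test_functions \<Omega>"
    "(\<lambda>k. pint M p (\<lambda>x. \<phi> k x - u x)) \<longlonglongrightarrow> 0" "(\<lambda>k. pint M p (\<lambda>x. grad (\<phi> k) x - G x)) \<longlonglongrightarrow> 0"
    using W1p0_sequence[OF G assms(1)] by blast
  obtain \<psi> where \<psi>: "\<And>k. \<psi> k \<in> test_functions \<Omega>"
    "(\<lambda>k. pint M p (\<lambda>x. \<psi> k x - v x)) \<longlonglongrightarrow> 0" "(\<lambda>k. pint M p (\<lambda>x. grad (\<psi> k) x - H x)) \<longlonglongrightarrow> 0"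
    using W1p0_sequence[OF H assms(2)] by blast
  have comb: "(\<lambda>k. pint M p (\<lambda>x. (f k x + c *\<^sub>R g k x) - (f' x + c *\<^sub>R g' x))) \<longlonglongrightarrow> 0"
    if f: "\<And>k. lp M p (f k)" "lp M p f'" and g: "\<And>k. lp M p (g k)" "lp M p g'"
      and lim: "(\<lambda>k. pint M p (\<lambda>x. f k x - f' x)) \<longlonglongrightarrow> 0" "(\<lambda>k. pint M p (\<lambda>x. g k x - g' x)) \<longlonglongrightarrow> 0"
    for f g :: "nat \<Rightarrow> real^'n \<Rightarrow> 'b::euclidean_space" and f' g'
  proof (rule tendsto_sandwich[OF _ _ tendsto_const])
    have "pint M p (\<lambda>x. (f k x + c *\<^sub>R g k x) - (f' x + c *\<^sub>R g' x))
        \<le> 2 powr p * (pint M p (\<lambda>x. f k x - f' x) + \<bar>c\<bar> powr p * pint M p (\<lambda>x. g k x - g' x))" for k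
    proof -
      have d: "lp M p (\<lambda>x. f k x - f' x)" "lp M p (\<lambda>x. g k x - g' x)"
        by (intro lp_diff(1)[OF p] f g)+
      show ?thesis
        using lp_add(2)[OF p d(1) lp_scaleR(1)[OF d(2), of c]] lp_scaleR(2)[OF d(2), of c]
        by (simp add: algebra_simps)
    qed
    then show "\<forall>\<^sub>F k in sequentially. pint M p (\<lambda>x. (f k x + c *\<^sub>R g k x) - (f' x + c *\<^sub>R g' x))
        \<le> 2 powr p * (pint M p (\<lambda>x. f k x - f' x) + \<bar>c\<bar> powr p * pint M p (\<lambda>x. g k x - g' x))" by simp
    have "(\<lambda>k. 2 powr p * (pint M p (\<lambda>x. f k x - f' x) + \<bar>c\<bar> powr p * pint M p (\<lambda>x. g k x - g' x)))
      \<longlonglongrightarrow> 2 powr p * (0 + \<bar>c\<bar> powr p * 0)"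
      by (intro tendsto_intros lim)
    then show "(\<lambda>k. 2 powr p * (pint M p (\<lambda>x. f k x - f' x) + \<bar>c\<bar> powr p * pint M p (\<lambda>x. g k x - g' x)))
      \<longlonglongrightarrow> 0" by simp
  qed simp
  define w where "w k x = \<phi> k x + c * \<psi> k x" for k x
  have w: "w k \<in> test_functions \<Omega>" for k
    unfolding w_def by (intro test_functions_add test_functions_scale \<phi> \<psi>)
  have gw: "grad (w k) x = grad (\<phi> k) x + c *\<^sub>R grad (\<psi> k) x" for k x
    unfolding w_def using grad_add[OF \<phi>(1) test_functions_scale[OF \<psi>(1)]] grad_scale[OF \<psi>(1)] by simp
  have lps: "lp M p u" "lp M p G" "lp M p v" "lp M p H" "lp M p (\<phi> k)" "lp M p (grad (\<phi> k))"
    "lp M p (\<psi> k)" "lp M p (grad (\<psi> k))" for k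
    using G H wgrad_test[OF \<phi>(1)[of k]] wgrad_test[OF \<psi>(1)[of k]] by (auto simp: has_weak_gradient_iff)
  show ?thesis
  proof (rule W1p0_closed[of w "\<lambda>k. grad (w k)"])
    show "wgrad (\<lambda>x. u x + c * v x) (\<lambda>x. G x + c *\<^sub>R H x)" by (intro wgrad_add wgrad_scale G H)
    show "(\<lambda>k. pint M p (\<lambda>x. w k x - (u x + c * v x))) \<longlonglongrightarrow> 0"
      using comb[OF lps(5,1,7,3) \<phi>(2) \<psi>(2)] by (simp add: w_def)
    show "(\<lambda>k. pint M p (\<lambda>x. grad (w k) x - (G x + c *\<^sub>R H x))) \<longlonglongrightarrow> 0"
      using comb[OF lps(6,2,8,4) \<phi>(3) \<psi>(3)] by (simp add: gw)
  qed (use w in \<open>auto intro: wgrad_test W1p0_test\<close>)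
qed

lemma zero_test: "(\<lambda>x. 0) \<in> test_functions \<Omega>"
  by (simp add: test_functions_def C_k_const)

lemma W1p0_zero: "(\<lambda>x. 0) \<in> W1p0 \<Omega> p"
  by (rule W1p0_test[OF zero_test])

lemma W1p0_diff: "u \<in> W1p0 \<Omega> p \<Longrightarrow> v \<in> W1p0 \<Omega> p \<Longrightarrow> (\<lambda>x. u x - v x) \<in> W1p0 \<Omega> p"
  using W1p0_add_scale[of u v "-1"] by simp

lemma W1p0_scale: "u \<in> W1p0 \<Omega> p \<Longrightarrow> (\<lambda>x. c * u x) \<in> W1p0 \<Omega> p"
  using W1p0_add_scale[OF W1p0_zero, of u c] by simp

text \<open>
For test functions the hypothesis says that \<open>F\<close> is weakly divergence free; the pairing is
continuous with respect to the gradient since \<open>F\<close> is bounded. Consequently the pairing of \<open>F\<close> with the gradient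
of a Sobolev function depends only on its boundary values.
\<close>

lemma W1p0_orthogonal_divergence_free:
  assumes u: "wgrad u G" "u \<in> W1p0 \<Omega> p" and F: "continuous_on (closure \<Omega>) F"
    and div: "\<And>\<phi>. \<phi> \<in> test_functions \<Omega> \<Longrightarrow> (\<integral>x. grad \<phi> x \<bullet> F x \<partial>M) = 0"
  shows "(\<integral>x. G x \<bullet> F x \<partial>M) = 0"
proof -
  obtain \<phi> where \<phi>: "\<And>k. \<phi> k \<in> test_functions \<Omega>" "(\<lambda>k. pint M p (\<lambda>x. grad (\<phi> k) x - G x)) \<longlonglongrightarrow> 0"
    using W1p0_sequence[OF u] by blast
  have "(\<lambda>k. \<integral>x. grad (\<phi> k) x \<bullet> F x \<partial>M) \<longlonglongrightarrow> (\<integral>x. G x \<bullet> F x \<partial>M)"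
    using wgrad_test[OF \<phi>(1)] u(1) by (intro lp_inner_tendsto \<phi>(2) F) (auto simp: has_weak_gradient_iff)
  then show ?thesis using div[OF \<phi>(1)] by (simp add: LIMSEQ_const_iff)
qed

end

section \<open>Uniform convexity of the p-th power of the norm\<close>

text \<open>
The strict tangent inequality for \<open>t\<^sup>p\<close> at \<open>1\<close>, by the mean value theorem.
\<close>

lemma bernoulli_powr_strict:
  fixes t p :: real
  assumes "p > 1" "t \<ge> 0" "t \<noteq> 1"
  shows "1 + p * (t - 1) < t powr p"
proof (cases "t = 0")
  case False
  then have t: "t > 0" using assms by simp
  have D: "((\<lambda>s. s powr p) has_real_derivative p * s powr (p - 1)) (at s)" if "s > 0" for s
    using that by (auto intro!: derivative_eq_intros)
  consider "1 < t" | "t < 1" using assms by linarith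
  then show ?thesis
  proof cases
    case 1
    obtain z where z: "1 < z" "z < t" "t powr p - 1 powr p = (t - 1) * (p * z powr (p - 1))"
      using MVT2[OF 1, of "\<lambda>s. s powr p" "\<lambda>s. p * s powr (p - 1)"] D by force
    have "1 < z powr (p - 1)" using z assms by simp
    then have "(t - 1) * p * 1 < (t - 1) * p * z powr (p - 1)"
      using 1 assms by (intro mult_strict_left_mono) auto
    then show ?thesis using z by (simp add: algebra_simps)
  next
    case 2
    obtain z where z: "t < z" "z < 1" "1 powr p - t powr p = (1 - t) * (p * z powr (p - 1))"
      using MVT2[OF 2, of "\<lambda>s. s powr p" "\<lambda>s. p * s powr (p - 1)"] D t by force
    have "z powr (p - 1) < 1 powr (p - 1)" using z t assms by (intro powr_less_mono2) auto
    then have "(1 - t) * p * z powr (p - 1) < (1 - t) * p * 1"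
      using 2 assms by (intro mult_strict_left_mono) auto
    then show ?thesis using z by (simp add: algebra_simps)
  qed
qed (use assms in simp)

text \<open>
The gradient of \<open>|c|\<^sup>p / p\<close>.
\<close>

definition flux :: "real \<Rightarrow> 'b::euclidean_space \<Rightarrow> 'b" where
  "flux p c = norm c powr (p - 2) *\<^sub>R c"

lemma norm_flux: "norm (flux p c) = norm c powr (p - 1)"
  using powr_mult_base[of "norm c" "p - 2"] by (cases "c = 0") (simp_all add: flux_def mult.commute)

lemma inner_flux: "flux p c \<bullet> c = norm c powr p"
proof (cases "c = 0")
  case False
  have "norm c powr (p - 2) * (norm c)\<^sup>2 = norm c powr (p - 2) * norm c powr 2"
    using False by simp
  also have "\<dots> = norm c powr p" using powr_add[of "norm c" "p - 2" 2] by simp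
  finally show ?thesis by (simp add: flux_def power2_norm_eq_inner)
qed (simp add: flux_def)

lemma flux_scale: "k > 0 \<Longrightarrow> flux p (k *\<^sub>R c) = k powr (p - 1) *\<^sub>R flux p c"
  by (simp add: flux_def powr_mult) (simp add: powr_mult_base mult.commute mult.assoc[symmetric])

lemma isCont_flux:
  assumes "p > 1"
  shows "isCont (flux p) c"
proof (cases "c = 0")
  case False
  then show ?thesis unfolding flux_def[abs_def] by (intro continuous_intros) auto
next
  case True
  have "((\<lambda>c::'a. norm (flux p c)) \<longlongrightarrow> 0) (at 0)"
    unfolding norm_flux
    using assms tendsto_powr'[of "norm :: 'a \<Rightarrow> real" 0 "at 0" "\<lambda>_. p - 1" "p - 1"]
    by (auto intro!: tendsto_eq_intros)
  then have "(flux p \<longlongrightarrow> (0::'a)) (at 0)" by (simp only: tendsto_norm_zero_iff)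
  then show ?thesis using True by (simp add: isCont_def flux_def)
qed

lemma borel_measurable_flux [measurable]: "p > 1 \<Longrightarrow> flux p \<in> borel_measurable borel"
  by (intro borel_measurable_continuous_onI continuous_at_imp_continuous_on ballI isCont_flux)

text \<open>
Dividing by \<open>|a|\<^sup>p\<close> reduces the claim to the scalar inequality at \<open>t = |b|/|a|\<close> together with the
Cauchy-Schwarz inequality. The former is strict unless the norms agree, and then the latter is
strict because \<open>a \<noteq> b\<close>. The non-strict form is the only convexity fact behind the Euler-Lagrange
equation and the lower energy bound.
\<close>

lemma norm_powr_tangent_strict:
  assumes "p > 1" "a \<noteq> b"
  shows "norm a powr p + p * (flux p a \<bullet> (b - a)) < norm b powr p"
proof (cases "a = 0")
  case True
  then show ?thesis using assms by (simp add: flux_def)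
next
  case False
  define A where "A = norm a"
  define t where "t = norm b / A"
  have A: "A > 0" using False by (simp add: A_def)
  have t: "t \<ge> 0" using A by (simp add: t_def)
  have nb: "norm b = A * t" using A by (simp add: t_def)
  have e1: "A powr (p - 2) * A\<^sup>2 = A powr p"
    using inner_flux[of p a] by (simp add: flux_def A_def power2_norm_eq_inner)
  have inn: "flux p a \<bullet> (b - a) = A powr (p - 2) * (a \<bullet> b) - A powr p"
    using e1 by (simp add: flux_def A_def inner_diff_right right_diff_distrib power2_norm_eq_inner)
  have cs: "a \<bullet> b \<le> A\<^sup>2 * t"
    using norm_cauchy_schwarz[of a b] nb by (simp add: A_def power2_eq_square mult.assoc)
  have "A powr p + p * (A powr (p - 2) * (a \<bullet> b) - A powr p) < A powr p * t powr p"
  proof (cases "t = 1")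
    case False
    have "A powr (p - 2) * (a \<bullet> b) \<le> A powr (p - 2) * (A\<^sup>2 * t)"
      using cs by (intro mult_left_mono) auto
    also have "\<dots> = A powr p * t" using e1 by (simp add: mult.assoc[symmetric])
    finally have "p * (A powr (p - 2) * (a \<bullet> b) - A powr p) \<le> p * (A powr p * t - A powr p)"
      using assms by (intro mult_left_mono) auto
    then have "A powr p + p * (A powr (p - 2) * (a \<bullet> b) - A powr p) \<le> A powr p * (1 + p * (t - 1))"
      by (simp add: algebra_simps)
    also have "\<dots> < A powr p * t powr p"
      using bernoulli_powr_strict[OF assms(1) t False] A by (intro mult_strict_left_mono) auto
    finally show ?thesis .
  next
    case True
    have "0 < (norm (a - b))\<^sup>2" using assms by simp
    also have "(norm (a - b))\<^sup>2 = 2 * (A\<^sup>2 - a \<bullet> b)"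
      using dot_norm_neg[of a b] nb True by (simp add: A_def)
    finally have "a \<bullet> b < A\<^sup>2" by simp
    then have "A powr (p - 2) * (a \<bullet> b) < A powr (p - 2) * A\<^sup>2"
      using A by (intro mult_strict_left_mono) auto
    then have "p * (A powr (p - 2) * (a \<bullet> b) - A powr p) < p * 0"
      using e1 assms by (intro mult_strict_left_mono) auto
    then show ?thesis using True by simp
  qed
  moreover have "norm b powr p = A powr p * t powr p" using nb A t by (simp add: powr_mult)
  ultimately show ?thesis using inn by (simp add: A_def)
qed

lemma norm_powr_tangent:
  assumes "p > 1"
  shows "norm a powr p + p * (flux p a \<bullet> (b - a)) \<le> norm b powr p"
  using norm_powr_tangent_strict[OF assms, of a b] by (cases "a = b") auto

lemma midpoint_gap:
  fixes a b :: "'b::euclidean_space"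
  assumes "p > 1"
  shows "norm ((1/2) *\<^sub>R (a + b)) powr p \<le> (norm a powr p + norm b powr p) / 2"
    "a \<noteq> b \<Longrightarrow> norm ((1/2) *\<^sub>R (a + b)) powr p < (norm a powr p + norm b powr p) / 2"
proof -
  let ?c = "(1/2) *\<^sub>R (a + b)"
  have z: "p * (flux p ?c \<bullet> (a - ?c)) + p * (flux p ?c \<bullet> (b - ?c)) = 0"
    by (simp add: inner_diff_right inner_add_right algebra_simps)
  have avg: "C + x \<le> A \<Longrightarrow> C + y \<le> B \<Longrightarrow> x + y = 0 \<Longrightarrow> C \<le> (A + B) / 2"
    "C + x < A \<Longrightarrow> C + y \<le> B \<Longrightarrow> x + y = 0 \<Longrightarrow> C < (A + B) / 2" for A B C x y :: real
    by (simp_all add: field_simps)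
  show "norm ?c powr p \<le> (norm a powr p + norm b powr p) / 2"
    by (rule avg(1)[OF norm_powr_tangent[OF assms] norm_powr_tangent[OF assms] z])
  assume "a \<noteq> b"
  have "?c \<noteq> a"
  proof
    assume "?c = a"
    then have "2 *\<^sub>R ?c = 2 *\<^sub>R a" by simp
    then have "a + b = a + a" by (simp add: scaleR_2)
    then show False using \<open>a \<noteq> b\<close> by simp
  qed
  then show "norm ?c powr p < (norm a powr p + norm b powr p) / 2"
    by (rule avg(2)[OF norm_powr_tangent_strict[OF assms] norm_powr_tangent[OF assms] z])
qed

text \<open>
A form of uniform convexity that is the same for all exponents above \<open>1\<close>. By homogeneity it is
enough to consider pairs on the unit sphere of the product space. There the inequality is trivial
unless \<open>|a - b|\<^sup>p\<close> is at least \<open>\<epsilon> (|a|\<^sup>p + |b|\<^sup>p)\<close>, and on the compact set where this holds the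
convexity gap is positive and hence bounded away from zero.
\<close>

lemma uniform_convexity_gap:
  fixes \<epsilon> p :: real
  assumes p: "p > 1" and "\<epsilon> > 0"
  obtains C where "C > 0" "\<And>a b :: 'b::euclidean_space. norm (a - b) powr p \<le> \<epsilon> * (norm a powr p + norm b powr p)
     + C * ((norm a powr p + norm b powr p) / 2 - norm ((1/2) *\<^sub>R (a + b)) powr p)"
proof -
  define S where "S = (\<lambda>z::'b \<times> 'b. norm (fst z) powr p + norm (snd z) powr p)"
  define h where "h = (\<lambda>z::'b \<times> 'b. S z / 2 - norm ((1/2) *\<^sub>R (fst z + snd z)) powr p)"
  define d where "d = (\<lambda>z::'b \<times> 'b. norm (fst z - snd z) powr p)"
  have cont: "continuous_on A S" "continuous_on A h" "continuous_on A d" for A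
    unfolding S_def h_def d_def using p by (auto intro!: continuous_intros continuous_on_powr')
  have h0: "h z \<ge> 0" for z using midpoint_gap(1)[OF p, of "fst z" "snd z"] by (simp add: h_def S_def)
  have Sz: "S z > 0" if "z \<noteq> 0" for z
  proof -
    have "fst z \<noteq> 0 \<or> snd z \<noteq> 0" using that by (metis fst_zero prod_eq_iff snd_zero)
    then show ?thesis by (auto simp: S_def intro: add_pos_nonneg add_nonneg_pos)
  qed
  define K where "K = sphere 0 1 \<inter> {z. \<epsilon> * S z \<le> d z}"
  have "closed {z. \<epsilon> * S z \<le> d z}"
    by (intro closed_Collect_le continuous_intros cont)
  then have K: "compact K" unfolding K_def by (intro compact_Int_closed) auto
  obtain m where m: "m > 0" "\<And>z. z \<in> K \<Longrightarrow> m \<le> h z"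
  proof (cases "K = {}")
    case False
    then obtain z0 where z0: "z0 \<in> K" "\<And>z. z \<in> K \<Longrightarrow> h z0 \<le> h z"
      using continuous_attains_inf[OF K False cont(2)] by blast
    have "z0 \<noteq> 0" using z0(1) by (auto simp: K_def)
    then have "d z0 > 0" using z0(1) Sz[of z0] assms(2) by (auto simp: K_def intro: less_le_trans[OF mult_pos_pos])
    then have "fst z0 \<noteq> snd z0" by (auto simp: d_def)
    then have "h z0 > 0" using midpoint_gap(2)[OF p, of "fst z0" "snd z0"] by (simp add: h_def S_def)
    then show ?thesis using that z0(2) by blast
  qed (use that[of 1] in auto)
  define C where "C = 2 powr p / m"
  have C: "C > 0" using m by (simp add: C_def)
  have sph: "d z \<le> \<epsilon> * S z + C * h z" if "norm z = 1" for z
  proof (cases "z \<in> K")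
    case True
    have "norm (fst z - snd z) \<le> norm (fst z) + norm (snd z)" by (rule norm_triangle_ineq4)
    also have "\<dots> \<le> 2" using norm_fst_le[of "fst z" "snd z"] norm_snd_le[of "snd z" "fst z"] that by simp
    finally have "d z \<le> 2 powr p" unfolding d_def using p by (intro powr_mono2) auto
    also have "\<dots> = C * m" using m by (simp add: C_def)
    also have "\<dots> \<le> C * h z" using m(2)[OF True] C by (intro mult_left_mono) auto
    also have "\<dots> \<le> \<epsilon> * S z + C * h z"
      using assms(2) by (simp add: S_def)
    finally show ?thesis .
  next
    case False
    then have "d z \<le> \<epsilon> * S z" using that by (auto simp: K_def)
    moreover have "0 \<le> C * h z" using C h0[of z] by (intro mult_nonneg_nonneg) auto
    ultimately show ?thesis by linarith
  qed
  have "norm (a - b) powr p \<le> \<epsilon> * (norm a powr p + norm b powr p)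
     + C * ((norm a powr p + norm b powr p) / 2 - norm ((1/2) *\<^sub>R (a + b)) powr p)" for a b :: 'b
  proof (cases "(a, b) = 0")
    case True
    then show ?thesis using p by (auto simp: zero_prod_def)
  next
    case False
    define r where "r = norm (a, b)"
    have r: "r > 0" using False by (simp only: r_def zero_less_norm_iff) simp
    define z where "z = (1 / r) *\<^sub>R (a, b)"
    have nz: "norm z = 1" using r by (simp only: z_def norm_scaleR r_def[symmetric]) simp
    have fs: "fst z = (1 / r) *\<^sub>R a" "snd z = (1 / r) *\<^sub>R b" by (simp_all add: z_def)
    have s: "norm ((1 / r) *\<^sub>R c) powr p = (1 / r) powr p * norm c powr p" for c :: 'b
      using r powr_mult[of "1 / r" "norm c" p] by simp
    have dz: "d z = (1 / r) powr p * norm (a - b) powr p"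
      unfolding d_def fs s[symmetric] by (simp add: scaleR_diff_right)
    have Sz: "S z = (1 / r) powr p * (norm a powr p + norm b powr p)"
      unfolding S_def fs s by (simp add: distrib_left)
    have hz: "h z = (1 / r) powr p * ((norm a powr p + norm b powr p) / 2 - norm ((1/2) *\<^sub>R (a + b)) powr p)"
    proof -
      have "(1/2) *\<^sub>R (fst z + snd z) = (1 / r) *\<^sub>R ((1/2) *\<^sub>R (a + b))"
        unfolding fs by (simp add: scaleR_add_right mult.commute)
      then show ?thesis unfolding h_def Sz by (simp only: s) (simp add: right_diff_distrib)
    qed
    have "(1 / r) powr p * norm (a - b) powr p \<le> (1 / r) powr p * (\<epsilon> * (norm a powr p + norm b powr p)
     + C * ((norm a powr p + norm b powr p) / 2 - norm ((1/2) *\<^sub>R (a + b)) powr p))"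
      using sph[OF nz] unfolding dz Sz hz by (simp add: algebra_simps)
    moreover have "0 < (1 / r) powr p" using r by simp
    ultimately show ?thesis by (simp only: mult_le_cancel_left_pos)
  qed
  then show ?thesis using that C by blast
qed

section \<open>Poincare's inequality\<close>

text \<open>
The tangent inequalities at \<open>t\<close> and at \<open>t + h\<close> enclose the difference quotient between
\<open>p * flux p t\<close> and \<open>p * flux p (t + h)\<close>, and \<open>flux p\<close> is continuous, also at \<open>0\<close>.
\<close>

lemma abs_powr_has_real_derivative:
  assumes "p > 1"
  shows "((\<lambda>t. \<bar>t\<bar> powr p) has_real_derivative p * flux p t) (at t)"
proof -
  have le: "\<bar>(\<bar>t + h\<bar> powr p - \<bar>t\<bar> powr p) / h - p * flux p t\<bar> \<le> p * \<bar>flux p (t + h) - flux p t\<bar>" if "h \<noteq> 0" for h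
  proof -
    define X where "X = \<bar>t + h\<bar> powr p - \<bar>t\<bar> powr p"
    define a b where "a = p * flux p t" "b = p * flux p (t + h)"
    have "a * h \<le> X" "X \<le> b * h"
      using norm_powr_tangent[OF assms, of t "t + h"] norm_powr_tangent[OF assms, of "t + h" t]
      by (simp_all add: X_def a_b_def algebra_simps)
    then have "\<bar>X - a * h\<bar> \<le> \<bar>b * h - a * h\<bar>" by linarith
    also have "\<dots> = \<bar>b - a\<bar> * \<bar>h\<bar>" by (simp add: abs_mult flip: left_diff_distrib)
    finally have "\<bar>X - a * h\<bar> / \<bar>h\<bar> \<le> \<bar>b - a\<bar>" using that by (simp add: pos_divide_le_eq)
    moreover have "\<bar>X / h - a\<bar> = \<bar>X - a * h\<bar> / \<bar>h\<bar>"
      using that by (simp add: abs_divide[symmetric] diff_divide_distrib)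
    moreover have "\<bar>b - a\<bar> = p * \<bar>flux p (t + h) - flux p t\<bar>"
      using assms by (simp add: a_b_def abs_mult flip: right_diff_distrib)
    ultimately show ?thesis by (simp add: X_def a_b_def)
  qed
  have "((\<lambda>h. (\<bar>t + h\<bar> powr p - \<bar>t\<bar> powr p) / h - p * flux p t) \<longlongrightarrow> 0) (at 0)"
  proof (rule Lim_null_comparison)
    show "\<forall>\<^sub>F h in at 0. norm ((\<bar>t + h\<bar> powr p - \<bar>t\<bar> powr p) / h - p * flux p t)
        \<le> p * \<bar>flux p (t + h) - flux p t\<bar>"
      using le by (auto simp: eventually_at_filter real_norm_def)
    have "((\<lambda>h. flux p (t + h)) \<longlongrightarrow> flux p t) (at 0)"
      using isCont_flux[OF assms, of t] unfolding isCont_iff .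
    then have "((\<lambda>h. p * \<bar>flux p (t + h) - flux p t\<bar>) \<longlongrightarrow> p * \<bar>flux p t - flux p t\<bar>) (at 0)"
      by (intro tendsto_intros)
    then show "((\<lambda>h. p * \<bar>flux p (t + h) - flux p t\<bar>) \<longlongrightarrow> 0) (at 0)" by simp
  qed
  then show ?thesis unfolding DERIV_def by (simp only: Lim_null[symmetric])
qed

lemma young_powr_eps:
  fixes p \<epsilon> s t :: real
  assumes "p > 1" "\<epsilon> > 0" "s \<ge> 0" "t \<ge> 0"
  shows "t powr (p - 1) * s \<le> \<epsilon> * t powr p + \<epsilon> powr (1 - p) * s powr p"
proof (cases "s \<le> \<epsilon> * t")
  case True
  have "t powr (p - 1) * s \<le> t powr (p - 1) * (\<epsilon> * t)"
    using True by (intro mult_left_mono) auto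
  also have "\<dots> = \<epsilon> * t powr p"
    using powr_mult_base[OF assms(4), of "p - 1"] by (simp add: mult.commute mult.left_commute)
  also have "\<dots> \<le> \<epsilon> * t powr p + \<epsilon> powr (1 - p) * s powr p" by simp
  finally show ?thesis .
next
  case False
  then have t: "t \<le> s / \<epsilon>" using assms by (simp add: field_simps)
  have "t powr (p - 1) * s \<le> (s / \<epsilon>) powr (p - 1) * s"
    using assms t by (intro mult_right_mono powr_mono2) auto
  also have "\<dots> = \<epsilon> powr (1 - p) * s powr p"
  proof -
    have "(s / \<epsilon>) powr (p - 1) = s powr (p - 1) * \<epsilon> powr (1 - p)"
      using assms powr_minus_divide[of \<epsilon> "p - 1"] by (simp add: powr_divide)
    then show ?thesis using powr_mult_base[OF assms(3), of "p - 1"] by (simp add: mult.commute mult.left_commute)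
  qed
  also have "\<dots> \<le> \<epsilon> * t powr p + \<epsilon> powr (1 - p) * s powr p" using assms by simp
  finally show ?thesis .
qed

context bounded_domain
begin

text \<open>
The divergence theorem for \<open>(x \<bullet> d) |\<phi>|\<^sup>p\<close> with a unit vector \<open>d\<close> bounds \<open>\<integral> |\<phi>|\<^sup>p\<close> by
\<open>R p \<integral> |\<phi>|\<^sup>p\<^sup>-\<^sup>1 |grad \<phi>|\<close>, where \<open>R\<close> bounds the domain. Young's inequality splits the integrand
into a multiple of \<open>|grad \<phi>|\<^sup>p\<close> and \<open>|\<phi>|\<^sup>p / 2\<close>, which the left side absorbs.
\<close>

lemma poincare_test_functions:
  obtains C where "C \<ge> 0" "\<And>\<phi>. \<phi> \<in> test_functions \<Omega> \<Longrightarrow> pint M p \<phi> \<le> C * pint M p (grad \<phi>)"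
proof -
  obtain R where R: "R > 0" "\<And>x. x \<in> \<Omega> \<Longrightarrow> norm x \<le> R" using bounded_\<Omega> bounded_pos by blast
  define d :: "real^'n" where "d = axis undefined 1"
  have nd: "norm d = 1" by (simp add: d_def)
  \<comment> \<open>Chosen so that Young's inequality returns exactly half of \<open>|\<phi>|\<^sup>p\<close>.\<close>
  define \<epsilon> where "\<epsilon> = 1 / (2 * (R * p))"
  define K where "K = R * p * \<epsilon> powr (1 - p)"
  have Rp: "R * p > 0" using R p by simp
  have K: "K \<ge> 0" using Rp by (simp add: K_def)
  have \<epsilon>: "\<epsilon> > 0" "R * p * \<epsilon> = 1 / 2" using R p by (auto simp: \<epsilon>_def)
  have "pint M p \<phi> \<le> (2 * K) * pint M p (grad \<phi>)" if \<phi>: "\<phi> \<in> test_functions \<Omega>" for \<phi>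
  proof -
    let ?g = "\<lambda>x. \<bar>\<phi> x\<bar> powr p + (x \<bullet> d) * (p * flux p (\<phi> x) * (grad \<phi> x \<bullet> d))"
    have out: "x \<notin> \<Omega>" if "R < norm x" for x using R(2)[of x] that by auto
    have cf: "continuous_on S (\<lambda>x. flux p (\<phi> x))" for S
    proof (rule continuous_on_compose2[OF _ test_continuous(1)[OF \<phi>]])
      show "continuous_on UNIV (flux p :: real \<Rightarrow> real)"
        by (intro continuous_at_imp_continuous_on ballI isCont_flux p)
    qed auto
    have cp: "continuous_on S (\<lambda>x. \<bar>\<phi> x\<bar> powr p)" for S
      using test_continuous[OF \<phi>] p by (intro continuous_on_powr' continuous_intros) auto
    have cg: "continuous_on S ?g" for S
      using test_continuous[OF \<phi>] by (intro continuous_intros cf cp) auto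
    have "(\<integral>x. ?g x \<partial>lborel) = 0"
    proof (rule integral_directional_derivative_eq_0[where r=R and d=d])
      show "((\<lambda>t. ((x + t *\<^sub>R d) \<bullet> d) * \<bar>\<phi> (x + t *\<^sub>R d)\<bar> powr p) has_real_derivative ?g x) (at 0)" for x
      proof -
        have 1: "((\<lambda>t. (x + t *\<^sub>R d) \<bullet> d) has_real_derivative 1) (at 0)"
          using nd by (auto intro!: derivative_eq_intros simp: inner_add_left dot_square_norm)
        have 2: "((\<lambda>t. \<phi> (x + t *\<^sub>R d)) has_real_derivative (grad \<phi> x \<bullet> d)) (at 0)"
          by (rule directional_derivative[OF test_functions_grad(1)[OF \<phi>]])
        have 3: "((\<lambda>t. \<bar>\<phi> (x + t *\<^sub>R d)\<bar> powr p) has_real_derivative (p * flux p (\<phi> x) * (grad \<phi> x \<bullet> d))) (at 0)"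
          using DERIV_chain2[OF _ 2, of "\<lambda>t. \<bar>t\<bar> powr p"] abs_powr_has_real_derivative[OF p, of "\<phi> x"] by simp
        show ?thesis using DERIV_mult[OF 1 3] by (simp add: algebra_simps)
      qed
      show "continuous_on UNIV (\<lambda>x. (x \<bullet> d) * \<bar>\<phi> x\<bar> powr p)" by (intro continuous_intros cp)
      show "continuous_on UNIV ?g" by (rule cg)
      show "(x \<bullet> d) * \<bar>\<phi> x\<bar> powr p = 0" if "R < norm x" for x
        using test_functions_zero[OF \<phi> out[OF that]] by simp
      show "?g x = 0" if "R < norm x" for x
        using test_functions_zero[OF \<phi> out[OF that]] by simp
    qed
    moreover have "(\<integral>x. ?g x \<partial>M) = (\<integral>x. ?g x \<partial>lborel)"
      using test_functions_zero[OF \<phi>]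
      by (intro integral_lebesgue_on_eq_lborel open_\<Omega> borel_measurable_continuous_onI cg) auto
    ultimately have 0: "(\<integral>x. ?g x \<partial>M) = 0" by simp
    have lp: "lp M p \<phi>" "lp M p (grad \<phi>)" using wgradD[OF wgrad_test[OF \<phi>]] by auto
    have "(\<integral>x. (1/2) * norm (\<phi> x) powr p - K * norm (grad \<phi> x) powr p \<partial>M) \<le> (\<integral>x. ?g x \<partial>M)"
    proof (rule integral_mono)
      show "integrable M (\<lambda>x. (1/2) * norm (\<phi> x) powr p - K * norm (grad \<phi> x) powr p)"
        using lp by (simp add: lp_def)
      show "integrable M ?g" by (intro integrable_continuous_M cg)
      fix x assume "x \<in> space M"
      then have x: "norm x \<le> R" using R(2) by simp
      have "\<bar>x \<bullet> d\<bar> \<le> R" using Cauchy_Schwarz_ineq2[of x d] nd x by simp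
      moreover have "\<bar>grad \<phi> x \<bullet> d\<bar> \<le> norm (grad \<phi> x)" using Cauchy_Schwarz_ineq2[of "grad \<phi> x" d] nd by simp
      moreover have "\<bar>flux p (\<phi> x)\<bar> = norm (\<phi> x) powr (p - 1)" using norm_flux[of p "\<phi> x"] by simp
      ultimately have "\<bar>x \<bullet> d\<bar> * (p * \<bar>flux p (\<phi> x)\<bar> * \<bar>grad \<phi> x \<bullet> d\<bar>) \<le> R * (p * norm (\<phi> x) powr (p - 1) * norm (grad \<phi> x))"
        using p R by (intro mult_mono mult_left_mono) auto
      moreover have "\<bar>(x \<bullet> d) * (p * flux p (\<phi> x) * (grad \<phi> x \<bullet> d))\<bar> = \<bar>x \<bullet> d\<bar> * (p * \<bar>flux p (\<phi> x)\<bar> * \<bar>grad \<phi> x \<bullet> d\<bar>)"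
        using p by (simp add: abs_mult)
      moreover have "R * (p * norm (\<phi> x) powr (p - 1) * norm (grad \<phi> x)) = R * p * (norm (\<phi> x) powr (p - 1) * norm (grad \<phi> x))"
        by (simp only: mult.assoc)
      moreover have "\<dots> \<le> R * p * (\<epsilon> * norm (\<phi> x) powr p + \<epsilon> powr (1 - p) * norm (grad \<phi> x) powr p)"
        using Rp by (intro mult_left_mono young_powr_eps p \<epsilon>) auto
      moreover have "\<dots> = (R * p * \<epsilon>) * norm (\<phi> x) powr p + K * norm (grad \<phi> x) powr p"
        by (simp add: K_def distrib_left mult.assoc)
      ultimately have "\<bar>(x \<bullet> d) * (p * flux p (\<phi> x) * (grad \<phi> x \<bullet> d))\<bar> \<le> (1/2) * norm (\<phi> x) powr p + K * norm (grad \<phi> x) powr p"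
        unfolding \<epsilon>(2) by (simp only:) 
      moreover have "a - b \<le> c + y" if "\<bar>y\<bar> \<le> a + b" "c = 2 * a" for a b c y :: real using that by linarith
      ultimately show "(1/2) * norm (\<phi> x) powr p - K * norm (grad \<phi> x) powr p \<le> ?g x" by simp
    qed
    also have "(\<integral>x. (1/2) * norm (\<phi> x) powr p - K * norm (grad \<phi> x) powr p \<partial>M) = (1/2) * pint M p \<phi> - K * pint M p (grad \<phi>)"
      using lp by (simp add: lp_def pint_def)
    finally show ?thesis using 0 by simp
  qed
  then show ?thesis using that[of "2 * K"] K by simp
qed

lemma poincare:
  obtains C where "C \<ge> 0" "\<And>u G. wgrad u G \<Longrightarrow> u \<in> W1p0 \<Omega> p \<Longrightarrow> pint M p u \<le> C * pint M p G"
proof -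
  obtain C where C: "C \<ge> 0" "\<And>\<phi>. \<phi> \<in> test_functions \<Omega> \<Longrightarrow> pint M p \<phi> \<le> C * pint M p (grad \<phi>)"
    using poincare_test_functions by blast
  have "pint M p u \<le> (2 powr p * (C * 2 powr p)) * pint M p G" if u: "wgrad u G" "u \<in> W1p0 \<Omega> p" for u G
  proof -
    obtain \<phi> where \<phi>: "\<And>k. \<phi> k \<in> test_functions \<Omega>"
      "(\<lambda>k. pint M p (\<lambda>x. \<phi> k x - u x)) \<longlonglongrightarrow> 0" "(\<lambda>k. pint M p (\<lambda>x. grad (\<phi> k) x - G x)) \<longlonglongrightarrow> 0"
      using W1p0_sequence[OF u] by blast
    have le: "pint M p u \<le> 2 powr p * (pint M p (\<lambda>x. \<phi> k x - u x) + C * (2 powr p * (pint M p (\<lambda>x. grad (\<phi> k) x - G x) + pint M p G)))" for k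
    proof -
      have lp: "lp M p u" "lp M p G" "lp M p (\<phi> k)" "lp M p (grad (\<phi> k))"
        using wgradD[OF u(1)] wgradD[OF wgrad_test[OF \<phi>(1)]] by auto
      have "pint M p u \<le> 2 powr p * (pint M p (\<lambda>x. u x - \<phi> k x) + pint M p (\<phi> k))"
        using lp_add(2)[OF p lp_diff(1)[OF p lp(1,3)] lp(3)] by simp
      also have "pint M p (\<lambda>x. u x - \<phi> k x) = pint M p (\<lambda>x. \<phi> k x - u x)" by (rule pint_minus_commute)
      finally have 1: "pint M p u \<le> 2 powr p * (pint M p (\<lambda>x. \<phi> k x - u x) + pint M p (\<phi> k))" .
      have "pint M p (grad (\<phi> k)) \<le> 2 powr p * (pint M p (\<lambda>x. grad (\<phi> k) x - G x) + pint M p G)"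
        using lp_add(2)[OF p lp_diff(1)[OF p lp(4,2)] lp(2)] by simp
      then have "pint M p (\<phi> k) \<le> C * (2 powr p * (pint M p (\<lambda>x. grad (\<phi> k) x - G x) + pint M p G))"
        using C(2)[OF \<phi>(1)[of k]] C(1) by (meson mult_left_mono order_trans)
      then show ?thesis by (intro order_trans[OF 1] mult_left_mono add_left_mono) auto
    qed
    have "(\<lambda>k. 2 powr p * (pint M p (\<lambda>x. \<phi> k x - u x) + C * (2 powr p * (pint M p (\<lambda>x. grad (\<phi> k) x - G x) + pint M p G))))
        \<longlonglongrightarrow> 2 powr p * (0 + C * (2 powr p * (0 + pint M p G)))"
      by (intro tendsto_intros \<phi>)
    then have "pint M p u \<le> 2 powr p * (0 + C * (2 powr p * (0 + pint M p G)))"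
      by (rule LIMSEQ_le_const) (use le in blast)
    then show ?thesis by (simp add: mult.assoc)
  qed
  then show ?thesis using that[of "2 powr p * (C * 2 powr p)"] C(1) by simp
qed

end

section \<open>Energy minimizers and the diagonal of the Dirichlet-Neumann map\<close>

context bounded_domain
begin

text \<open>
The class of \<open>v\<close> modulo functions that vanish on the boundary, written without the quotient.
\<close>

definition boundary_class :: "(real^'n \<Rightarrow> real) \<Rightarrow> (real^'n \<Rightarrow> real) set" where
  "boundary_class v = {w \<in> W1p \<Omega> p. (\<lambda>x. v x - w x) \<in> W1p0 \<Omega> p}"

lemma boundary_classD: 
  assumes "w \<in> boundary_class v"
  shows "w \<in> W1p \<Omega> p" "(\<lambda>x. v x - w x) \<in> W1p0 \<Omega> p"
  using assms by (auto simp: boundary_class_def)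

lemma boundary_class_diff:
  assumes "w \<in> boundary_class v" "w' \<in> boundary_class v"
  shows "(\<lambda>x. w x - w' x) \<in> W1p0 \<Omega> p"
  using W1p0_diff[OF boundary_classD(2)[OF assms(2)] boundary_classD(2)[OF assms(1)]] by simp

lemma boundary_class_self: "v \<in> W1p \<Omega> p \<Longrightarrow> v \<in> boundary_class v"
  using W1p0_zero by (simp add: boundary_class_def)

lemma boundary_class_add:
  assumes "w \<in> boundary_class v" "z \<in> W1p0 \<Omega> p"
  shows "(\<lambda>x. w x + t * z x) \<in> boundary_class v"
proof -
  obtain G Z where "wgrad w G" "wgrad z Z" using boundary_classD(1)[OF assms(1)] W1p0_W1p[OF assms(2)] unfolding W1p_iff by blast
  then have "wgrad (\<lambda>x. w x + t * z x) (\<lambda>x. G x + t *\<^sub>R Z x)" by (intro wgrad_add wgrad_scale)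
  moreover have "(\<lambda>x. v x - (w x + t * z x)) \<in> W1p0 \<Omega> p"
    using W1p0_add_scale[OF boundary_classD(2)[OF assms(1)] assms(2), of "- t"] by (simp add: algebra_simps)
  ultimately show ?thesis unfolding boundary_class_def W1p_iff by blast
qed

lemma boundary_class_in_boundary_space:
  assumes "v \<in> W1p \<Omega> p"
  shows "boundary_class v \<in> boundary_space \<Omega> p"
proof -
  have "boundary_class v = {(u, v). u \<in> W1p \<Omega> p \<and> v \<in> W1p \<Omega> p \<and> (\<lambda>x. u x - v x) \<in> W1p0 \<Omega> p} `` {v}"
    using assms by (auto simp: boundary_class_def)
  then show ?thesis unfolding boundary_space_def using assms by (simp only: quotientI)
qed

end

locale conductivity = bounded_domain \<Omega> p
  for \<Omega> :: "(real^'n) set" and p :: real +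
  fixes \<sigma> :: "real^'n \<Rightarrow> real"
  assumes cont_\<sigma>: "continuous_on (closure \<Omega>) \<sigma>" and pos_\<sigma>: "\<forall>x\<in>closure \<Omega>. 0 < \<sigma> x"
begin

text \<open>
The energy as a function of the gradient, which frees it from the choice of a weak gradient.
\<close>

definition grad_energy :: "(real^'n \<Rightarrow> real^'n) \<Rightarrow> real" where
  "grad_energy G = (\<integral>x. \<sigma> x * norm (G x) powr p \<partial>M)"

lemma \<sigma>_bounds:
  obtains s S where "0 < s" "\<And>x. x \<in> \<Omega> \<Longrightarrow> s \<le> \<sigma> x" "\<And>x. x \<in> \<Omega> \<Longrightarrow> \<sigma> x \<le> S" "0 < S"
proof (cases "\<Omega> = {}")
  case False
  then have ne: "closure \<Omega> \<noteq> {}" by simp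
  have "compact (closure \<Omega>)" using bounded_\<Omega> by (simp add: compact_closure)
  then obtain y where y: "y \<in> closure \<Omega>" "\<forall>x\<in>closure \<Omega>. \<sigma> y \<le> \<sigma> x"
    using continuous_attains_inf[OF _ ne cont_\<sigma>] by blast
  obtain S where S: "S > 0" "\<And>x. x \<in> closure \<Omega> \<Longrightarrow> norm (\<sigma> x) \<le> S"
    using continuous_bounded_on_\<Omega>[OF cont_\<sigma>] by blast
  show ?thesis
  proof (rule that)
    show "0 < \<sigma> y" using pos_\<sigma> y(1) by blast
    show "0 < S" by fact
    fix x assume "x \<in> \<Omega>"
    then have x: "x \<in> closure \<Omega>" using closure_subset[of \<Omega>] by auto
    show "\<sigma> y \<le> \<sigma> x" using y x by blast
    show "\<sigma> x \<le> S" using S(2)[OF x] by simp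
  qed
qed (use that[of 1 1] in auto)

lemma \<sigma>_measurable [measurable]: "\<sigma> \<in> borel_measurable M"
  by (intro continuous_measurable_M continuous_on_subset[OF cont_\<sigma> closure_subset])

lemma \<sigma>_pos: "x \<in> \<Omega> \<Longrightarrow> 0 < \<sigma> x"
  using pos_\<sigma> closure_subset[of \<Omega>] by auto

lemma \<sigma>_integrable:
  assumes "integrable M (h :: real^'n \<Rightarrow> real)"
  shows "integrable M (\<lambda>x. \<sigma> x * h x)"
proof -
  obtain s S where S: "0 < s" "\<And>x. x \<in> \<Omega> \<Longrightarrow> s \<le> \<sigma> x" "\<And>x. x \<in> \<Omega> \<Longrightarrow> \<sigma> x \<le> S" "0 < S"
    using \<sigma>_bounds by blast
  show ?thesis
  proof (rule Bochner_Integration.integrable_bound)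
    show "integrable M (\<lambda>x. S * h x)" using assms by simp
    show "(\<lambda>x. \<sigma> x * h x) \<in> borel_measurable M" using assms by simp
    show "AE x in M. norm (\<sigma> x * h x) \<le> norm (S * h x)"
    proof (rule AE_I2)
      fix x assume "x \<in> space M"
      then have "x \<in> \<Omega>" by simp
      then show "norm (\<sigma> x * h x) \<le> norm (S * h x)"
        using S(3)[of x] \<sigma>_pos[of x] S(4) by (auto simp: abs_mult intro!: mult_right_mono)
    qed
  qed
qed

lemma grad_energy_integrable: "lp M p G \<Longrightarrow> integrable M (\<lambda>x. \<sigma> x * norm (G x) powr p)"
  by (intro \<sigma>_integrable) (simp add: lp_def)

lemma grad_energy_nonneg: "0 \<le> grad_energy G"
  unfolding grad_energy_def by (intro integral_nonneg_AE AE_I2) (auto simp: \<sigma>_pos less_imp_le)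

lemma grad_energy_lower:
  obtains s where "s > 0" "\<And>G. lp M p G \<Longrightarrow> s * pint M p G \<le> grad_energy G"
proof -
  obtain s S where S: "0 < s" "\<And>x. x \<in> \<Omega> \<Longrightarrow> s \<le> \<sigma> x" "\<And>x. x \<in> \<Omega> \<Longrightarrow> \<sigma> x \<le> S" "0 < S"
    using \<sigma>_bounds by blast
  have "s * pint M p G \<le> grad_energy G" if "lp M p G" for G :: "real^'n \<Rightarrow> real^'n"
  proof -
    have "(\<integral>x. s * norm (G x) powr p \<partial>M) \<le> grad_energy G"
      unfolding grad_energy_def using that grad_energy_integrable[OF that] S(2)
      by (intro integral_mono) (auto simp: lp_def intro!: mult_right_mono)
    then show ?thesis by (simp add: pint_def)
  qed
  then show ?thesis using that S(1) by blast
qed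

lemma grad_energy_cong:
  assumes "AE x in M. G x = H x" "lp M p G" "lp M p H"
  shows "grad_energy G = grad_energy H"
  unfolding grad_energy_def
proof (rule integral_cong_AE)
  have [measurable]: "G \<in> borel_measurable M" "H \<in> borel_measurable M" using assms by (auto simp: lp_def)
  show "(\<lambda>x. \<sigma> x * norm (G x) powr p) \<in> borel_measurable M" "(\<lambda>x. \<sigma> x * norm (H x) powr p) \<in> borel_measurable M"
    by measurable
  show "AE x in M. \<sigma> x * norm (G x) powr p = \<sigma> x * norm (H x) powr p"
    using assms(1) by eventually_elim simp
qed

lemma energy_eq_grad_energy:
  assumes "wgrad u G"
  shows "energy \<Omega> p \<sigma> u = grad_energy G"
proof -
  have "wgrad u (weak_gradient \<Omega> p u)" using assms by (intro wgrad_weak_gradient) (auto simp: W1p_iff)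
  then have "grad_energy (weak_gradient \<Omega> p u) = grad_energy G"
    using assms by (intro grad_energy_cong AE_weak_gradient wgradD)
  then show ?thesis by (simp add: energy_def grad_energy_def)
qed

text \<open>
Multiplying the gradients by \<open>\<sigma>\<^sup>1\<^sup>/\<^sup>p\<close> turns the energy into a \<open>p\<close>-th power integral.
\<close>

lemma grad_energy_fatou:
  assumes f: "\<And>k. lp M p (G k)" and H: "lp M p H"
    and lim: "AE x in M. (\<lambda>k. G k x) \<longlonglongrightarrow> H x"
    and b: "\<forall>\<^sub>F k in sequentially. grad_energy (G k) \<le> e"
  shows "grad_energy H \<le> e"
proof -
  let ?w = "\<lambda>x. \<sigma> x powr (1 / p)"
  have n: "norm (?w x *\<^sub>R c) powr p = \<sigma> x * norm c powr p" if "x \<in> \<Omega>" for x and c :: "real^'n"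
    using p \<sigma>_pos[OF that] by (simp add: powr_mult powr_powr)
  have lpw: "lp M p (\<lambda>x. ?w x *\<^sub>R F x)" "pint M p (\<lambda>x. ?w x *\<^sub>R F x) = grad_energy F"
    if "lp M p F" for F :: "real^'n \<Rightarrow> real^'n"
  proof -
    have m: "(\<lambda>x. ?w x *\<^sub>R F x) \<in> borel_measurable M" using that by (auto simp: lp_def)
    have "integrable M (\<lambda>x. norm (?w x *\<^sub>R F x) powr p) \<longleftrightarrow> integrable M (\<lambda>x. \<sigma> x * norm (F x) powr p)"
      by (intro Bochner_Integration.integrable_cong refl n) simp
    then show "lp M p (\<lambda>x. ?w x *\<^sub>R F x)" using m grad_energy_integrable[OF that] by (simp add: lp_def)
    show "pint M p (\<lambda>x. ?w x *\<^sub>R F x) = grad_energy F"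
      unfolding pint_def grad_energy_def by (intro Bochner_Integration.integral_cong refl n) simp
  qed
  have "AE x in M. (\<lambda>k. ?w x *\<^sub>R G k x) \<longlonglongrightarrow> ?w x *\<^sub>R H x"
    using lim by eventually_elim (intro tendsto_intros)
  moreover have "\<forall>\<^sub>F k in sequentially. pint M p (\<lambda>x. ?w x *\<^sub>R G k x) \<le> e"
    using b by (simp only: lpw(2)[OF f])
  moreover have "(\<lambda>x. ?w x *\<^sub>R H x) \<in> borel_measurable M" using lpw(1)[OF H] by (simp add: lp_def)
  ultimately have "pint M p (\<lambda>x. ?w x *\<^sub>R H x) \<le> e"
    by (intro pint_fatou(2)[OF p lpw(1)[OF f]])
  then show ?thesis by (simp only: lpw(2)[OF H])
qed

lemma grad_energy_gap:
  assumes "\<epsilon> > 0"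
  obtains C where "C > 0" "\<And>G H. lp M p G \<Longrightarrow> lp M p H \<Longrightarrow>
    grad_energy (\<lambda>x. G x - H x) \<le> \<epsilon> * (grad_energy G + grad_energy H) + C * ((grad_energy G + grad_energy H) / 2 - grad_energy (\<lambda>x. (1/2) *\<^sub>R (G x + H x)))"
proof -
  obtain C where C: "C > 0" "\<And>a b :: real^'n. norm (a - b) powr p \<le> \<epsilon> * (norm a powr p + norm b powr p)
     + C * ((norm a powr p + norm b powr p) / 2 - norm ((1/2) *\<^sub>R (a + b)) powr p)"
    using uniform_convexity_gap[OF p assms] by metis
  have "grad_energy (\<lambda>x. G x - H x) \<le> \<epsilon> * (grad_energy G + grad_energy H) + C * ((grad_energy G + grad_energy H) / 2 - grad_energy (\<lambda>x. (1/2) *\<^sub>R (G x + H x)))"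
    if lp: "lp M p G" "lp M p H" for G H :: "real^'n \<Rightarrow> real^'n"
  proof -
    let ?m = "\<lambda>x. (1/2) *\<^sub>R (G x + H x)"
    have lpm: "lp M p ?m" by (intro lp_scaleR lp_add(1)[OF p] lp)
    note int = grad_energy_integrable[OF lp(1)] grad_energy_integrable[OF lp(2)] grad_energy_integrable[OF lpm]
    let ?a = "\<lambda>x. \<sigma> x * norm (G x) powr p" and ?b = "\<lambda>x. \<sigma> x * norm (H x) powr p" and ?c = "\<lambda>x. \<sigma> x * norm (?m x) powr p"
    have "grad_energy (\<lambda>x. G x - H x) \<le> (\<integral>x. \<epsilon> * (?a x + ?b x) + C * ((?a x + ?b x) / 2 - ?c x) \<partial>M)"
      unfolding grad_energy_def
    proof (rule integral_mono)
      show "integrable M (\<lambda>x. \<sigma> x * norm (G x - H x) powr p)" by (intro grad_energy_integrable lp_diff(1)[OF p] lp)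
      show "integrable M (\<lambda>x. \<epsilon> * (?a x + ?b x) + C * ((?a x + ?b x) / 2 - ?c x))"
        using int by (intro Bochner_Integration.integrable_add Bochner_Integration.integrable_diff
          Bochner_Integration.integrable_mult_right Bochner_Integration.integrable_divide)
      fix x assume "x \<in> space M"
      then have s: "\<sigma> x > 0" by (simp add: \<sigma>_pos)
      have "\<sigma> x * norm (G x - H x) powr p \<le> \<sigma> x * (\<epsilon> * (norm (G x) powr p + norm (H x) powr p)
         + C * ((norm (G x) powr p + norm (H x) powr p) / 2 - norm (?m x) powr p))"
        using C(2)[of "G x" "H x"] s by (intro mult_left_mono) auto
      also have "\<dots> = \<epsilon> * (?a x + ?b x) + C * ((?a x + ?b x) / 2 - ?c x)"
        by (simp only: algebra_simps add_divide_distrib)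
      finally show "\<sigma> x * norm (G x - H x) powr p \<le> \<epsilon> * (?a x + ?b x) + C * ((?a x + ?b x) / 2 - ?c x)" .
    qed
    also have "\<dots> = \<epsilon> * (grad_energy G + grad_energy H) + C * ((grad_energy G + grad_energy H) / 2 - grad_energy ?m)"
    proof -
      have "(\<integral>x. \<epsilon> * (?a x + ?b x) + C * ((?a x + ?b x) / 2 - ?c x) \<partial>M)
         = (\<integral>x. \<epsilon> * (?a x + ?b x) \<partial>M) + (\<integral>x. C * ((?a x + ?b x) / 2 - ?c x) \<partial>M)"
        using int by (intro Bochner_Integration.integral_add Bochner_Integration.integrable_add Bochner_Integration.integrable_diff
          Bochner_Integration.integrable_mult_right Bochner_Integration.integrable_divide)
      also have "(\<integral>x. C * ((?a x + ?b x) / 2 - ?c x) \<partial>M) = C * ((\<integral>x. (?a x + ?b x) / 2 \<partial>M) - (\<integral>x. ?c x \<partial>M))"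
        using int by (subst Bochner_Integration.integral_diff[symmetric])
          (auto intro!: Bochner_Integration.integrable_add Bochner_Integration.integrable_divide)
      also have "(\<integral>x. (?a x + ?b x) / 2 \<partial>M) = (\<integral>x. ?a x + ?b x \<partial>M) / 2" by simp
      also have "(\<integral>x. \<epsilon> * (?a x + ?b x) \<partial>M) = \<epsilon> * (\<integral>x. ?a x + ?b x \<partial>M)" by simp
      also have "(\<integral>x. ?a x + ?b x \<partial>M) = grad_energy G + grad_energy H"
        unfolding grad_energy_def using int by (intro Bochner_Integration.integral_add)
      finally show ?thesis by (simp only: grad_energy_def)
    qed
    finally show ?thesis .
  qed
  then show ?thesis using that C(1) by blast
qed

text \<open>
The midpoint of two members of the class again belongs to it and so has at least the infimal energy
\<open>I\<close>. For two members of almost minimal energy the convexity gap is therefore small, and the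
gradients of a minimizing sequence are Cauchy. Poincare's inequality, applied to differences, makes
the functions Cauchy too; the limit stays in the class, and its energy is at most \<open>I\<close> by lower
semicontinuity.
\<close>

lemma exists_minimizer:
  assumes v: "v \<in> W1p \<Omega> p"
  shows "\<exists>u\<in>boundary_class v. \<forall>w\<in>boundary_class v. energy \<Omega> p \<sigma> u \<le> energy \<Omega> p \<sigma> w"
proof -
  let ?D = "weak_gradient \<Omega> p"
  define I where "I = (INF w\<in>boundary_class v. energy \<Omega> p \<sigma> w)"
  have wg: "wgrad w (?D w)" if "w \<in> boundary_class v" for w by (rule wgrad_weak_gradient[OF boundary_classD(1)[OF that]])
  have lpD: "lp M p (?D w)" if "w \<in> boundary_class v" for w by (rule wgradD(2)[OF wg[OF that]])
  have E: "energy \<Omega> p \<sigma> w = grad_energy (?D w)" for w by (simp add: energy_def grad_energy_def)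
  have bdd: "bdd_below (energy \<Omega> p \<sigma> ` boundary_class v)"
    by (rule bdd_belowI[of _ 0]) (auto simp: E grad_energy_nonneg)
  have ne: "boundary_class v \<noteq> {}" using boundary_class_self[OF v] by blast
  have I_le: "I \<le> energy \<Omega> p \<sigma> w" if "w \<in> boundary_class v" for w
    unfolding I_def using bdd that by (rule cINF_lower)
  have I0: "I \<ge> 0" unfolding I_def by (rule cINF_greatest[OF ne]) (simp add: E grad_energy_nonneg)
  have "\<exists>w\<in>boundary_class v. energy \<Omega> p \<sigma> w < I + inverse (real (Suc k))" for k
  proof -
    have "I < I + inverse (real (Suc k))" by (simp del: of_nat_Suc)
    then show ?thesis unfolding I_def using cINF_less_iff[OF ne bdd] by blast
  qed
  then have "\<forall>k. \<exists>w. w \<in> boundary_class v \<and> energy \<Omega> p \<sigma> w < I + inverse (real (Suc k))" by blast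
  from choice[OF this] obtain w where w: "\<And>k. w k \<in> boundary_class v" "\<And>k. energy \<Omega> p \<sigma> (w k) < I + inverse (real (Suc k))"
    by auto
  define G where "G k = ?D (w k)" for k
  have G: "wgrad (w k) (G k)" "lp M p (G k)" for k unfolding G_def using wg[OF w(1)] lpD[OF w(1)] .
  have energy_w: "grad_energy (G k) < I + inverse (real (Suc k))" for k using w(2)[of k] by (simp only: E G_def)
  obtain s where s: "s > 0" "\<And>G. lp M p G \<Longrightarrow> s * pint M p G \<le> grad_energy G" using grad_energy_lower by blast
  have mid: "I \<le> grad_energy (\<lambda>x. (1/2) *\<^sub>R (G m x + G n x))" for m n
  proof -
    have "(\<lambda>x. w m x + (1/2) * (w n x - w m x)) \<in> boundary_class v" by (intro boundary_class_add boundary_class_diff[where v=v] w)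
    then have c: "(\<lambda>x. (1/2) * (w m x + w n x)) \<in> boundary_class v" by (simp add: algebra_simps)
    have "wgrad (\<lambda>x. (1/2) * (w m x + w n x)) (\<lambda>x. (1/2) *\<^sub>R (G m x + G n x))"
      by (intro wgrad_scale wgrad_add G)
    then show ?thesis using I_le[OF c] by (simp only: energy_eq_grad_energy)
  qed
  have CauG: "\<exists>N. \<forall>m\<ge>N. \<forall>n\<ge>N. pint M p (\<lambda>x. G m x - G n x) < e" if "e > 0" for e
  proof -
    \<comment> \<open>All energies in the sequence are at most \<open>I + 1\<close>, so this makes the first error term at most half of \<open>s * e\<close>.\<close>
    define \<epsilon> where "\<epsilon> = s * e / (4 * (I + 1))"
    have \<epsilon>: "\<epsilon> > 0" using s that I0 by (simp add: \<epsilon>_def)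
    obtain C where C: "C > 0" "\<And>G H. lp M p G \<Longrightarrow> lp M p H \<Longrightarrow>
      grad_energy (\<lambda>x. G x - H x) \<le> \<epsilon> * (grad_energy G + grad_energy H) + C * ((grad_energy G + grad_energy H) / 2 - grad_energy (\<lambda>x. (1/2) *\<^sub>R (G x + H x)))"
      using grad_energy_gap[OF \<epsilon>] by blast
    have "0 < s * e / (2 * C)" using s that C by simp
    then obtain N where N: "inverse (real (Suc N)) < s * e / (2 * C)" using reals_Archimedean by blast
    have inv: "inverse (real (Suc k)) \<le> inverse (real (Suc N))" if "k \<ge> N" for k using that by (simp add: le_imp_inverse_le)
    have "pint M p (\<lambda>x. G m x - G n x) < e" if mn: "m \<ge> N" "n \<ge> N" for m n
    proof -
      define A where "A = grad_energy (G m) + grad_energy (G n)"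
      have le1: "inverse (real (Suc k)) \<le> 1" for k by (simp add: inverse_eq_divide)
      have "A < 2 * I + 2" using energy_w[of m] energy_w[of n] le1[of m] le1[of n] unfolding A_def by linarith
      then have "A < 2 * (I + 1)" by simp
      then have "\<epsilon> * A < \<epsilon> * (2 * (I + 1))" using \<epsilon> by (intro mult_strict_left_mono)
      also have "\<dots> = s * e / 2" using I0 by (simp add: \<epsilon>_def field_simps)
      finally have 1: "\<epsilon> * A < s * e / 2" .
      have "A \<le> 2 * I + 2 * inverse (real (Suc N))"
        using energy_w[of m] energy_w[of n] inv[OF mn(1)] inv[OF mn(2)] unfolding A_def by linarith
      then have "A / 2 - grad_energy (\<lambda>x. (1/2) *\<^sub>R (G m x + G n x)) \<le> inverse (real (Suc N))"
        using mid[of m n] by linarith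
      then have "C * (A / 2 - grad_energy (\<lambda>x. (1/2) *\<^sub>R (G m x + G n x))) \<le> C * inverse (real (Suc N))"
        using C by (intro mult_left_mono) auto
      also have "\<dots> < C * (s * e / (2 * C))" using N C by (intro mult_strict_left_mono)
      also have "\<dots> = s * e / 2" using C by simp
      finally have 2: "C * (A / 2 - grad_energy (\<lambda>x. (1/2) *\<^sub>R (G m x + G n x))) < s * e / 2" .
      have "s * pint M p (\<lambda>x. G m x - G n x) \<le> grad_energy (\<lambda>x. G m x - G n x)"
        by (intro s lp_diff(1)[OF p] G)
      also have "\<dots> \<le> \<epsilon> * A + C * (A / 2 - grad_energy (\<lambda>x. (1/2) *\<^sub>R (G m x + G n x)))"
        using C(2)[OF G(2)[of m] G(2)[of n]] by (simp only: A_def)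
      also have "\<dots> < s * e" using 1 2 by simp
      finally show ?thesis using s by simp
    qed
    then show ?thesis by blast
  qed
  obtain CP where CP: "CP \<ge> 0" "\<And>u G. wgrad u G \<Longrightarrow> u \<in> W1p0 \<Omega> p \<Longrightarrow> pint M p u \<le> CP * pint M p G"
    using poincare by blast
  have Cauw: "\<exists>N. \<forall>m\<ge>N. \<forall>n\<ge>N. pint M p (\<lambda>x. w m x - w n x) < e" if "e > 0" for e
  proof -
    have "e / (CP + 1) > 0" using that CP by simp
    from CauG[OF this] obtain N where N: "\<And>m n. m \<ge> N \<Longrightarrow> n \<ge> N \<Longrightarrow> pint M p (\<lambda>x. G m x - G n x) < e / (CP + 1)"
      by auto
    have "pint M p (\<lambda>x. w m x - w n x) < e" if "m \<ge> N" "n \<ge> N" for m n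
    proof -
      have "pint M p (\<lambda>x. w m x - w n x) \<le> CP * pint M p (\<lambda>x. G m x - G n x)"
        by (intro CP wgrad_diff G boundary_class_diff[where v=v] w)
      also have "\<dots> \<le> (CP + 1) * pint M p (\<lambda>x. G m x - G n x)" by (simp add: distrib_right)
      also have "\<dots> < (CP + 1) * (e / (CP + 1))" using N[OF that] CP by (intro mult_strict_left_mono) auto
      also have "\<dots> = e" using CP by simp
      finally show ?thesis .
    qed
    then show ?thesis by blast
  qed
  obtain r H where H: "strict_mono (r :: nat \<Rightarrow> nat)" "lp M p H" "AE x in M. (\<lambda>k. G (r k) x) \<longlonglongrightarrow> H x"
    "(\<lambda>k. pint M p (\<lambda>x. G k x - H x)) \<longlonglongrightarrow> 0"
    using lp_complete[OF p G(2) CauG] by blast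
  obtain r' :: "nat \<Rightarrow> nat" and u where u: "lp M p u" "(\<lambda>k. pint M p (\<lambda>x. w k x - u x)) \<longlonglongrightarrow> 0"
    using lp_complete[OF p wgradD(1)[OF G(1)] Cauw] by blast
  have uH: "wgrad u H" by (rule wgrad_limit[OF G(1) u(1) H(2) u(2) H(4)])
  have vD: "wgrad v (?D v)" by (rule wgrad_weak_gradient[OF v])
  have "(\<lambda>x. v x - u x) \<in> W1p0 \<Omega> p"
  proof (rule W1p0_closed)
    show "wgrad (\<lambda>x. v x - w k x) (\<lambda>x. ?D v x - G k x)" for k by (intro wgrad_diff vD G)
    show "(\<lambda>x. v x - w k x) \<in> W1p0 \<Omega> p" for k by (rule boundary_classD(2)[OF w(1)])
    show "wgrad (\<lambda>x. v x - u x) (\<lambda>x. ?D v x - H x)" by (intro wgrad_diff vD uH)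
    have "pint M p (\<lambda>x. (v x - w k x) - (v x - u x)) = pint M p (\<lambda>x. w k x - u x)" for k
      using pint_minus_commute[of M p "w k" u] by simp
    then show "(\<lambda>k. pint M p (\<lambda>x. (v x - w k x) - (v x - u x))) \<longlonglongrightarrow> 0" using u(2) by simp
    have "pint M p (\<lambda>x. (?D v x - G k x) - (?D v x - H x)) = pint M p (\<lambda>x. G k x - H x)" for k
      using pint_minus_commute[of M p "G k" H] by simp
    then show "(\<lambda>k. pint M p (\<lambda>x. (?D v x - G k x) - (?D v x - H x))) \<longlonglongrightarrow> 0" using H(4) by simp
  qed
  then have u_class: "u \<in> boundary_class v" using uH unfolding boundary_class_def W1p_iff by blast
  have "grad_energy H \<le> I + e" if e: "e > 0" for e
  proof (rule grad_energy_fatou[OF G(2) H(2,3)])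
    obtain N where N: "inverse (real (Suc N)) < e" using reals_Archimedean[OF e] by blast
    have "grad_energy (G (r k)) \<le> I + e" if "k \<ge> N" for k
    proof -
      have "inverse (real (Suc (r k))) \<le> inverse (real (Suc N))"
        using that seq_suble[OF H(1), of k] by (simp add: le_imp_inverse_le)
      then show ?thesis using energy_w[of "r k"] N by linarith
    qed
    then show "\<forall>\<^sub>F k in sequentially. grad_energy (G (r k)) \<le> I + e" unfolding eventually_sequentially by blast
  qed
  then have "grad_energy H \<le> I" by (rule field_le_epsilon)
  then have "\<forall>w\<in>boundary_class v. energy \<Omega> p \<sigma> u \<le> energy \<Omega> p \<sigma> w"
    using I_le by (auto simp: energy_eq_grad_energy[OF uH] intro: order_trans)
  then show ?thesis using u_class by blast
qed

lemma flux_pairing_integrable: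
  fixes G Z :: "real^'n \<Rightarrow> real^'n"
  assumes "lp M p G" "lp M p Z"
  shows "integrable M (\<lambda>x. \<sigma> x * (flux p (G x) \<bullet> Z x))"
    and "norm (flux p (G x) \<bullet> Z x) \<le> norm (G x) powr p + norm (Z x) powr p"
proof -
  have bound: "norm (flux p a \<bullet> b) \<le> norm a powr p + norm b powr p" for a b :: "real^'n"
  proof -
    have "norm (flux p a \<bullet> b) \<le> norm a powr (p - 1) * norm b"
      using Cauchy_Schwarz_ineq2[of "flux p a" b] by (simp add: norm_flux)
    also have "\<dots> \<le> 1 * norm a powr p + 1 powr (1 - p) * norm b powr p"
      by (intro young_powr_eps p) auto
    finally show ?thesis by simp
  qed
  show "norm (flux p (G x) \<bullet> Z x) \<le> norm (G x) powr p + norm (Z x) powr p" by (rule bound)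
  have [measurable]: "G \<in> borel_measurable M" "Z \<in> borel_measurable M" using assms by (auto simp: lp_def)
  have fm: "(\<lambda>x. flux p (G x)) \<in> borel_measurable M"
    by (rule measurable_compose[OF _ borel_measurable_flux[OF p]]) measurable
  show "integrable M (\<lambda>x. \<sigma> x * (flux p (G x) \<bullet> Z x))"
  proof (rule \<sigma>_integrable, rule Bochner_Integration.integrable_bound)
    show "integrable M (\<lambda>x. norm (G x) powr p + norm (Z x) powr p)" using assms by (simp add: lp_def)
    show "(\<lambda>x. flux p (G x) \<bullet> Z x) \<in> borel_measurable M" using fm by simp
    show "AE x in M. norm (flux p (G x) \<bullet> Z x) \<le> norm (norm (G x) powr p + norm (Z x) powr p)"
      using bound by (intro AE_I2) simp
  qed
qed

text \<open>
The one-sided derivative of the energy in the direction \<open>z\<close>. The tangent inequality at the perturbed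
gradient \<open>G + t Z\<close>, evaluated at \<open>G\<close>, gives the sign for every \<open>t > 0\<close>, and dominated convergence
lets \<open>t\<close> tend to \<open>0\<close>.
\<close>

lemma euler_lagrange_ge:
  assumes u: "u \<in> boundary_class v" "\<And>w. w \<in> boundary_class v \<Longrightarrow> energy \<Omega> p \<sigma> u \<le> energy \<Omega> p \<sigma> w"
    and G: "wgrad u G" and z: "z \<in> W1p0 \<Omega> p" "wgrad z Z"
  shows "0 \<le> (\<integral>x. \<sigma> x * (flux p (G x) \<bullet> Z x) \<partial>M)"
proof -
  define t :: "nat \<Rightarrow> real" where "t k = inverse (real (Suc k))" for k
  have t: "0 < t k" "t k \<le> 1" for k by (auto simp: t_def inverse_eq_divide)
  define H where "H k = (\<lambda>x. G x + t k *\<^sub>R Z x)" for k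
  have lp: "lp M p G" "lp M p Z" using wgradD[OF G] wgradD[OF z(2)] by auto
  have wH: "wgrad (\<lambda>x. u x + t k * z x) (H k)" for k unfolding H_def by (intro wgrad_add wgrad_scale G z)
  have lpH: "lp M p (H k)" for k by (rule wgradD(2)[OF wH])
  have pos: "0 \<le> (\<integral>x. \<sigma> x * (flux p (H k x) \<bullet> Z x) \<partial>M)" for k
  proof -
    have "grad_energy G \<le> grad_energy (H k)"
      using u(2)[OF boundary_class_add[OF u(1) z(1)], of "t k"] by (simp only: energy_eq_grad_energy[OF G] energy_eq_grad_energy[OF wH])
    moreover have "grad_energy (H k) \<le> (\<integral>x. \<sigma> x * norm (G x) powr p + (p * t k) * (\<sigma> x * (flux p (H k x) \<bullet> Z x)) \<partial>M)"
      unfolding grad_energy_def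
    proof (rule integral_mono)
      show "integrable M (\<lambda>x. \<sigma> x * norm (H k x) powr p)" by (rule grad_energy_integrable[OF lpH])
      show "integrable M (\<lambda>x. \<sigma> x * norm (G x) powr p + (p * t k) * (\<sigma> x * (flux p (H k x) \<bullet> Z x)))"
        by (intro Bochner_Integration.integrable_add Bochner_Integration.integrable_mult_right
            grad_energy_integrable flux_pairing_integrable(1) lp lpH)
      fix x assume "x \<in> space M"
      then have s: "\<sigma> x > 0" by (simp add: \<sigma>_pos)
      have "flux p (H k x) \<bullet> (G x - H k x) = - (t k * (flux p (H k x) \<bullet> Z x))" by (simp add: H_def)
      then have "norm (H k x) powr p \<le> norm (G x) powr p + p * t k * (flux p (H k x) \<bullet> Z x)"
        using norm_powr_tangent[OF p, of "H k x" "G x"] by (simp add: mult.assoc)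
      then have "\<sigma> x * norm (H k x) powr p \<le> \<sigma> x * (norm (G x) powr p + p * t k * (flux p (H k x) \<bullet> Z x))"
        using s by (intro mult_left_mono) auto
      then show "\<sigma> x * norm (H k x) powr p \<le> \<sigma> x * norm (G x) powr p + (p * t k) * (\<sigma> x * (flux p (H k x) \<bullet> Z x))"
        by (simp add: distrib_left mult.assoc mult.left_commute)
    qed
    moreover have "(\<integral>x. \<sigma> x * norm (G x) powr p + (p * t k) * (\<sigma> x * (flux p (H k x) \<bullet> Z x)) \<partial>M)
        = grad_energy G + (p * t k) * (\<integral>x. \<sigma> x * (flux p (H k x) \<bullet> Z x) \<partial>M)"
      using Bochner_Integration.integral_add[OF grad_energy_integrable[OF lp(1)]
          Bochner_Integration.integrable_mult_right[OF flux_pairing_integrable(1)[OF lpH lp(2)]], of "p * t k" k]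
      by (simp add: grad_energy_def)
    ultimately have "0 \<le> (p * t k) * (\<integral>x. \<sigma> x * (flux p (H k x) \<bullet> Z x) \<partial>M)" by linarith
    moreover have "0 < p * t k" using p t by simp
    ultimately show ?thesis by (simp only: zero_le_mult_iff) auto
  qed
  have [measurable]: "G \<in> borel_measurable M" "Z \<in> borel_measurable M" "H k \<in> borel_measurable M" for k
    using lp lpH by (auto simp: lp_def)
  have "(\<lambda>k. \<integral>x. \<sigma> x * (flux p (H k x) \<bullet> Z x) \<partial>M) \<longlonglongrightarrow> (\<integral>x. \<sigma> x * (flux p (G x) \<bullet> Z x) \<partial>M)"
  proof (rule integral_dominated_convergence[where
        w="\<lambda>x. \<sigma> x * (2 powr p * (norm (G x) powr p + norm (Z x) powr p) + norm (Z x) powr p)"])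
    show "(\<lambda>x. \<sigma> x * (flux p (H k x) \<bullet> Z x)) \<in> borel_measurable M" for k
      using flux_pairing_integrable(1)[OF lpH lp(2)] by (rule borel_measurable_integrable)
    show "(\<lambda>x. \<sigma> x * (flux p (G x) \<bullet> Z x)) \<in> borel_measurable M"
      using flux_pairing_integrable(1)[OF lp] by (rule borel_measurable_integrable)
    show "integrable M (\<lambda>x. \<sigma> x * (2 powr p * (norm (G x) powr p + norm (Z x) powr p) + norm (Z x) powr p))"
      using lp by (intro \<sigma>_integrable) (simp add: lp_def)
    show "AE x in M. (\<lambda>k. \<sigma> x * (flux p (H k x) \<bullet> Z x)) \<longlonglongrightarrow> \<sigma> x * (flux p (G x) \<bullet> Z x)"
    proof (rule AE_I2)
      fix x
      have "(\<lambda>k. G x + t k *\<^sub>R Z x) \<longlonglongrightarrow> G x + 0 *\<^sub>R Z x"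
        unfolding t_def by (intro tendsto_intros LIMSEQ_inverse_real_of_nat)
      then have "(\<lambda>k. H k x) \<longlonglongrightarrow> G x" by (simp add: H_def)
      then have "(\<lambda>k. flux p (H k x)) \<longlonglongrightarrow> flux p (G x)" by (rule isCont_tendsto_compose[OF isCont_flux[OF p]])
      then show "(\<lambda>k. \<sigma> x * (flux p (H k x) \<bullet> Z x)) \<longlonglongrightarrow> \<sigma> x * (flux p (G x) \<bullet> Z x)"
        by (intro tendsto_intros)
    qed
    show "AE x in M. norm (\<sigma> x * (flux p (H k x) \<bullet> Z x))
        \<le> \<sigma> x * (2 powr p * (norm (G x) powr p + norm (Z x) powr p) + norm (Z x) powr p)" for k
    proof (rule AE_I2)
      fix x assume "x \<in> space M"
      then have s: "\<sigma> x > 0" by (simp add: \<sigma>_pos)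
      have "norm (t k *\<^sub>R Z x) \<le> norm (Z x)" using t[of k] by (simp add: mult_left_le_one_le)
      then have "norm (t k *\<^sub>R Z x) powr p \<le> norm (Z x) powr p" using p by (intro powr_mono2) auto
      then have "norm (H k x) powr p \<le> 2 powr p * (norm (G x) powr p + norm (Z x) powr p)"
        unfolding H_def using p
        by (intro order_trans[OF norm_add_powr_le] mult_left_mono add_left_mono) auto
      then have "norm (flux p (H k x) \<bullet> Z x) \<le> 2 powr p * (norm (G x) powr p + norm (Z x) powr p) + norm (Z x) powr p"
        using flux_pairing_integrable(2)[OF lpH lp(2), of k x] by linarith
      then show "norm (\<sigma> x * (flux p (H k x) \<bullet> Z x))
        \<le> \<sigma> x * (2 powr p * (norm (G x) powr p + norm (Z x) powr p) + norm (Z x) powr p)"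
        using s by (simp add: abs_mult)
    qed
  qed
  then show ?thesis by (rule LIMSEQ_le_const) (use pos in blast)
qed

lemma euler_lagrange:
  assumes u: "u \<in> boundary_class v" "\<And>w. w \<in> boundary_class v \<Longrightarrow> energy \<Omega> p \<sigma> u \<le> energy \<Omega> p \<sigma> w"
    and G: "wgrad u G" and z: "z \<in> W1p0 \<Omega> p" "wgrad z Z"
  shows "(\<integral>x. \<sigma> x * (flux p (G x) \<bullet> Z x) \<partial>M) = 0"
proof -
  have "0 \<le> (\<integral>x. \<sigma> x * (flux p (G x) \<bullet> ((-1) *\<^sub>R Z x)) \<partial>M)"
    by (rule euler_lagrange_ge[OF u G W1p0_scale[OF z(1)] wgrad_scale[OF z(2)]])
  then show ?thesis using euler_lagrange_ge[OF u G z] by simp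
qed

definition min_energy :: "(real^'n \<Rightarrow> real) \<Rightarrow> real" where
  "min_energy v = energy \<Omega> p \<sigma> (minimizer \<Omega> p \<sigma> (boundary_class v))"

lemma minimizer:
  assumes "v \<in> W1p \<Omega> p"
  shows "minimizer \<Omega> p \<sigma> (boundary_class v) \<in> boundary_class v"
    "w \<in> boundary_class v \<Longrightarrow> energy \<Omega> p \<sigma> (minimizer \<Omega> p \<sigma> (boundary_class v)) \<le> energy \<Omega> p \<sigma> w"
proof -
  have "\<exists>u. u \<in> boundary_class v \<and> (\<forall>w\<in>boundary_class v. energy \<Omega> p \<sigma> u \<le> energy \<Omega> p \<sigma> w)"
    using exists_minimizer[OF assms] by blast
  from someI_ex[OF this] show "minimizer \<Omega> p \<sigma> (boundary_class v) \<in> boundary_class v"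
    "w \<in> boundary_class v \<Longrightarrow> energy \<Omega> p \<sigma> (minimizer \<Omega> p \<sigma> (boundary_class v)) \<le> energy \<Omega> p \<sigma> w"
    unfolding minimizer_def by blast+
qed

text \<open>
The map pairs the flux of the minimizer with the gradient of an unspecified member of the class. The
Euler-Lagrange equation permits replacing that member by the minimizer itself.
\<close>

lemma DN_map_diagonal:
  assumes v: "v \<in> W1p \<Omega> p"
  shows "DN_map \<Omega> p \<sigma> (boundary_class v) (boundary_class v) = min_energy v"
proof -
  let ?u = "minimizer \<Omega> p \<sigma> (boundary_class v)" and ?v = "SOME w. w \<in> boundary_class v"
  let ?G = "weak_gradient \<Omega> p ?u" and ?H = "weak_gradient \<Omega> p ?v"
  have vc: "?v \<in> boundary_class v" using someI[of "\<lambda>w. w \<in> boundary_class v", OF boundary_class_self[OF v]] .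
  note uc = minimizer(1)[OF v]
  have G: "wgrad ?u ?G" by (rule wgrad_weak_gradient[OF boundary_classD(1)[OF uc]])
  have H: "wgrad ?v ?H" by (rule wgrad_weak_gradient[OF boundary_classD(1)[OF vc]])
  have 0: "(\<integral>x. \<sigma> x * (flux p (?G x) \<bullet> (?H x - ?G x)) \<partial>M) = 0"
    by (rule euler_lagrange[OF uc minimizer(2)[OF v] G boundary_class_diff[OF vc uc] wgrad_diff[OF H G]])
  have "DN_map \<Omega> p \<sigma> (boundary_class v) (boundary_class v) = (\<integral>x. \<sigma> x * norm (?G x) powr (p - 2) * (?G x \<bullet> ?H x) \<partial>M)"
    using boundary_class_in_boundary_space[OF v] by (simp add: DN_map_def Let_def)
  also have "\<dots> = (\<integral>x. \<sigma> x * norm (?G x) powr p + \<sigma> x * (flux p (?G x) \<bullet> (?H x - ?G x)) \<partial>M)"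
  proof (rule Bochner_Integration.integral_cong[OF refl])
    fix x
    have "norm (?G x) powr p + flux p (?G x) \<bullet> (?H x - ?G x) = flux p (?G x) \<bullet> ?H x"
      by (simp add: inner_diff_right inner_flux)
    then show "\<sigma> x * norm (?G x) powr (p - 2) * (?G x \<bullet> ?H x)
        = \<sigma> x * norm (?G x) powr p + \<sigma> x * (flux p (?G x) \<bullet> (?H x - ?G x))"
      by (simp add: flux_def distrib_left[symmetric] mult.assoc del: inner_diff_right)
  qed
  also have "\<dots> = (\<integral>x. \<sigma> x * norm (?G x) powr p \<partial>M) + (\<integral>x. \<sigma> x * (flux p (?G x) \<bullet> (?H x - ?G x)) \<partial>M)"
    by (intro Bochner_Integration.integral_add grad_energy_integrable flux_pairing_integrable(1) lp_diff(1)[OF p] wgradD(2)[OF G] wgradD(2)[OF H])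
  also have "\<dots> = min_energy v" unfolding 0 by (simp add: min_energy_def energy_def)
  finally show ?thesis .
qed

end

section \<open>Two-sided bounds for the minimal energy\<close>

context conductivity
begin

lemma min_energy_le:
  assumes "wgrad v V"
  shows "min_energy v \<le> grad_energy V"
proof -
  have v: "v \<in> W1p \<Omega> p" using assms by (auto simp: W1p_iff)
  show ?thesis
    using minimizer(2)[OF v boundary_class_self[OF v]] by (simp only: min_energy_def energy_eq_grad_energy[OF assms])
qed

text \<open>
The tangent inequality at \<open>k V\<close> with \<open>k = (l / \<sigma>)\<^sup>1\<^sup>/\<^sup>(\<^sup>p\<^sup>-\<^sup>1\<^sup>)\<close> bounds the energy density of the
minimizer from below. This \<open>k\<close> is chosen so that \<open>\<sigma> * flux p (k V)\<close> is the constant \<open>l\<close> times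
\<open>flux p V\<close>, hence still divergence free; in the linear term the gradient of the minimizer may then
be replaced by \<open>V\<close>. At a point where \<open>\<sigma> = l\<close> the weight equals \<open>l\<close>, so nothing is lost there.
\<close>

lemma min_energy_ge:
  assumes V: "wgrad v V" "continuous_on (closure \<Omega>) V"
    and div: "\<And>\<phi>. \<phi> \<in> test_functions \<Omega> \<Longrightarrow> (\<integral>x. grad \<phi> x \<bullet> flux p (V x) \<partial>M) = 0"
    and l: "l > 0"
  shows "(\<integral>x. (p * l - (p - 1) * l * (l / \<sigma> x) powr (1 / (p - 1))) * norm (V x) powr p \<partial>M) \<le> min_energy v"
proof -
  have v: "v \<in> W1p \<Omega> p" using V(1) by (auto simp: W1p_iff)
  define u where "u = minimizer \<Omega> p \<sigma> (boundary_class v)"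
  define G where "G = weak_gradient \<Omega> p u"
  define k where "k x = (l / \<sigma> x) powr (1 / (p - 1))" for x
  have uc: "u \<in> boundary_class v" unfolding u_def by (rule minimizer(1)[OF v])
  have G: "wgrad u G" unfolding G_def by (rule wgrad_weak_gradient[OF boundary_classD(1)[OF uc]])
  note lp = wgradD(2)[OF V(1)] wgradD(2)[OF G]
  have cF: "continuous_on (closure \<Omega>) (\<lambda>x. flux p (V x))"
    by (rule continuous_on_compose2[OF _ V(2), of UNIV])
       (auto intro!: continuous_at_imp_continuous_on isCont_flux p)
  have orth: "(\<integral>x. (G x - V x) \<bullet> flux p (V x) \<partial>M) = 0"
    by (rule W1p0_orthogonal_divergence_free[OF wgrad_diff[OF G V(1)] boundary_class_diff[OF uc boundary_class_self[OF v]] cF div])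
  have ck: "continuous_on (closure \<Omega>) k"
  proof -
    have "\<forall>x\<in>closure \<Omega>. \<sigma> x \<noteq> 0" "\<forall>x\<in>closure \<Omega>. l / \<sigma> x \<noteq> 0"
      using pos_\<sigma> l by force+
    then show ?thesis unfolding k_def by (intro continuous_intros cont_\<sigma>)
  qed
  have cN: "continuous_on (closure \<Omega>) (\<lambda>x. norm (V x) powr p)"
    using p by (intro continuous_on_powr' continuous_intros V) auto
  let ?w = "\<lambda>x. (p * l - (p - 1) * l * k x) * norm (V x) powr p"
  have int1: "integrable M ?w" by (intro integrable_continuous_M continuous_intros ck cN)
  have int2: "integrable M (\<lambda>x. (G x - V x) \<bullet> flux p (V x))"
    by (intro lp_inner_integrable lp_diff(1)[OF p] lp cF)
  have "(\<integral>x. ?w x + p * l * ((G x - V x) \<bullet> flux p (V x)) \<partial>M) \<le> grad_energy G"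
    unfolding grad_energy_def
  proof (rule integral_mono)
    show "integrable M (\<lambda>x. ?w x + p * l * ((G x - V x) \<bullet> flux p (V x)))"
      by (intro Bochner_Integration.integrable_add int1 Bochner_Integration.integrable_mult_right int2)
    show "integrable M (\<lambda>x. \<sigma> x * norm (G x) powr p)" by (rule grad_energy_integrable[OF lp(2)])
    fix x assume "x \<in> space M"
    then have s: "\<sigma> x > 0" by (simp add: \<sigma>_pos)
    have k: "k x > 0" using s l by (simp add: k_def)
    have kp: "k x powr (p - 1) = l / \<sigma> x" using s l p by (simp add: k_def powr_powr)
    define N where "N = norm (V x) powr p"
    define g where "g = flux p (V x) \<bullet> G x"
    have VN: "flux p (V x) \<bullet> V x = N" by (simp add: N_def inner_flux)
    have skl: "\<sigma> x * k x powr (p - 1) = l" using kp s by simp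
    have kpp: "k x powr p = k x powr (p - 1) * k x" using powr_mult_base[of "k x" "p - 1"] k by (simp add: mult.commute)
    have "norm (k x *\<^sub>R V x) powr p + p * (flux p (k x *\<^sub>R V x) \<bullet> (G x - k x *\<^sub>R V x)) \<le> norm (G x) powr p"
      by (rule norm_powr_tangent[OF p])
    also have "norm (k x *\<^sub>R V x) powr p = k x powr (p - 1) * k x * N"
      using k kpp by (simp add: powr_mult N_def)
    also have "flux p (k x *\<^sub>R V x) \<bullet> (G x - k x *\<^sub>R V x) = k x powr (p - 1) * (g - k x * N)"
      using k VN by (simp add: flux_scale inner_diff_right g_def right_diff_distrib mult.left_commute)
    finally have "\<sigma> x * (k x powr (p - 1) * k x * N + p * (k x powr (p - 1) * (g - k x * N))) \<le> \<sigma> x * norm (G x) powr p"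
      using s by (intro mult_left_mono) auto
    also have "\<sigma> x * (k x powr (p - 1) * k x * N + p * (k x powr (p - 1) * (g - k x * N)))
        = (\<sigma> x * k x powr (p - 1)) * (k x * N + p * (g - k x * N))" by (simp add: algebra_simps)
    also have "\<dots> = (p * l - (p - 1) * l * k x) * N + p * l * (g - N)"
      unfolding skl by (simp add: algebra_simps)
    also have "g - N = (G x - V x) \<bullet> flux p (V x)"
      unfolding inner_commute[of "G x - V x"] using VN by (simp add: g_def inner_diff_right)
    finally show "?w x + p * l * ((G x - V x) \<bullet> flux p (V x)) \<le> \<sigma> x * norm (G x) powr p"
      by (simp only: N_def)
  qed
  also have "(\<integral>x. ?w x + p * l * ((G x - V x) \<bullet> flux p (V x)) \<partial>M)
      = (\<integral>x. ?w x \<partial>M) + (\<integral>x. p * l * ((G x - V x) \<bullet> flux p (V x)) \<partial>M)"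
    by (intro Bochner_Integration.integral_add int1 Bochner_Integration.integrable_mult_right int2)
  also have "(\<integral>x. p * l * ((G x - V x) \<bullet> flux p (V x)) \<partial>M) = 0"
    using orth by simp
  also have "grad_energy G = min_energy v" by (simp add: min_energy_def energy_eq_grad_energy[OF G, symmetric] u_def)
  finally show ?thesis by (simp add: k_def)
qed

end

section \<open>Wolff's exponential solutions of the p-Laplace equation\<close>

text \<open>
For a function \<open>exp s * a t\<close> of two orthogonal coordinates, the \<open>p\<close>-Laplace equation is homogeneous
in \<open>(a, a')\<close>. In polar coordinates the phase \<open>\<Theta>\<close> of \<open>(a, - a')\<close> satisfies this autonomous
equation with \<open>q = p - 1\<close>, and the inverse function \<open>Y\<close> of the solution is elementary.
\<close>

lemma wolff_phase:
  fixes q :: real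
  assumes q: "q > 0"
  obtains \<Theta> where "\<And>y. (\<Theta> has_real_derivative (q / (q * (sin (\<Theta> y))\<^sup>2 + (cos (\<Theta> y))\<^sup>2))) (at y)"
proof -
  define Y where "Y \<theta> = \<theta> * ((1 + 1 / q) / 2) + (1 / q - 1) / 2 * (sin \<theta> * cos \<theta>)" for \<theta> :: real
  define Y' where "Y' \<theta> = (sin \<theta>)\<^sup>2 + (cos \<theta>)\<^sup>2 / q" for \<theta> :: real
  have Y: "(Y has_real_derivative Y' \<theta>) (at \<theta>)" for \<theta>
  proof -
    have "((\<lambda>\<theta>. \<theta> * A + B * (sin \<theta> * cos \<theta>)) has_real_derivative (A + B * ((cos \<theta>)\<^sup>2 - (sin \<theta>)\<^sup>2))) (at \<theta>)" for A B
      by (auto intro!: derivative_eq_intros simp: power2_eq_square algebra_simps)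
    then have "(Y has_real_derivative ((1 + 1 / q) / 2 + (1 / q - 1) / 2 * ((cos \<theta>)\<^sup>2 - (sin \<theta>)\<^sup>2))) (at \<theta>)"
      unfolding Y_def[abs_def] .
    also have "(1 + 1 / q) / 2 + (1 / q - 1) / 2 * ((cos \<theta>)\<^sup>2 - (sin \<theta>)\<^sup>2) = Y' \<theta>"
      unfolding Y'_def cos_squared_eq using q by (simp add: field_simps)
    finally show ?thesis .
  qed
  have pos: "Y' \<theta> > 0" for \<theta>
  proof (cases "sin \<theta> = 0")
    case True
    then have "(cos \<theta>)\<^sup>2 = 1" using sin_cos_squared_add[of \<theta>] by simp
    then show ?thesis using q True by (simp add: Y'_def)
  qed (use q in \<open>auto simp: Y'_def intro!: add_pos_nonneg\<close>)
  have mono: "Y a < Y b" if "a < b" for a b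
    by (rule DERIV_pos_imp_increasing[OF that]) (use Y pos in blast)
  have inj: "inj Y" by (rule injI) (metis mono less_irrefl linorder_less_linear)
  have contY: "continuous_on S Y" for S
    by (intro continuous_at_imp_continuous_on ballI DERIV_isCont[OF Y])
  have "\<exists>\<theta>. Y \<theta> = y" for y
  proof -
    define A where "A = (1 + 1 / q) / 2"
    define B where "B = \<bar>(1 / q - 1) / 2\<bar>"
    have A: "A > 0" using q by (simp add: A_def add_pos_pos)
    define r where "r = (\<bar>y\<bar> + B) / A"
    have r: "r \<ge> 0" "r * A = \<bar>y\<bar> + B" using A by (auto simp: r_def B_def)
    have near: "\<bar>Y \<theta> - \<theta> * A\<bar> \<le> B" for \<theta>
    proof -
      have "\<bar>sin \<theta> * cos \<theta>\<bar> \<le> 1"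
        using abs_sin_le_one[of \<theta>] abs_cos_le_one[of \<theta>] by (simp add: abs_mult mult_le_one)
      then have "\<bar>(1 / q - 1) / 2\<bar> * \<bar>sin \<theta> * cos \<theta>\<bar> \<le> B * 1"
        unfolding B_def by (intro mult_left_mono) auto
      then show ?thesis by (simp add: Y_def A_def flip: abs_mult)
    qed
    have "y \<le> Y r" "Y (- r) \<le> y"
      using near[of r] near[of "- r"] r by (auto simp: abs_le_iff)
    then show ?thesis
      using IVT'[of Y "- r" y r] contY r by auto
  qed
  then have surj: "surj Y" by (metis surjI surj_def)
  define \<Theta> where "\<Theta> = inv Y"
  have "(\<Theta> has_real_derivative (q / (q * (sin (\<Theta> y))\<^sup>2 + (cos (\<Theta> y))\<^sup>2))) (at y)" for y
  proof -
    have yy: "Y (\<Theta> y) = y" unfolding \<Theta>_def by (rule surj_f_inv_f[OF surj])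
    have "(\<Theta> has_derivative (\<lambda>h. h / Y' (\<Theta> y))) (at (Y (\<Theta> y)))"
    proof (rule has_derivative_inverse_strong[where S=UNIV and f=Y and f'="(*) (Y' (\<Theta> y))"])
      show "(Y has_derivative (*) (Y' (\<Theta> y))) (at (\<Theta> y))"
        using Y by (simp add: has_field_derivative_def)
      show "(*) (Y' (\<Theta> y)) \<circ> (\<lambda>h. h / Y' (\<Theta> y)) = id"
        using pos[of "\<Theta> y"] by (auto simp: fun_eq_iff)
    qed (auto simp: contY \<Theta>_def inj)
    moreover have "h / Y' (\<Theta> y) = (q / (q * (sin (\<Theta> y))\<^sup>2 + (cos (\<Theta> y))\<^sup>2)) * h" for h
    proof -
      have "q * Y' (\<Theta> y) = q * (sin (\<Theta> y))\<^sup>2 + (cos (\<Theta> y))\<^sup>2" using q by (simp add: Y'_def distrib_left)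
      then have "q / (q * (sin (\<Theta> y))\<^sup>2 + (cos (\<Theta> y))\<^sup>2) = 1 / Y' (\<Theta> y)"
        using q by (metis divide_divide_eq_left' nonzero_divide_mult_cancel_left order_less_irrefl)
      then show ?thesis by simp
    qed
    ultimately show ?thesis unfolding has_field_derivative_def by (simp only: yy)
  qed
  then show ?thesis using that by blast
qed

text \<open>
Here \<open>R\<close> is the modulus belonging to the phase \<open>\<Theta>\<close>, so that \<open>a = R cos \<Theta>\<close> and \<open>b = R sin \<Theta>\<close>; it is
an explicit function of \<open>cos \<Theta>\<close>, hence bounded above and below. The functions \<open>\<alpha>\<close> and \<open>\<beta>\<close> are the
components of the flux, up to sign and an exponential factor, and the equation for \<open>\<beta>\<close> says that
the flux is divergence free.
\<close>

lemma wolff_profile: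
  fixes p :: real
  assumes p: "p > 1"
  obtains a b R \<alpha> \<beta> :: "real \<Rightarrow> real" and K where
    "\<And>y. (a has_real_derivative - b y) (at y)"
    "\<And>y. (\<beta> has_real_derivative (p - 1) * \<alpha> y) (at y)"
    "continuous_on UNIV b" "continuous_on UNIV \<alpha>"
    "\<And>y. (a y)\<^sup>2 + (b y)\<^sup>2 = (R y)\<^sup>2"
    "\<And>y. exp (- K) \<le> R y" "\<And>y. R y \<le> exp K"
    "\<And>y. \<alpha> y = R y powr (p - 2) * a y" "\<And>y. \<beta> y = R y powr (p - 2) * b y"
proof -
  define q where "q = p - 1"
  have q: "q > 0" using p by (simp add: q_def)
  obtain \<Theta> where \<Theta>: "\<And>y. (\<Theta> has_real_derivative (q / (q * (sin (\<Theta> y))\<^sup>2 + (cos (\<Theta> y))\<^sup>2))) (at y)"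
    using wolff_phase[OF q] by blast
  define D where "D y = q * (sin (\<Theta> y))\<^sup>2 + (cos (\<Theta> y))\<^sup>2" for y
  have D: "D y > 0" for y
  proof (cases "sin (\<Theta> y) = 0")
    case True
    then have "(cos (\<Theta> y))\<^sup>2 = 1" using sin_cos_squared_add[of "\<Theta> y"] by simp
    then show ?thesis using q True by (simp add: D_def)
  qed (use q in \<open>auto simp: D_def intro!: add_pos_nonneg\<close>)
  note \<Theta>' = \<Theta>[folded D_def]
  define c s where "c y = cos (\<Theta> y)" and "s y = sin (\<Theta> y)" for y
  have c: "(c has_real_derivative - s y * (q / D y)) (at y)" for y
    unfolding c_def[abs_def] s_def using \<Theta>'[of y] by (auto intro!: derivative_eq_intros)
  have s: "(s has_real_derivative c y * (q / D y)) (at y)" for y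
    unfolding s_def[abs_def] c_def using \<Theta>'[of y] by (auto intro!: derivative_eq_intros)
  have cs: "(s y)\<^sup>2 = 1 - (c y)\<^sup>2" for y by (simp add: s_def c_def sin_squared_eq)
  have Dq: "q / D y * ((c y)\<^sup>2 + q * (s y)\<^sup>2) = q" for y
    using D[of y] unfolding D_def s_def c_def by (simp add: add.commute)
  \<comment> \<open>As a function of the phase, \<open>ln R\<close> has derivative \<open>- 2 e sin \<Theta> cos \<Theta>\<close>, hence equals \<open>e cos\<^sup>2 \<Theta>\<close>.\<close>
  define e where "e = (1 - q) / q / 2"
  define R where "R y = exp (e * (c y)\<^sup>2)" for y
  define a where "a y = R y * c y" for y
  define b where "b y = R y * s y" for y
  define \<alpha> where "\<alpha> y = exp (q * e * (c y)\<^sup>2) * c y" for y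
  define \<beta> where "\<beta> y = exp (q * e * (c y)\<^sup>2) * s y" for y
  have dexp: "((\<lambda>y. exp (k * (f y)\<^sup>2)) has_real_derivative exp (k * (f y)\<^sup>2) * (k * (2 * f y * f'))) (at y)"
    if "(f has_real_derivative f') (at y)" for f f' k y
    by (auto intro!: derivative_eq_intros that)
  have da: "(a has_real_derivative - b y) (at y)" for y
  proof -
    have "(a has_real_derivative (R y * (e * (2 * c y * (- s y * (q / D y)))) * c y + (- s y * (q / D y)) * R y)) (at y)"
      unfolding a_def[abs_def] R_def[abs_def] by (rule DERIV_mult[OF dexp[OF c] c])
    also have "R y * (e * (2 * c y * (- s y * (q / D y)))) * c y + (- s y * (q / D y)) * R y
        = - (R y * s y) * (q / D y * (2 * e * (c y)\<^sup>2 + 1))"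
    proof -
      have "r * (e * (2 * k * (- l * z))) * k + (- l * z) * r = - (r * l) * (z * (2 * e * k\<^sup>2 + 1))"
        for r k l z :: real by (simp add: algebra_simps power2_eq_square)
      then show ?thesis .
    qed
    also have "2 * e * (c y)\<^sup>2 + 1 = ((c y)\<^sup>2 + q * (s y)\<^sup>2) / q"
      unfolding cs e_def using q by (simp add: field_simps)
    also have "q / D y * (((c y)\<^sup>2 + q * (s y)\<^sup>2) / q) = 1"
      using Dq[of y] q by (metis divide_self_if less_irrefl times_divide_eq_right)
    finally show ?thesis by (simp add: b_def)
  qed
  have d\<beta>: "(\<beta> has_real_derivative (p - 1) * \<alpha> y) (at y)" for y
  proof -
    let ?E = "exp (q * e * (c y)\<^sup>2)"
    have "(\<beta> has_real_derivative (?E * (q * e * (2 * c y * (- s y * (q / D y)))) * s y + (c y * (q / D y)) * ?E)) (at y)"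
      unfolding \<beta>_def[abs_def] by (rule DERIV_mult[OF dexp[OF c] s])
    also have "?E * (q * e * (2 * c y * (- s y * (q / D y)))) * s y + (c y * (q / D y)) * ?E
        = ?E * c y * (q / D y * (1 - 2 * q * e * (s y)\<^sup>2))"
    proof -
      have "r * (q * e * (2 * k * (- l * z))) * l + (k * z) * r = r * k * (z * (1 - 2 * q * e * l\<^sup>2))"
        for r k l z :: real by (simp add: algebra_simps power2_eq_square)
      then show ?thesis .
    qed
    also have "1 - 2 * q * e * (s y)\<^sup>2 = (c y)\<^sup>2 + q * (s y)\<^sup>2"
      unfolding cs e_def using q by (simp add: field_simps)
    also note Dq
    finally show ?thesis by (simp add: \<alpha>_def q_def mult.commute mult.left_commute)
  qed
  have cont: "continuous_on UNIV c" "continuous_on UNIV s"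
    by (intro continuous_at_imp_continuous_on ballI DERIV_isCont[OF c] DERIV_isCont[OF s])+
  have c1: "0 \<le> (c y)\<^sup>2" "(c y)\<^sup>2 \<le> 1" for y using cs[of y] zero_le_power2[of "s y"] by auto
  have eb: "\<bar>e * (c y)\<^sup>2\<bar> \<le> \<bar>e\<bar>" for y
    using c1[of y] mult_left_mono[of "(c y)\<^sup>2" 1 "\<bar>e\<bar>"] by (simp add: abs_mult)
  have Rp: "R y powr (p - 2) * R y = exp (q * e * (c y)\<^sup>2)" for y
    by (simp add: R_def powr_def q_def algebra_simps flip: exp_add)
  show ?thesis
  proof (rule that[of a b \<beta> \<alpha> R "\<bar>e\<bar>"])
    show "continuous_on UNIV b" "continuous_on UNIV \<alpha>"
      unfolding b_def[abs_def] \<alpha>_def[abs_def] R_def[abs_def] by (intro continuous_intros cont)+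
    show "(a y)\<^sup>2 + (b y)\<^sup>2 = (R y)\<^sup>2" for y
      unfolding a_def b_def power_mult_distrib cs by (simp add: algebra_simps)
    show "exp (- \<bar>e\<bar>) \<le> R y" "R y \<le> exp \<bar>e\<bar>" for y
      using eb[of y] unfolding R_def by (auto simp: abs_le_iff)
    show "\<alpha> y = R y powr (p - 2) * a y" "\<beta> y = R y powr (p - 2) * b y" for y
      unfolding \<alpha>_def \<beta>_def a_def b_def Rp[symmetric] by (simp_all add: mult.assoc)
  qed (rule da d\<beta>)+
qed

text \<open>
The solution is \<open>v(x) = exp (\<tau> (x \<bullet> \<rho> - c)) a(\<tau> (x \<bullet> e)) / \<tau>\<close>. In the frame \<open>\<rho>, e\<close> its gradient is the
exponential times \<open>(a, - b)\<close>, so its norm is the exponential times \<open>R\<close>.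
\<close>

lemma (in bounded_domain) wolff_solutions:
  assumes \<rho>: "norm \<rho> = 1" "norm e = 1" "\<rho> \<bullet> e = 0"
  obtains m K where "m > 0" "K > 0" "\<And>\<tau>. \<tau> > 0 \<Longrightarrow> \<exists>v V. wgrad v V \<and> continuous_on UNIV V
      \<and> (\<forall>x. m * exp (p * \<tau> * (x \<bullet> \<rho> - c)) \<le> norm (V x) powr p \<and> norm (V x) powr p \<le> K * exp (p * \<tau> * (x \<bullet> \<rho> - c)))
      \<and> (\<forall>\<phi>\<in>test_functions \<Omega>. (\<integral>x. grad \<phi> x \<bullet> flux p (V x) \<partial>M) = 0)"
proof -
  obtain a b R \<alpha> \<beta> k where
    a: "\<And>y. (a has_real_derivative - b y) (at y)" and
    \<beta>: "\<And>y. (\<beta> has_real_derivative (p - 1) * \<alpha> y) (at y)" and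
    cont: "continuous_on UNIV b" "continuous_on UNIV \<alpha>" and
    R: "\<And>y. (a y)\<^sup>2 + (b y)\<^sup>2 = (R y)\<^sup>2" "\<And>y. exp (- k) \<le> R y" "\<And>y. R y \<le> exp k" and
    \<alpha>: "\<And>y. \<alpha> y = R y powr (p - 2) * a y" "\<And>y. \<beta> y = R y powr (p - 2) * b y"
  proof (rule wolff_profile[OF p], goal_cases)
    case (1 a b R \<alpha> \<beta> k)
    show ?case by (rule that[of a b \<beta> \<alpha> R k]) (rule 1)+
  qed
  have Rpos: "R y > 0" for y using R(2)[of y] exp_gt_zero[of "- k"] by linarith
  have conta: "continuous_on UNIV a" "continuous_on UNIV \<beta>"
    by (intro continuous_at_imp_continuous_on ballI DERIV_isCont[OF a] DERIV_isCont[OF \<beta>])+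
  have comp: "continuous_on UNIV (\<lambda>x::real^'n. f (\<tau> * (x \<bullet> e)))" if "continuous_on UNIV f" for f :: "real \<Rightarrow> real" and \<tau>
    by (rule continuous_on_compose2[OF that]) (auto intro!: continuous_intros)
  have main: "\<exists>v V. wgrad v V \<and> continuous_on UNIV V
      \<and> (\<forall>x. exp (- k) powr p * exp (p * \<tau> * (x \<bullet> \<rho> - c)) \<le> norm (V x) powr p \<and> norm (V x) powr p \<le> exp k powr p * exp (p * \<tau> * (x \<bullet> \<rho> - c)))
      \<and> (\<forall>\<phi>\<in>test_functions \<Omega>. (\<integral>x. grad \<phi> x \<bullet> flux p (V x) \<partial>M) = 0)" if \<tau>: "\<tau> > 0" for \<tau>
  proof -
    define E where "E x = exp (\<tau> * (x \<bullet> \<rho> - c))" for x :: "real^'n"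
    define v where "v x = E x * a (\<tau> * (x \<bullet> e)) / \<tau>" for x
    define V where "V x = (E x * a (\<tau> * (x \<bullet> e))) *\<^sub>R \<rho> - (E x * b (\<tau> * (x \<bullet> e))) *\<^sub>R e" for x
    have contE: "continuous_on UNIV E" unfolding E_def by (intro continuous_intros)
    have contV: "continuous_on UNIV V"
      unfolding V_def by (intro continuous_intros contE comp conta cont)
    have dv: "(v has_derivative (\<lambda>h. V x \<bullet> h)) (at x)" for x
    proof -
      have dE: "(E has_derivative (\<lambda>h. E x * (\<tau> * (h \<bullet> \<rho>)))) (at x)"
        unfolding E_def by (auto intro!: derivative_eq_intros)
      have da: "((\<lambda>x. a (\<tau> * (x \<bullet> e))) has_derivative (\<lambda>h. - b (\<tau> * (x \<bullet> e)) * (\<tau> * (h \<bullet> e)))) (at x)"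
        by (rule has_derivative_compose[where g=a, OF _ a[unfolded has_field_derivative_def]])
           (auto intro!: derivative_eq_intros)
      have "(v has_derivative (\<lambda>h. (E x * (- b (\<tau> * (x \<bullet> e)) * (\<tau> * (h \<bullet> e))) + E x * (\<tau> * (h \<bullet> \<rho>)) * a (\<tau> * (x \<bullet> e))) / \<tau>)) (at x)"
        unfolding v_def by (intro bounded_linear.has_derivative[OF bounded_linear_divide] has_derivative_mult dE da)
      also have "(\<lambda>h. (E x * (- b (\<tau> * (x \<bullet> e)) * (\<tau> * (h \<bullet> e))) + E x * (\<tau> * (h \<bullet> \<rho>)) * a (\<tau> * (x \<bullet> e))) / \<tau>) = (\<lambda>h. V x \<bullet> h)"
      proof
        fix h
        have "V x \<bullet> h = E x * a (\<tau> * (x \<bullet> e)) * (h \<bullet> \<rho>) - E x * b (\<tau> * (x \<bullet> e)) * (h \<bullet> e)"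
          by (simp add: V_def inner_diff_left inner_commute[of \<rho> h] inner_commute[of e h])
        moreover have "(r * (- k * (\<tau> * z)) + r * (\<tau> * y) * l) / \<tau> = r * l * y - r * k * z" for r k l y z
          using \<tau> by (simp add: field_simps)
        ultimately show "(E x * (- b (\<tau> * (x \<bullet> e)) * (\<tau> * (h \<bullet> e))) + E x * (\<tau> * (h \<bullet> \<rho>)) * a (\<tau> * (x \<bullet> e))) / \<tau> = V x \<bullet> h"
          by simp
      qed
      finally show ?thesis .
    qed
    have nV: "norm (V x) = E x * R (\<tau> * (x \<bullet> e))" for x
    proof -
      let ?y = "\<tau> * (x \<bullet> e)"
      have "V x = E x *\<^sub>R (a ?y *\<^sub>R \<rho> - b ?y *\<^sub>R e)" by (simp add: V_def scaleR_diff_right)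
      moreover have "(norm (a ?y *\<^sub>R \<rho> - b ?y *\<^sub>R e))\<^sup>2 = (R ?y)\<^sup>2"
      proof -
        have "\<rho> \<bullet> \<rho> = 1" "e \<bullet> e = 1" "e \<bullet> \<rho> = 0" using \<rho> by (simp_all add: dot_square_norm inner_commute)
        then have "(norm (r *\<^sub>R \<rho> - l *\<^sub>R e))\<^sup>2 = r\<^sup>2 + l\<^sup>2" for r l
          unfolding power2_norm_eq_inner using \<rho>(3)
          by (simp add: inner_diff_left inner_diff_right power2_eq_square)
        then show ?thesis by (simp only: R(1))
      qed
      then have "norm (a ?y *\<^sub>R \<rho> - b ?y *\<^sub>R e) = R ?y"
        using Rpos[of ?y] by (simp add: power2_eq_iff_nonneg less_imp_le)
      ultimately show ?thesis by (simp add: E_def)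
    qed
    have Ep: "E x powr p = exp (p * \<tau> * (x \<bullet> \<rho> - c))" for x
      by (simp add: E_def powr_def mult.assoc)
    have Vp: "norm (V x) powr p = R (\<tau> * (x \<bullet> e)) powr p * exp (p * \<tau> * (x \<bullet> \<rho> - c))" for x
    proof -
      have "0 \<le> E x" by (simp add: E_def)
      then have "(E x * R (\<tau> * (x \<bullet> e))) powr p = E x powr p * R (\<tau> * (x \<bullet> e)) powr p"
        using Rpos[of "\<tau> * (x \<bullet> e)"] by (intro powr_mult)
      then show ?thesis by (simp only: nV Ep mult.commute)
    qed
    have bounds: "exp (- k) powr p * exp (p * \<tau> * (x \<bullet> \<rho> - c)) \<le> norm (V x) powr p"
      "norm (V x) powr p \<le> exp k powr p * exp (p * \<tau> * (x \<bullet> \<rho> - c))" for x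
      unfolding Vp using R(2,3)[of "\<tau> * (x \<bullet> e)"] Rpos[of "\<tau> * (x \<bullet> e)"] p
      by (intro mult_right_mono powr_mono2; simp)+
    have div: "(\<integral>x. grad \<phi> x \<bullet> flux p (V x) \<partial>M) = 0" if \<phi>: "\<phi> \<in> test_functions \<Omega>" for \<phi>
    proof -
      define F where "F x = exp ((p - 1) * \<tau> * (x \<bullet> \<rho> - c))" for x :: "real^'n"
      define A where "A x = F x * \<alpha> (\<tau> * (x \<bullet> e))" for x
      define B where "B x = - (F x * \<beta> (\<tau> * (x \<bullet> e)))" for x
      define A' where "A' x = (p - 1) * \<tau> * A x" for x
      have contF: "continuous_on UNIV F" unfolding F_def by (intro continuous_intros)
      have contAB: "continuous_on UNIV A" "continuous_on UNIV B" "continuous_on UNIV A'" "continuous_on UNIV (\<lambda>x. - A' x)"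
        unfolding A_def B_def A'_def by (intro continuous_intros contF comp conta cont)+
      have FE: "E x powr (p - 2) * E x = F x" for x
      proof -
        have "E x powr (p - 2) * E x = E x powr (p - 1)"
          using powr_mult_base[of "E x" "p - 2"] by (simp add: E_def mult.commute)
        then show ?thesis by (simp add: E_def F_def powr_def mult.assoc)
      qed
      have fl: "flux p (V x) = A x *\<^sub>R \<rho> + B x *\<^sub>R e" for x
      proof -
        let ?y = "\<tau> * (x \<bullet> e)"
        have "norm (V x) powr (p - 2) = E x powr (p - 2) * R ?y powr (p - 2)"
          unfolding nV using Rpos[of ?y] by (simp add: powr_mult E_def)
        then have "flux p (V x) = ((E x powr (p - 2) * E x) * (R ?y powr (p - 2) * a ?y)) *\<^sub>R \<rho>
            - ((E x powr (p - 2) * E x) * (R ?y powr (p - 2) * b ?y)) *\<^sub>R e"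
          by (simp add: flux_def V_def scaleR_diff_right mult.assoc mult.left_commute)
        then show ?thesis by (simp add: FE A_def B_def \<alpha>)
      qed
      have 1: "(\<integral>x. A x * (grad \<phi> x \<bullet> \<rho>) \<partial>M) = - (\<integral>x. A' x * \<phi> x \<partial>M)"
      proof (rule test_integration_by_parts[OF \<phi> _ contAB(1,3)])
        fix x
        have "((\<lambda>t. exp ((p - 1) * \<tau> * (x \<bullet> \<rho> + t - c)) * \<alpha> (\<tau> * (x \<bullet> e))) has_real_derivative A' x) (at 0)"
          by (auto intro!: derivative_eq_intros simp: A'_def A_def F_def)
        moreover have "\<rho> \<bullet> \<rho> = 1" using \<rho> by (simp add: dot_square_norm)
        ultimately show "((\<lambda>t. A (x + t *\<^sub>R \<rho>)) has_real_derivative A' x) (at 0)"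
          using \<rho>(3) by (simp add: A_def F_def inner_add_left)
      qed
      have 2: "(\<integral>x. B x * (grad \<phi> x \<bullet> e) \<partial>M) = - (\<integral>x. - A' x * \<phi> x \<partial>M)"
      proof (rule test_integration_by_parts[OF \<phi> _ contAB(2,4)])
        fix x
        have l: "((\<lambda>t. \<tau> * (x \<bullet> e + t)) has_real_derivative \<tau>) (at 0)"
          by (auto intro!: derivative_eq_intros)
        have "((\<lambda>t. \<beta> (\<tau> * (x \<bullet> e + t))) has_real_derivative (p - 1) * \<alpha> (\<tau> * (x \<bullet> e)) * \<tau>) (at 0)"
          using DERIV_chain2[of \<beta>, OF _ l] \<beta>[of "\<tau> * (x \<bullet> e)"] by simp
        from DERIV_cmult[OF this, of "- F x"]
        have "((\<lambda>t. - (F x * \<beta> (\<tau> * (x \<bullet> e + t)))) has_real_derivative - A' x) (at 0)"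
          by (simp add: A'_def A_def mult_ac)
        moreover have "e \<bullet> e = 1" "e \<bullet> \<rho> = 0" using \<rho> by (simp_all add: dot_square_norm inner_commute)
        ultimately show "((\<lambda>t. B (x + t *\<^sub>R e)) has_real_derivative - A' x) (at 0)"
          by (simp add: B_def F_def inner_add_left)
      qed
      have int: "integrable M (\<lambda>x. A x * (grad \<phi> x \<bullet> \<rho>))" "integrable M (\<lambda>x. B x * (grad \<phi> x \<bullet> e))"
        by (intro integrable_continuous_M continuous_intros test_continuous[OF \<phi>]
            continuous_on_subset[OF contAB(1) subset_UNIV] continuous_on_subset[OF contAB(2) subset_UNIV])+
      have "(\<integral>x. grad \<phi> x \<bullet> flux p (V x) \<partial>M) = (\<integral>x. A x * (grad \<phi> x \<bullet> \<rho>) + B x * (grad \<phi> x \<bullet> e) \<partial>M)"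
        unfolding fl by (simp add: inner_add_right)
      also have "\<dots> = (\<integral>x. A x * (grad \<phi> x \<bullet> \<rho>) \<partial>M) + (\<integral>x. B x * (grad \<phi> x \<bullet> e) \<partial>M)"
        by (rule Bochner_Integration.integral_add[OF int])
      also have "\<dots> = 0" unfolding 1 2 by simp
      finally show ?thesis .
    qed
    show ?thesis using wgrad_C1[OF dv contV] contV bounds div by blast
  qed
  show ?thesis by (rule that[of "exp (- k) powr p" "exp k powr p"]) (use main in auto)
qed

section \<open>Concentration at a boundary point\<close>

text \<open>
The hyperplane supporting \<open>\<Omega>\<close> at \<open>x0\<close> meets the closure of \<open>\<Omega>\<close> only in \<open>x0\<close>, since another common
point would span a segment inside the frontier. By compactness, the part of the closure outside a
ball about \<open>x0\<close> stays a positive distance below the hyperplane.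
\<close>

lemma supporting_direction:
  fixes \<Omega> :: "'a::euclidean_space set"
  assumes "strictly_convex \<Omega>" "open \<Omega>" "bounded \<Omega>" and x0: "x0 \<in> frontier \<Omega>"
  obtains \<rho> where "norm \<rho> = 1"
    "\<And>d. d > 0 \<Longrightarrow> \<exists>\<epsilon>>0. \<forall>x\<in>closure \<Omega>. x0 \<bullet> \<rho> - \<epsilon> < x \<bullet> \<rho> \<longrightarrow> dist x x0 < d"
proof -
  have conv: "convex \<Omega>" using assms(1) by (simp add: strictly_convex_def)
  have x0c: "x0 \<in> closure \<Omega>" "x0 \<notin> \<Omega>"
    using x0 assms(2) by (auto simp: frontier_def interior_open)
  have rel: "rel_interior \<Omega> = \<Omega>" using assms(2) by (rule rel_interior_open)
  obtain a where a: "a \<noteq> 0" "\<And>y. y \<in> closure \<Omega> \<Longrightarrow> a \<bullet> x0 \<le> a \<bullet> y" "\<And>y. y \<in> \<Omega> \<Longrightarrow> a \<bullet> x0 < a \<bullet> y"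
    using supporting_hyperplane_relative_frontier[OF conv x0c(1)] x0c(2) unfolding rel by metis
  define \<rho> where "\<rho> = (- 1 / norm a) *\<^sub>R a"
  have ip: "x \<bullet> \<rho> = - (a \<bullet> x) / norm a" for x by (simp add: \<rho>_def inner_commute)
  have n: "norm \<rho> = 1" using a(1) by (simp add: \<rho>_def)
  have le: "x \<bullet> \<rho> \<le> x0 \<bullet> \<rho>" if "x \<in> closure \<Omega>" for x
    using a(2)[OF that] a(1) unfolding ip by (intro divide_right_mono) auto
  have lt: "x \<bullet> \<rho> < x0 \<bullet> \<rho>" if "x \<in> \<Omega>" for x
    using a(3)[OF that] a(1) unfolding ip by (intro divide_strict_right_mono) auto
  have strict: "x \<bullet> \<rho> < x0 \<bullet> \<rho>" if x: "x \<in> closure \<Omega>" "x \<noteq> x0" for x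
  proof (rule ccontr)
    assume "\<not> x \<bullet> \<rho> < x0 \<bullet> \<rho>"
    then have eq: "x \<bullet> \<rho> = x0 \<bullet> \<rho>" using le[OF x(1)] by simp
    have "closed_segment x0 x \<subseteq> frontier \<Omega>"
    proof
      fix y assume y: "y \<in> closed_segment x0 x"
      have "closed_segment x0 x \<subseteq> closure \<Omega>"
        by (rule closed_segment_subset[OF x0c(1) x(1) convex_closure[OF conv]])
      then have "y \<in> closure \<Omega>" using y by blast
      moreover obtain u where u: "y = (1 - u) *\<^sub>R x0 + u *\<^sub>R x" using y by (auto simp: in_segment)
      have "y \<bullet> \<rho> = (1 - u) * (x0 \<bullet> \<rho>) + u * (x \<bullet> \<rho>)" by (simp only: u inner_add_left inner_scaleR_left)
      then have "y \<bullet> \<rho> = x0 \<bullet> \<rho>" by (simp add: eq algebra_simps)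
      then have "y \<notin> \<Omega>" using lt[of y] by auto
      ultimately show "y \<in> frontier \<Omega>" using assms(2) by (simp add: frontier_def interior_open)
    qed
    then show False using assms(1) x(2) unfolding strictly_convex_def by metis
  qed
  have "\<exists>\<epsilon>>0. \<forall>x\<in>closure \<Omega>. x0 \<bullet> \<rho> - \<epsilon> < x \<bullet> \<rho> \<longrightarrow> dist x x0 < d" if d: "d > 0" for d
  proof (cases "closure \<Omega> - ball x0 d = {}")
    case True
    then show ?thesis by (intro exI[of _ 1]) (auto simp: dist_commute)
  next
    case False
    have cpt: "compact (closure \<Omega> - ball x0 d)"
      using assms(3) by (intro compact_diff) (auto simp: compact_closure)
    have "continuous_on (closure \<Omega> - ball x0 d) (\<lambda>x. x \<bullet> \<rho>)" by (intro continuous_intros)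
    from continuous_attains_sup[OF cpt False this]
    obtain y where y: "y \<in> closure \<Omega> - ball x0 d" "\<And>x. x \<in> closure \<Omega> - ball x0 d \<Longrightarrow> x \<bullet> \<rho> \<le> y \<bullet> \<rho>"
      by blast
    have "y \<noteq> x0" using y(1) d by auto
    then have "y \<bullet> \<rho> < x0 \<bullet> \<rho>" using strict y(1) by blast
    moreover have "dist x x0 < d" if "x \<in> closure \<Omega>" "y \<bullet> \<rho> < x \<bullet> \<rho>" for x
      using y(2)[of x] that by (force simp: dist_commute)
    ultimately show ?thesis by (intro exI[of _ "x0 \<bullet> \<rho> - y \<bullet> \<rho>"]) auto
  qed
  note near = this
  show ?thesis by (rule that[OF n]) (rule near)
qed

text \<open>
Split the domain where \<open>x \<bullet> \<rho>\<close> is \<open>\<epsilon>/2\<close> or \<open>\<epsilon>\<close> less than its value at \<open>x0\<close>. Down to depth \<open>\<epsilon>\<close> the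
function \<open>h\<close> is negative. The layer above depth \<open>\<epsilon>/2\<close> has positive measure and contributes at most
a negative multiple of \<open>exp (- p \<tau> \<epsilon> / 2)\<close>, whereas what lies below depth \<open>\<epsilon>\<close> contributes at most
a multiple of the much smaller \<open>exp (- p \<tau> \<epsilon>)\<close>.
\<close>

lemma (in bounded_domain) negative_at_peak_imp_negative_integral:
  assumes x0c: "x0 \<in> closure \<Omega>"
    and \<rho>: "\<And>d. d > 0 \<Longrightarrow> \<exists>\<epsilon>>0. \<forall>x\<in>closure \<Omega>. x0 \<bullet> \<rho> - \<epsilon> < x \<bullet> \<rho> \<longrightarrow> dist x x0 < d"
    and h: "continuous_on (closure \<Omega>) h" "h x0 < (0::real)"
    and mK: "m > 0" "K > 0"
  obtains \<tau> where "\<tau> > 0" "\<And>w. continuous_on (closure \<Omega>) w \<Longrightarrow>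
     (\<And>x. m * exp (p * \<tau> * (x \<bullet> \<rho> - x0 \<bullet> \<rho>)) \<le> w x) \<Longrightarrow> (\<And>x. w x \<le> K * exp (p * \<tau> * (x \<bullet> \<rho> - x0 \<bullet> \<rho>))) \<Longrightarrow>
     (\<integral>x. h x * w x \<partial>M) < 0"
proof -
  define \<delta> where "\<delta> = - h x0 / 2"
  have \<delta>: "\<delta> > 0" using h by (simp add: \<delta>_def)
  obtain d where d: "d > 0" "\<And>x. x \<in> closure \<Omega> \<Longrightarrow> dist x x0 < d \<Longrightarrow> dist (h x) (h x0) < \<delta>"
    using h(1) x0c \<delta> unfolding continuous_on_iff by metis
  have hneg: "h x \<le> - \<delta>" if "x \<in> closure \<Omega>" "dist x x0 < d" for x
    using d(2)[OF that] by (simp add: dist_real_def \<delta>_def abs_if split: if_splits)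
  obtain \<epsilon> where \<epsilon>: "\<epsilon> > 0" "\<And>x. x \<in> closure \<Omega> \<Longrightarrow> x0 \<bullet> \<rho> - \<epsilon> < x \<bullet> \<rho> \<Longrightarrow> dist x x0 < d"
    using \<rho>[OF d(1)] by blast
  obtain H where H: "H > 0" "\<And>x. x \<in> closure \<Omega> \<Longrightarrow> norm (h x) \<le> H"
    using continuous_bounded_on_\<Omega>[OF h(1)] by blast
  define W where "W = \<Omega> \<inter> {x. x0 \<bullet> \<rho> - \<epsilon> / 2 < x \<bullet> \<rho>}"
  have halfspace: "open {x. x0 \<bullet> \<rho> - \<epsilon> / 2 < x \<bullet> \<rho>}"
    by (intro open_Collect_less continuous_intros)
  then have openW: "open W" unfolding W_def using open_\<Omega> by (rule open_Int[rotated])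
  have "{x. x0 \<bullet> \<rho> - \<epsilon> / 2 < x \<bullet> \<rho>} \<inter> \<Omega> \<noteq> {}"
  proof -
    have "x0 \<in> {x. x0 \<bullet> \<rho> - \<epsilon> / 2 < x \<bullet> \<rho>}" using \<epsilon>(1) by simp
    then show ?thesis unfolding open_Int_closure_eq_empty[OF halfspace, of \<Omega>, symmetric] using x0c by blast
  qed
  then obtain y where "y \<in> W" unfolding W_def by blast
  then obtain r where r: "r > 0" "ball y r \<subseteq> W" using openW unfolding open_contains_ball by blast
  have lmW: "W \<in> lmeasurable"
    using bounded_\<Omega> openW by (intro bounded_set_imp_lmeasurable) (auto simp: W_def)
  define \<mu> where "\<mu> = measure M W"
  have "measure M W = measure lebesgue W"
    using openW by (intro measure_restrict_space) (auto simp: W_def)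
  moreover have "measure lebesgue (ball y r) \<le> measure lebesgue W"
    by (rule measure_mono_fmeasurable[OF r(2) _ lmW]) simp
  moreover have "0 < measure lebesgue (ball y r)" using content_ball_pos[OF r(1), of y] by simp
  ultimately have \<mu>: "\<mu> > 0" unfolding \<mu>_def by linarith
  define C where "C = H * K * measure M (space M)"
  have C: "C \<ge> 0" using H(1) mK by (simp add: C_def)
  \<comment> \<open>Large enough for \<open>\<delta> * m * \<mu> * exp X\<close> to exceed \<open>C\<close>, by \<open>1 + X \<le> exp X\<close>.\<close>
  define \<tau> where "\<tau> = 2 / (p * \<epsilon>) * ((C + 1) / (\<delta> * m * \<mu>))"
  have pos: "\<delta> * m * \<mu> > 0" using \<delta> mK \<mu> by simp
  have \<tau>: "\<tau> > 0" using p \<epsilon>(1) C pos by (simp add: \<tau>_def)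
  define X where "X = p * \<tau> * \<epsilon> / 2"
  have X: "X = (C + 1) / (\<delta> * m * \<mu>)" 
  proof -
    have "a * (2 / (a * b) * Q) * b / 2 = Q" if "a \<noteq> 0" "b \<noteq> 0" for a b Q :: real using that by simp
    then show ?thesis using p \<epsilon>(1) by (simp only: X_def \<tau>_def)
  qed
  show ?thesis
  proof (rule that[OF \<tau>])
    fix w assume w: "continuous_on (closure \<Omega>) w" "\<And>x. m * exp (p * \<tau> * (x \<bullet> \<rho> - x0 \<bullet> \<rho>)) \<le> w x"
      "\<And>x. w x \<le> K * exp (p * \<tau> * (x \<bullet> \<rho> - x0 \<bullet> \<rho>))"
    have w0: "w x \<ge> 0" for x using w(2)[of x] mK by (meson exp_ge_zero less_imp_le mult_nonneg_nonneg order_trans)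
    have pt: "h x * w x \<le> - (\<delta> * m * exp (- X)) * indicator W x + H * K * exp (- (2 * X))" if "x \<in> \<Omega>" for x
    proof -
      have xc: "x \<in> closure \<Omega>" using that closure_subset by auto
      have HK: "0 \<le> H * K * exp (- (2 * X))" using H(1) mK by simp
      have pt0: "p * \<tau> > 0" using p \<tau> by simp
      consider "x \<in> W" | "x \<notin> W" "x0 \<bullet> \<rho> - \<epsilon> < x \<bullet> \<rho>" | "x \<notin> W" "x \<bullet> \<rho> \<le> x0 \<bullet> \<rho> - \<epsilon>" by linarith
      then show ?thesis
      proof cases
        case 1
        then have s: "- (\<epsilon> / 2) \<le> x \<bullet> \<rho> - x0 \<bullet> \<rho>" "x0 \<bullet> \<rho> - \<epsilon> < x \<bullet> \<rho>" using \<epsilon>(1) by (auto simp: W_def)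
        have "p * \<tau> * (- (\<epsilon> / 2)) \<le> p * \<tau> * (x \<bullet> \<rho> - x0 \<bullet> \<rho>)" using s(1) pt0 by (intro mult_left_mono) auto
        then have "exp (- X) \<le> exp (p * \<tau> * (x \<bullet> \<rho> - x0 \<bullet> \<rho>))" by (simp add: X_def)
        then have "m * exp (- X) \<le> w x" using w(2)[of x] mK by (meson less_imp_le mult_left_mono order_trans)
        then have "\<delta> * (m * exp (- X)) \<le> \<delta> * w x" using \<delta> by (intro mult_left_mono) auto
        moreover have "h x * w x \<le> (- \<delta>) * w x" using hneg[OF xc \<epsilon>(2)[OF xc s(2)]] w0 by (intro mult_right_mono) auto
        ultimately show ?thesis using 1 HK by (simp add: mult.assoc)
      next
        case 2
        have "h x \<le> 0" using hneg[OF xc \<epsilon>(2)[OF xc 2(2)]] \<delta> by linarith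
        then have "h x * w x \<le> 0" using w0 by (simp add: mult_nonpos_nonneg)
        then show ?thesis using 2(1) HK by simp
      next
        case 3
        have "p * \<tau> * (x \<bullet> \<rho> - x0 \<bullet> \<rho>) \<le> p * \<tau> * (- \<epsilon>)" using 3(2) pt0 by (intro mult_left_mono) auto
        also have "\<dots> = - (2 * X)" by (simp add: X_def)
        finally have "K * exp (p * \<tau> * (x \<bullet> \<rho> - x0 \<bullet> \<rho>)) \<le> K * exp (- (2 * X))" using mK by simp
        then have "w x \<le> K * exp (- (2 * X))" using w(3)[of x] by linarith
        moreover have "h x \<le> H" using H(2)[OF xc] by simp
        ultimately have "h x * w x \<le> H * (K * exp (- (2 * X)))" using w0 H(1) by (intro mult_mono) auto
        then show ?thesis using 3(1) by (simp add: mult.assoc)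
      qed
    qed
    have Wsets: "W \<in> sets M" using openW by (auto simp: sets_restrict_space_iff W_def)
    have indint: "integrable M (indicator W :: _ \<Rightarrow> real)"
      using finite_measure.emeasure_finite[OF finite_M] Wsets by (intro integrable_real_indicator) (auto simp: less_top)
    have cint: "integrable M (\<lambda>x. H * K * exp (- (2 * X)))" by (rule finite_measure.integrable_const[OF finite_M])
    have "(\<integral>x. h x * w x \<partial>M) \<le> (\<integral>x. - (\<delta> * m * exp (- X)) * indicator W x + H * K * exp (- (2 * X)) \<partial>M)"
      by (intro integral_mono Bochner_Integration.integrable_add Bochner_Integration.integrable_mult_right indint cint
          integrable_continuous_M continuous_intros h w pt) auto
    also have "\<dots> = - (\<delta> * m * exp (- X)) * \<mu> + C * exp (- (2 * X))"
    proof -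
      have "(\<integral>x. - (\<delta> * m * exp (- X)) * indicator W x + H * K * exp (- (2 * X)) \<partial>M)
        = (\<integral>x. - (\<delta> * m * exp (- X)) * indicator W x \<partial>M) + (\<integral>x. H * K * exp (- (2 * X)) \<partial>M)"
        by (intro Bochner_Integration.integral_add Bochner_Integration.integrable_mult_right indint cint)
      moreover have "W \<inter> space M = W" by (auto simp: W_def)
      ultimately show ?thesis by (simp add: C_def \<mu>_def)
    qed
    also have "\<dots> = exp (- (2 * X)) * (C - \<delta> * m * \<mu> * exp X)"
    proof -
      have "exp (- X) = exp (- (2 * X)) * exp X" by (simp flip: exp_add)
      then show ?thesis by (simp add: algebra_simps)
    qed
    also have "\<dots> < 0"
    proof -
      have "(\<delta> * m * \<mu>) * (1 + X) \<le> (\<delta> * m * \<mu>) * exp X" using pos exp_ge_add_one_self[of X] by (intro mult_left_mono) auto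
      moreover have "(\<delta> * m * \<mu>) * X = C + 1" 
      proof -
        have div: "a * (b / a) = b" if "a > 0" for a b :: real using that by simp
        show ?thesis unfolding X by (rule div[OF pos])
      qed
      ultimately have "C - \<delta> * m * \<mu> * exp X < 0" using pos by (simp add: distrib_left)
      then show ?thesis by (simp add: mult_pos_neg)
    qed
    finally show "(\<integral>x. h x * w x \<partial>M) < 0" .
  qed
qed

section \<open>Boundary determination\<close>

text \<open>
If this failed, \<open>\<sigma>1\<close> would lie below the weight \<open>g\<close> of the lower energy bound for \<open>\<sigma>2\<close> near \<open>x0\<close>, and
a sufficiently concentrated Wolff solution would have a smaller minimal energy for \<open>\<sigma>1\<close> than for
\<open>\<sigma>2\<close>.
\<close>

lemma boundary_value_ge:
  fixes \<Omega> :: "(real^'n) set"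
  assumes "CARD('n) \<ge> 2" and sc: "strictly_convex \<Omega>"
    and c1: "conductivity \<Omega> p \<sigma>1" and c2: "conductivity \<Omega> p \<sigma>2"
    and DN: "DN_map \<Omega> p \<sigma>1 = DN_map \<Omega> p \<sigma>2"
    and x0: "x0 \<in> frontier \<Omega>"
  shows "\<sigma>2 x0 \<le> \<sigma>1 x0"
proof (rule ccontr)
  assume neg: "\<not> \<sigma>2 x0 \<le> \<sigma>1 x0"
  interpret A: conductivity \<Omega> p \<sigma>1 by fact
  interpret B: conductivity \<Omega> p \<sigma>2 by fact
  have x0c: "x0 \<in> closure \<Omega>" using x0 by (simp add: frontier_def)
  define l where "l = \<sigma>2 x0"
  have l: "l > 0" using B.pos_\<sigma> x0c by (simp add: l_def)
  define g where "g x = p * l - (p - 1) * l * (l / \<sigma>2 x) powr (1 / (p - 1))" for x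
  define h where "h x = \<sigma>1 x - g x" for x
  have "\<forall>x\<in>closure \<Omega>. \<sigma>2 x \<noteq> 0" "\<forall>x\<in>closure \<Omega>. l / \<sigma>2 x \<noteq> 0"
    using B.pos_\<sigma> l by force+
  then have contg: "continuous_on (closure \<Omega>) g"
    unfolding g_def by (intro continuous_intros B.cont_\<sigma>)
  have conth: "continuous_on (closure \<Omega>) h" unfolding h_def by (intro continuous_intros A.cont_\<sigma> contg)
  have "g x0 = l" using l by (simp add: g_def l_def[symmetric] algebra_simps)
  then have h0: "h x0 < 0" using neg by (simp add: h_def l_def)
  obtain \<rho> where \<rho>: "norm \<rho> = 1"
    "\<And>d. d > 0 \<Longrightarrow> \<exists>\<epsilon>>0. \<forall>x\<in>closure \<Omega>. x0 \<bullet> \<rho> - \<epsilon> < x \<bullet> \<rho> \<longrightarrow> dist x x0 < d"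
    using supporting_direction[OF sc A.open_\<Omega> A.bounded_\<Omega> x0] by blast
  obtain e' where e': "e' \<noteq> 0" "orthogonal \<rho> e'"
    using orthogonal_to_vector_exists[of \<rho>] assms(1) by auto
  define e where "e = (1 / norm e') *\<^sub>R e'"
  have e: "norm e = 1" "\<rho> \<bullet> e = 0" using e' by (auto simp: e_def orthogonal_def)
  obtain m K where mK: "m > 0" "K > 0" and sol: "\<And>\<tau>. \<tau> > 0 \<Longrightarrow> \<exists>v V. A.wgrad v V \<and> continuous_on UNIV V
      \<and> (\<forall>x. m * exp (p * \<tau> * (x \<bullet> \<rho> - x0 \<bullet> \<rho>)) \<le> norm (V x) powr p \<and> norm (V x) powr p \<le> K * exp (p * \<tau> * (x \<bullet> \<rho> - x0 \<bullet> \<rho>)))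
      \<and> (\<forall>\<phi>\<in>test_functions \<Omega>. (\<integral>x. grad \<phi> x \<bullet> flux p (V x) \<partial>lebesgue_on \<Omega>) = 0)"
  proof (rule A.wolff_solutions[OF \<rho>(1) e, of "x0 \<bullet> \<rho>"], goal_cases)
    case (1 m K)
    show ?case by (rule that) (rule 1; assumption?)+
  qed
  obtain \<tau> where \<tau>: "\<tau> > 0" and int_neg: "\<And>w. continuous_on (closure \<Omega>) w \<Longrightarrow>
     (\<And>x. m * exp (p * \<tau> * (x \<bullet> \<rho> - x0 \<bullet> \<rho>)) \<le> w x) \<Longrightarrow> (\<And>x. w x \<le> K * exp (p * \<tau> * (x \<bullet> \<rho> - x0 \<bullet> \<rho>))) \<Longrightarrow>
     (\<integral>x. h x * w x \<partial>lebesgue_on \<Omega>) < 0"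
  proof (rule A.negative_at_peak_imp_negative_integral[OF x0c _ conth h0 mK, of \<rho>], goal_cases)
    case (1 d)
    show ?case using 1(2) by (rule \<rho>(2))
  next
    case (2 \<tau>)
    show ?case by (rule that) (rule 2; assumption?)+
  qed
  obtain v V where V: "A.wgrad v V" "continuous_on UNIV V"
    "\<And>x. m * exp (p * \<tau> * (x \<bullet> \<rho> - x0 \<bullet> \<rho>)) \<le> norm (V x) powr p"
    "\<And>x. norm (V x) powr p \<le> K * exp (p * \<tau> * (x \<bullet> \<rho> - x0 \<bullet> \<rho>))"
    "\<And>\<phi>. \<phi> \<in> test_functions \<Omega> \<Longrightarrow> (\<integral>x. grad \<phi> x \<bullet> flux p (V x) \<partial>lebesgue_on \<Omega>) = 0"
    using sol[OF \<tau>] by blast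
  have contV: "continuous_on (closure \<Omega>) V" using V(2) by (rule continuous_on_subset) simp
  have contN: "continuous_on (closure \<Omega>) (\<lambda>x. norm (V x) powr p)"
    using A.p by (intro continuous_on_powr' continuous_intros contV) auto
  have v: "v \<in> W1p \<Omega> p" using V(1) by (auto simp: A.W1p_iff)
  have "A.min_energy v = B.min_energy v"
    using A.DN_map_diagonal[OF v] B.DN_map_diagonal[OF v] DN by simp
  moreover have "A.min_energy v \<le> A.grad_energy V" by (rule A.min_energy_le[OF V(1)])
  moreover have "(\<integral>x. g x * norm (V x) powr p \<partial>lebesgue_on \<Omega>) \<le> B.min_energy v"
    unfolding g_def by (rule B.min_energy_ge[OF V(1) contV V(5) l])
  ultimately have "(\<integral>x. g x * norm (V x) powr p \<partial>lebesgue_on \<Omega>) \<le> A.grad_energy V" by simp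
  moreover have "(\<integral>x. h x * norm (V x) powr p \<partial>lebesgue_on \<Omega>)
     = A.grad_energy V - (\<integral>x. g x * norm (V x) powr p \<partial>lebesgue_on \<Omega>)"
  proof -
    have "(\<integral>x. \<sigma>1 x * norm (V x) powr p - g x * norm (V x) powr p \<partial>lebesgue_on \<Omega>)
      = (\<integral>x. \<sigma>1 x * norm (V x) powr p \<partial>lebesgue_on \<Omega>) - (\<integral>x. g x * norm (V x) powr p \<partial>lebesgue_on \<Omega>)"
      by (intro Bochner_Integration.integral_diff A.integrable_continuous_M continuous_intros A.cont_\<sigma> contg contN)
    then show ?thesis by (simp only: h_def left_diff_distrib A.grad_energy_def)
  qed
  ultimately show False using int_neg[OF contN V(3,4)] by simp
qed

theorem theorem1p2:
  fixes p :: real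
    and \<Omega> :: "(real^'n) set"
    and \<sigma>1 \<sigma>2 :: "real^'n \<Rightarrow> real"
  assumes "CARD('n) \<ge> 2"
    and "1 < p"
    and "bounded \<Omega>" and "open \<Omega>" and "strictly_convex \<Omega>"
    and "continuous_on (closure \<Omega>) \<sigma>1" and "\<forall>x\<in>closure \<Omega>. 0 < \<sigma>1 x"
    and "continuous_on (closure \<Omega>) \<sigma>2" and "\<forall>x\<in>closure \<Omega>. 0 < \<sigma>2 x"
    and "DN_map \<Omega> p \<sigma>1 = DN_map \<Omega> p \<sigma>2"
  shows "\<forall>x\<in>frontier \<Omega>. \<sigma>1 x = \<sigma>2 x"
proof
  fix x assume x: "x \<in> frontier \<Omega>"
  have dom: "bounded_domain \<Omega> p" using assms(2-4) by unfold_locales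
  have c1: "conductivity \<Omega> p \<sigma>1" and c2: "conductivity \<Omega> p \<sigma>2"
    using dom assms(6-9) by (auto simp: conductivity_def conductivity_axioms_def)
  show "\<sigma>1 x = \<sigma>2 x"
    using boundary_value_ge[OF assms(1,5) c1 c2 assms(10) x]
      boundary_value_ge[OF assms(1,5) c2 c1 assms(10)[symmetric] x] by simp
qed

end
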